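(* Let $(f_n)_{n\ge 0}$ be a uniformly attracting sequence of automorphisms of $\mathbb C^2$ with constants $1>D>C>0$, i.e. $C\|z\|\le\|f_n(z)\|\le D\|z\|$ for all $n\in\mathbb N$ and all $z$ in the unit ball $\mathbb B$. Suppose that the maps $f_n$ all have order of contact $k$ (for one integer $k$ independent of $n$). Assume further that the linear part of each map $f_n$ is diagonal and that $$D^{k+1}<C.$$ Then the basin of attraction $\Omega_{(f_n)}$ is biholomorphic to $\mathbb C^2$.
   Context: An automorphism of $\mathbb C^2$ is a biholomorphic map $\mathbb C^2\to\mathbb C^2$. The sequence $(f_n)$ is called uniformly attracting if there are constants $1>D>C>0$, independent of $n$, such that $C\|z\|\le\|f_n(z)\|\le D\|z\|$ for all $n$ and all $z\in\mathbb B$, where $\mathbb B$ is the unit ball of $\mathbb C^2$ for the Euclidean norm (in particular $f_n(0)=0$). The basin of attraction is $\Omega_{(f_n)}=\{z\in\mathbb C^2 : f_n\circ\cdots\circ f_0(z)\to 0 \text{ as } n\to\infty\}$. A map $f$ has order of contact $k$ if $f(z)=l(z)+O(\|z\|^k)$ as $z\to0$, where $l$ is linear. The linear part of $f_n$ is $Df_n(0)$, diagonal in the standard coordinates of $\mathbb C^2$. *)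

theory Defs
  imports "HOL-Analysis.Analysis" "HOL-Library.Landau_Symbols"
begin

abbreviation complex_linear :: "(complex ^ 'n \<Rightarrow> complex ^ 'm) \<Rightarrow> bool"
  where "complex_linear \<equiv> Vector_Spaces.linear (*s) (*s)"

text \<open>Holomorphy of a map of several complex variables on an open set: at every point the map has a
  total derivative that is complex linear.\<close>

definition holomorphic_map_on :: "(complex ^ 'n \<Rightarrow> complex ^ 'm) \<Rightarrow> (complex ^ 'n) set \<Rightarrow> bool"
  where "holomorphic_map_on f S \<longleftrightarrow>
    open S \<and> (\<forall>z\<in>S. \<exists>L. complex_linear L \<and> (f has_derivative L) (at z))"

definition biholomorphism ::
  "(complex ^ 'n) set \<Rightarrow> (complex ^ 'm) set \<Rightarrow>
    (complex ^ 'n \<Rightarrow> complex ^ 'm) \<Rightarrow> (complex ^ 'm \<Rightarrow> complex ^ 'n) \<Rightarrow> bool"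
  where "biholomorphism S T f g \<longleftrightarrow>
    holomorphic_map_on f S \<and> f ` S = T \<and> (\<forall>z\<in>S. g (f z) = z) \<and>
    holomorphic_map_on g T \<and> g ` T = S \<and> (\<forall>w\<in>T. f (g w) = w)"

definition biholomorphic :: "(complex ^ 'n) set \<Rightarrow> (complex ^ 'm) set \<Rightarrow> bool"
  where "biholomorphic S T \<longleftrightarrow> (\<exists>f g. biholomorphism S T f g)"

definition holomorphic_automorphism :: "(complex ^ 'n \<Rightarrow> complex ^ 'n) \<Rightarrow> bool"
  where "holomorphic_automorphism f \<longleftrightarrow> (\<exists>g. biholomorphism UNIV UNIV f g)"

definition uniformly_attracting ::
  "real \<Rightarrow> real \<Rightarrow> (nat \<Rightarrow> complex ^ 'n \<Rightarrow> complex ^ 'n) \<Rightarrow> bool"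
  where "uniformly_attracting C D f \<longleftrightarrow>
    0 < C \<and> C < D \<and> D < 1 \<and>
    (\<forall>n. \<forall>z\<in>ball 0 1. C * norm z \<le> norm (f n z) \<and> norm (f n z) \<le> D * norm z)"

text \<open>\<open>compose_upto f n\<close> is \<open>f n \<circ> \<dots> \<circ> f 0\<close>; it includes both end points.\<close>

primrec compose_upto :: "(nat \<Rightarrow> 'a \<Rightarrow> 'a) \<Rightarrow> nat \<Rightarrow> 'a \<Rightarrow> 'a"
  where
    "compose_upto f 0 = f 0"
  | "compose_upto f (Suc n) = f (Suc n) \<circ> compose_upto f n"

definition basin_of_attraction :: "(nat \<Rightarrow> complex ^ 'n \<Rightarrow> complex ^ 'n) \<Rightarrow> (complex ^ 'n) set"
  where "basin_of_attraction f = {z. (\<lambda>n. compose_upto f n z) \<longlonglongrightarrow> 0}"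

definition order_of_contact :: "nat \<Rightarrow> (complex ^ 'n \<Rightarrow> complex ^ 'n) \<Rightarrow> bool"
  where "order_of_contact k f \<longleftrightarrow>
    (\<exists>l. complex_linear l \<and> (\<lambda>z. norm (f z - l z)) \<in> O[at 0](\<lambda>z. norm z ^ k))"

definition linear_part :: "(complex ^ 'n \<Rightarrow> complex ^ 'n) \<Rightarrow> complex ^ 'n ^ 'n"
  where "linear_part f = matrix (frechet_derivative f (at 0))"

definition diagonal_matrix :: "'a::zero ^ 'n ^ 'n \<Rightarrow> bool"
  where "diagonal_matrix A \<longleftrightarrow> (\<forall>i j. i \<noteq> j \<longrightarrow> A $ i $ j = 0)"

end

theory Submission
  imports Defs "HOL-Complex_Analysis.Complex_Analysis" "HOL-Library.Diagonal_Subsequence"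
begin

text \<open>
  Write \<open>\<lambda>\<^sub>1, \<lambda>\<^sub>2\<close> for the eigenvalues of the linear part at time \<open>n\<close>. Up to order \<open>k + 1\<close> the only
  obstruction to linearising the sequence are the coefficients of \<open>w\<^sup>k\<close> in the first and of \<open>z\<^sup>k\<close> in
  the second component: removing them leads to the backward recursion
  \<open>\<lambda>\<^sub>i c\<^sub>n = \<lambda>\<^sub>j\<^sup>k c\<^sub>n\<^sub>+\<^sub>1 + p\<^sub>n\<close> (with \<open>j\<close> the other index), whose factor may exceed 1 in absolute value. Since the
  product of the two factors (for \<open>i = 1, 2\<close>) is at most \<open>D\<^sup>2\<^sup>k\<^sup>-\<^sup>2\<close>, time can be cut into intervals
  (``trains''), with starting times growing at least by a factor \<open>k\<close>, such that on each train one of the two terms can be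
  removed with coefficients of size \<open>o(D\<^sup>-\<^sup>(\<^sup>k\<^sup>-\<^sup>1\<^sup>)\<^sup>n)\<close> which are bounded where the train starts.

  Thus the sequence is conjugate, on balls of radius comparable to \<open>D\<^sup>n\<close>, to a sequence of triangular
  automorphisms \<open>g\<^sub>n\<close> with bounded coefficients. On a train these compose to a single shear of degree \<open>k\<close>,
  and the growth of the trains compensates the growth of the degree, so the basin of \<open>(g\<^sub>n)\<close> is the
  whole space. The local conjugacies \<open>\<psi>\<^sub>n\<close> are limits of \<open>g\<^sub>n\<^sup>-\<^sup>1 \<dots> g\<^sub>N\<^sup>-\<^sup>1 \<circ> f\<^sub>N \<dots> f\<^sub>n\<close>, suitably
  normalised at time \<open>N\<close>; here \<open>D\<^sup>k\<^sup>+\<^sup>1 < C\<close> makes errors of order \<open>k + 1\<close> summable.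
\<close>

section \<open>Holomorphic maps in several variables\<close>

text \<open>A monomial of order k in component i that contains \<open>Z $ i\<close> acquires, when
  pulled back by one map and divided by the i-th eigenvalue, a product of k - 1 eigenvalues, of size
  at most D^(k-1) < 1; its recursion is always solved by a convergent sum. Only for the pure power
  of the other coordinate can the factor exceed 1, but D^(k+1) < C keeps it below 1/D. So a product
  of such factors beginning at time n cannot exceed D^(-(k-1)n) before time k n. Up to that size a
  coefficient of degree k is harmless on the ball of radius D^n, and the length of this time span is
  the origin of the growth factor k of the trains.

  Bounded coefficients are wanted where a train starts because there they enter the normal form, in
  the component that was not being cleared before.

  The local conjugacies come from compactness: bounds independent of N, an identity that is exact
  for each N, and a diagonal subsequence. The normalisation at time N is the shear with coefficients
  c_N, so that the comparison in \<open>Psi_bound\<close> starts with error zero.\<close>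

lemma complex_linearI:
  fixes L :: "complex ^ 'n \<Rightarrow> complex ^ 'm"
  assumes "\<And>x y. L (x + y) = L x + L y" "\<And>c x. L (c *s x) = c *s L x"
  shows "complex_linear L"
  using assms by (simp add: Vector_Spaces.linear_iff vec.vector_space_axioms)

lemma complex_linear_add:
  fixes L :: "complex ^ 'n \<Rightarrow> complex ^ 'm"
  assumes "complex_linear L" shows "L (x + y) = L x + L y"
  using assms by (simp add: Vector_Spaces.linear_iff)

lemma complex_linear_scale:
  fixes L :: "complex ^ 'n \<Rightarrow> complex ^ 'm"
  assumes "complex_linear L" shows "L (c *s x) = c *s L x"
  using assms by (simp add: Vector_Spaces.linear_iff)

lemma complex_linear_compose:
  fixes L :: "complex ^ 'n \<Rightarrow> complex ^ 'm" and M :: "complex ^ 'm \<Rightarrow> complex ^ 'k"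
  assumes "complex_linear L" "complex_linear M"
  shows "complex_linear (\<lambda>x. M (L x))"
  by (intro complex_linearI) (simp_all add: assms complex_linear_add complex_linear_scale)

text \<open>Only complex homogeneity is asked of \<open>L\<close>; additivity comes with
  \<open>has_derivative\<close>.\<close>

definition holomorphic_fun_on :: "(complex ^ 'n \<Rightarrow> complex) \<Rightarrow> (complex ^ 'n) set \<Rightarrow> bool"
  where "holomorphic_fun_on h S \<longleftrightarrow> open S \<and>
    (\<forall>z\<in>S. \<exists>L. (\<forall>c v. L (c *s v) = c * L v) \<and> (h has_derivative L) (at z))"

lemma has_derivative_vecI:
  fixes f :: "complex ^ 'n \<Rightarrow> complex ^ 'm"
  assumes "\<And>i. ((\<lambda>z. f z $ i) has_derivative L i) (at z)"
  shows "(f has_derivative (\<lambda>v. \<chi> i. L i v)) (at z)"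
proof -
  have eq: "w = (\<Sum>i\<in>UNIV. axis i (w $ i))" for w :: "complex ^ 'm"
    by (simp add: vec_eq_iff axis_def if_distrib cong: if_cong)
  have bl: "bounded_linear (\<lambda>c::complex. axis i c :: complex ^ 'm)" for i
    unfolding linear_conv_bounded_linear[symmetric]
    by (rule linearI) (simp_all add: vec_eq_iff axis_def)
  have "((\<lambda>z. \<Sum>i\<in>UNIV. axis i (f z $ i)) has_derivative
      (\<lambda>v. \<Sum>i\<in>UNIV. axis i (L i v))) (at z)"
    by (intro has_derivative_sum bounded_linear.has_derivative[OF bl] assms)
  then show ?thesis
    by (subst (asm) eq[symmetric], subst eq) simp
qed

lemma holomorphic_map_on_iff:
  fixes f :: "complex ^ 'n \<Rightarrow> complex ^ 'm"
  shows "holomorphic_map_on f S \<longleftrightarrow> open S \<and> (\<forall>i. holomorphic_fun_on (\<lambda>z. f z $ i) S)"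
proof
  assume f: "holomorphic_map_on f S"
  show "open S \<and> (\<forall>i. holomorphic_fun_on (\<lambda>z. f z $ i) S)"
    unfolding holomorphic_fun_on_def
  proof (intro conjI allI ballI)
    show "open S" using f by (simp add: holomorphic_map_on_def)
    then show "open S" .
    fix i z assume "z \<in> S"
    then obtain L where L: "complex_linear L" "(f has_derivative L) (at z)"
      using f by (auto simp: holomorphic_map_on_def)
    show "\<exists>L. (\<forall>c v. L (c *s v) = c * L v) \<and> ((\<lambda>z. f z $ i) has_derivative L) (at z)"
      by (rule exI[of _ "\<lambda>v. L v $ i"])
        (auto simp: complex_linear_scale[OF L(1)] intro!: bounded_linear.has_derivative[OF bounded_linear_vec_nth] L)
  qed
next
  assume *: "open S \<and> (\<forall>i. holomorphic_fun_on (\<lambda>z. f z $ i) S)"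
  show "holomorphic_map_on f S"
    unfolding holomorphic_map_on_def
  proof (intro conjI ballI)
    fix z assume "z \<in> S"
    then have "\<forall>i. \<exists>L. (\<forall>c v. L (c *s v) = c * L v) \<and> ((\<lambda>z. f z $ i) has_derivative L) (at z)"
      using * by (auto simp: holomorphic_fun_on_def)
    then obtain L where L: "\<And>i c v. L i (c *s v) = c * L i v"
      "\<And>i. ((\<lambda>z. f z $ i) has_derivative L i) (at z)" by metis
    have "linear (L i)" for i
      using L(2) has_derivative_linear by blast
    then have add: "L i (x + y) = L i x + L i y" for i x y
      by (simp add: linear_add)
    have "complex_linear (\<lambda>v. \<chi> i. L i v)"
      by (intro complex_linearI) (simp_all add: vec_eq_iff L(1) add)
    then show "\<exists>L. complex_linear L \<and> (f has_derivative L) (at z)"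
      using has_derivative_vecI[OF L(2)] by blast
  qed (use * in auto)
qed

lemma holomorphic_map_on_nth:
  "holomorphic_map_on f S \<Longrightarrow> holomorphic_fun_on (\<lambda>z. f z $ i) S"
  by (simp add: holomorphic_map_on_iff)

lemma holomorphic_map_on_open: "holomorphic_map_on f S \<Longrightarrow> open S"
  by (simp add: holomorphic_map_on_def)

lemma holomorphic_map_on_subset:
  "holomorphic_map_on f S \<Longrightarrow> open T \<Longrightarrow> T \<subseteq> S \<Longrightarrow> holomorphic_map_on f T"
  by (auto simp: holomorphic_map_on_def)

lemma holomorphic_map_on_continuous:
  "holomorphic_map_on f S \<Longrightarrow> continuous_on S f"
  unfolding holomorphic_map_on_def
  by (meson continuous_at_imp_continuous_on has_derivative_continuous)

lemma holomorphic_fun_on_const: "open S \<Longrightarrow> holomorphic_fun_on (\<lambda>z. c) S"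
  unfolding holomorphic_fun_on_def by (force intro: exI[of _ "\<lambda>v. 0"])

lemma holomorphic_fun_on_nth: "open S \<Longrightarrow> holomorphic_fun_on (\<lambda>z. z $ i) S"
  unfolding holomorphic_fun_on_def
  by (auto intro!: exI[of _ "\<lambda>v. v $ i"] bounded_linear_imp_has_derivative bounded_linear_vec_nth)

lemma holomorphic_fun_on_add:
  assumes "holomorphic_fun_on g S" "holomorphic_fun_on h S"
  shows "holomorphic_fun_on (\<lambda>z. g z + h z) S"
  unfolding holomorphic_fun_on_def
proof (intro conjI ballI)
  fix z assume "z \<in> S"
  then obtain L M where "\<And>c v. L (c *s v) = c * L v" "(g has_derivative L) (at z)"
    "\<And>c v. M (c *s v) = c * M v" "(h has_derivative M) (at z)"
    using assms unfolding holomorphic_fun_on_def by blast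
  then show "\<exists>L. (\<forall>c v. L (c *s v) = c * L v) \<and> ((\<lambda>z. g z + h z) has_derivative L) (at z)"
    by (intro exI[of _ "\<lambda>v. L v + M v"]) (auto simp: distrib_left intro: has_derivative_add)
qed (use assms in \<open>auto simp: holomorphic_fun_on_def\<close>)

lemma holomorphic_fun_on_mult:
  assumes "holomorphic_fun_on g S" "holomorphic_fun_on h S"
  shows "holomorphic_fun_on (\<lambda>z. g z * h z) S"
  unfolding holomorphic_fun_on_def
proof (intro conjI ballI)
  fix z assume "z \<in> S"
  then obtain L M where "\<And>c v. L (c *s v) = c * L v" "(g has_derivative L) (at z)"
    "\<And>c v. M (c *s v) = c * M v" "(h has_derivative M) (at z)"
    using assms unfolding holomorphic_fun_on_def by blast
  then show "\<exists>L. (\<forall>c v. L (c *s v) = c * L v) \<and> ((\<lambda>z. g z * h z) has_derivative L) (at z)"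
    by (intro exI[of _ "\<lambda>v. g z * M v + L v * h z"])
      (auto simp: algebra_simps intro: has_derivative_eq_rhs[OF has_derivative_mult])
qed (use assms in \<open>auto simp: holomorphic_fun_on_def\<close>)

lemma holomorphic_fun_on_power:
  "holomorphic_fun_on g S \<Longrightarrow> holomorphic_fun_on (\<lambda>z. g z ^ k) S"
proof (induction k)
  case 0
  then show ?case
    using holomorphic_fun_on_const[of S 1] by (simp add: holomorphic_fun_on_def)
next
  case (Suc k)
  then show ?case using holomorphic_fun_on_mult by auto
qed

lemma holomorphic_fun_on_diff:
  assumes "holomorphic_fun_on g S" "holomorphic_fun_on h S"
  shows "holomorphic_fun_on (\<lambda>z. g z - h z) S"
proof -
  have "open S" using assms by (simp add: holomorphic_fun_on_def)
  from holomorphic_fun_on_add[OF assms(1) holomorphic_fun_on_mult[OF holomorphic_fun_on_const[OF this, of "-1"] assms(2)]]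
  show ?thesis by simp
qed

lemma holomorphic_fun_on_divide_const:
  assumes "holomorphic_fun_on g S"
  shows "holomorphic_fun_on (\<lambda>z. g z / c) S"
proof -
  have "open S" using assms by (simp add: holomorphic_fun_on_def)
  from holomorphic_fun_on_mult[OF assms holomorphic_fun_on_const[OF this, of "inverse c"]]
  show ?thesis by (simp add: field_simps)
qed

lemma holomorphic_map_on_compose:
  assumes f: "holomorphic_map_on f S" and g: "holomorphic_map_on g T" and ST: "f ` S \<subseteq> T"
  shows "holomorphic_map_on (\<lambda>z. g (f z)) S"
  unfolding holomorphic_map_on_def
proof (intro conjI ballI)
  fix z assume z: "z \<in> S"
  then obtain L M where "complex_linear L" "(f has_derivative L) (at z)"
    "complex_linear M" "(g has_derivative M) (at (f z))"
    using f g ST unfolding holomorphic_map_on_def by blast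
  then show "\<exists>L. complex_linear L \<and> ((\<lambda>z. g (f z)) has_derivative L) (at z)"
    using complex_linear_compose[of L M] has_derivative_compose[of f L z UNIV g M] by blast
qed (use f in \<open>auto simp: holomorphic_map_on_def\<close>)

lemma holomorphic_map_on_id: "open S \<Longrightarrow> holomorphic_map_on (\<lambda>z. z) S"
  by (simp add: holomorphic_map_on_iff holomorphic_fun_on_nth)

section \<open>Restriction of holomorphic functions to complex lines\<close>

lemma norm_smult_vec: "norm (c *s v) = norm c * norm v" for v :: "complex ^ 'n"
  by (simp add: norm_vec_def norm_mult L2_set_right_distrib)

lemma bounded_linear_smult_left: "bounded_linear (\<lambda>c. c *s v)" for v :: "complex ^ 'n"
  unfolding linear_conv_bounded_linear[symmetric]
  by (rule linearI) (simp_all add: vec_eq_iff algebra_simps)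

text \<open>Homogeneity turns the real derivative \<open>L (t *s v)\<close> of the slice into
  multiplication by the complex number \<open>L v\<close>.\<close>

lemma slice_has_field_derivative:
  fixes h :: "complex ^ 'n \<Rightarrow> complex"
  assumes L: "\<And>c v. L (c *s v) = c * L v" and d: "(h has_derivative L) (at (z + t *s v))"
  shows "((\<lambda>t. h (z + t *s v)) has_field_derivative L v) (at t)"
proof -
  have "((\<lambda>t. z + t *s v) has_derivative (\<lambda>t. t *s v)) (at t)"
    by (rule has_derivative_eq_rhs[OF has_derivative_add[OF has_derivative_const
        bounded_linear_imp_has_derivative[OF bounded_linear_smult_left]]]) simp
  then have "((\<lambda>t. h (z + t *s v)) has_derivative (\<lambda>t. L (t *s v))) (at t)"
    using d by (rule has_derivative_compose)
  then show ?thesis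
    by (simp add: has_field_derivative_def L mult.commute[of _ "L v"])
qed

lemma holomorphic_slice:
  fixes h :: "complex ^ 'n \<Rightarrow> complex"
  assumes h: "holomorphic_fun_on h S" and "open T" and T: "\<And>t. t \<in> T \<Longrightarrow> z + t *s v \<in> S"
  shows "(\<lambda>t. h (z + t *s v)) holomorphic_on T"
  unfolding holomorphic_on_open[OF \<open>open T\<close>]
proof
  fix t assume "t \<in> T"
  then obtain L where "\<And>c v. L (c *s v) = c * L v" "(h has_derivative L) (at (z + t *s v))"
    using h T unfolding holomorphic_fun_on_def by blast
  then show "\<exists>f'. ((\<lambda>t. h (z + t *s v)) has_field_derivative f') (at t)"
    using slice_has_field_derivative by blast
qed

section \<open>Cauchy estimates and jets\<close>

lemma index2_succ_succ [simp]: "(i::2) + 1 + 1 = i"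
  using exhaust_2[of i] by auto

lemma index2_succ_neq [simp]: "(i::2) + 1 \<noteq> i" "i \<noteq> i + 1"
  using exhaust_2[of i] by auto

lemma index2_cases: "(j::2) = i \<or> j = i + 1"
  using exhaust_2[of i] exhaust_2[of j] by auto

lemma vec2_decompose: "(Z :: complex ^ 2) = axis (i + 1) (Z $ (i + 1)) + (Z $ i) *s axis i 1"
proof -
  have "Z $ j = (axis (i + 1) (Z $ (i + 1)) + (Z $ i) *s axis i 1) $ j" for j
    using index2_cases[of j i] by (auto simp: axis_def)
  then show ?thesis unfolding vec_eq_iff ..
qed

lemma norm_vec2_le: "norm (Z :: complex ^ 2) \<le> norm (Z $ i) + norm (Z $ (i + 1))"
proof -
  have "norm Z \<le> (\<Sum>j\<in>UNIV. norm (Z $ j))" by (simp add: norm_vec_def L2_set_le_sum)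
  also have "\<dots> = norm (Z $ i) + norm (Z $ (i + 1))"
  proof -
    have "(UNIV :: 2 set) = {i, i + 1}" using index2_cases[of _ i] by auto
    then show ?thesis by (metis (no_types) index2_succ_neq(2) empty_iff finite.emptyI insertE sum.empty sum.insert add_0_right finite.insertI)
  qed
  finally show ?thesis .
qed

lemma norm_axis_complex: "norm (axis i c :: complex ^ 'n) = norm c"
proof -
  have "axis i c = c *s axis i 1" by (simp add: vec_eq_iff axis_def)
  then have "norm (axis i c) = norm (c *s (axis i 1 :: complex ^ 'n))" by (rule arg_cong)
  also have "norm (axis i 1 :: complex ^ 'n) = 1" by (simp add: norm_eq_sqrt_inner inner_axis_axis)
  then have "norm (c *s (axis i 1 :: complex ^ 'n)) = norm c" by (simp add: norm_smult_vec)
  finally show ?thesis .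
qed

lemma deriv_bound_ball:
  assumes g: "g holomorphic_on ball c r" and r: "0 < r"
    and B: "\<And>t. t \<in> ball c r \<Longrightarrow> norm (g t) \<le> B"
  shows "norm (deriv g c) \<le> 2 * B / r"
proof -
  have sub: "cball c (r/2) \<subseteq> ball c r" "ball c (r/2) \<subseteq> ball c r"
    using r by (auto simp: subset_iff)
  \<comment> \<open>Half the radius, since \<open>g\<close> is controlled on the open ball only;
    this costs the factor 2.\<close>
  have "norm ((deriv ^^ 1) g c) \<le> fact 1 * B / (r/2) ^ 1"
  proof (rule Cauchy_inequality)
    show "g holomorphic_on ball c (r/2)" using g sub(2) by (rule holomorphic_on_subset)
    show "continuous_on (cball c (r/2)) g"
      using holomorphic_on_imp_continuous_on[OF g] sub(1) by (rule continuous_on_subset)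
    show "norm (g x) \<le> B" if "norm (c - x) = r/2" for x
      using that r by (intro B) (simp add: dist_norm)
  qed (use r in simp)
  then show ?thesis by (simp add: mult.commute)
qed

text \<open>Every point of the small ball is the centre of a disc of radius \<open>r\<close> inside
  the large one, so the Cauchy bound on the derivative is uniform there.\<close>

lemma lipschitz_of_bound:
  assumes g: "g holomorphic_on ball 0 (2 * r)" and r: "0 < r"
    and B: "\<And>t. t \<in> ball 0 (2 * r) \<Longrightarrow> norm (g t) \<le> B"
    and x: "x \<in> ball 0 r" and y: "y \<in> ball 0 r"
  shows "norm (g x - g y) \<le> 2 * B / r * norm (x - y)"
proof (rule field_differentiable_bound[OF convex_ball[of 0 r] _ _ x y])
  fix t :: complex assume t: "t \<in> ball 0 r"
  have sub: "ball t r \<subseteq> ball 0 (2 * r)"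
  proof
    fix s assume "s \<in> ball t r"
    then have "norm (s - t) < r" by (simp add: dist_norm norm_minus_commute)
    moreover have "norm t < r" using t by simp
    moreover have "norm s \<le> norm (s - t) + norm t" using norm_triangle_ineq[of "s - t" t] by simp
    ultimately show "s \<in> ball 0 (2 * r)" by simp
  qed
  have "t \<in> ball 0 (2 * r)" using t r by simp
  then show "(g has_field_derivative deriv g t) (at t within ball 0 r)"
    using g by (meson holomorphic_derivI open_ball)
  show "norm (deriv g t) \<le> 2 * B / r"
    by (rule deriv_bound_ball[OF holomorphic_on_subset[OF g sub] r]) (use B sub in blast)
qed

text \<open>Each induction step splits off one factor \<open>t\<close> by the Schwarz lemma: the
  growth bound forces \<open>g 0 = 0\<close>, and the quotient satisfies it with the exponent
  lowered by one.\<close>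

lemma holomorphic_factor_power:
  assumes "g holomorphic_on ball 0 r" "0 < r"
    and "\<exists>M. \<forall>\<^sub>F t in at 0. norm (g t) \<le> M * norm t ^ k"
  shows "\<exists>h. h holomorphic_on ball 0 r \<and> (\<forall>t\<in>ball 0 r. g t = t ^ k * h t)"
  using assms
proof (induction k arbitrary: g)
  case 0
  then show ?case by auto
next
  case (Suc k)
  then obtain M where M: "\<forall>\<^sub>F t in at 0. norm (g t) \<le> M * norm t ^ Suc k" by blast
  have "g 0 = 0"
  proof -
    have "isCont g 0"
      using Suc.prems holomorphic_on_imp_continuous_on[of g "ball 0 r"]
      by (simp add: continuous_on_eq_continuous_at)
    then have "(g \<longlongrightarrow> g 0) (at 0)" by (simp add: isCont_def)
    moreover have "(g \<longlongrightarrow> 0) (at 0)"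
    proof (rule Lim_null_comparison[OF M])
      have "((\<lambda>t::complex. M * norm t ^ Suc k) \<longlongrightarrow> M * norm (0::complex) ^ Suc k) (at 0)"
        by (intro tendsto_intros)
      then show "((\<lambda>t::complex. M * norm t ^ Suc k) \<longlongrightarrow> 0) (at 0)" by simp
    qed
    ultimately show ?thesis using tendsto_unique[of "at (0::complex)"] by simp
  qed
  from Schwarz3[OF Suc.prems(1) this] obtain h1 where h1: "h1 holomorphic_on ball 0 r"
    "\<And>z. norm z < r \<Longrightarrow> g z = z * h1 z" by blast
  have "\<forall>\<^sub>F t in at 0. norm (h1 t) \<le> M * norm t ^ k"
  proof -
    have "\<forall>\<^sub>F t in at (0::complex). t \<in> ball 0 r \<and> t \<noteq> 0"
      using Suc.prems(2) eventually_at_ball'[of r "0::complex" UNIV] by simp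
    with M show ?thesis
    proof eventually_elim
      case (elim t)
      then have "norm t * norm (h1 t) \<le> norm t * (M * norm t ^ k)"
        using h1(2)[of t] by (simp add: norm_mult algebra_simps)
      then show ?case using elim by simp
    qed
  qed
  then obtain h where "h holomorphic_on ball 0 r" "\<forall>t\<in>ball 0 r. h1 t = t ^ k * h t"
    using Suc.IH[OF h1(1) Suc.prems(2)] by blast
  then show ?case using h1(2) by (intro exI[of _ h]) auto
qed

text \<open>On the circle of radius 1/2 the quotient is at most \<open>2 ^ k * B\<close>, and the
  maximum principle carries this inside. The constant \<open>M\<close> of the growth condition does
  not enter the bound.\<close>

lemma holomorphic_factor_power_bound:
  assumes g: "g holomorphic_on ball 0 1"
    and B: "\<And>t. t \<in> ball 0 1 \<Longrightarrow> norm (g t) \<le> B"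
    and O: "\<exists>M. \<forall>\<^sub>F t in at 0. norm (g t) \<le> M * norm t ^ k"
  obtains h where "h holomorphic_on ball 0 1" "\<And>t. t \<in> ball 0 1 \<Longrightarrow> g t = t ^ k * h t"
    "\<And>t. norm t \<le> 1/2 \<Longrightarrow> norm (h t) \<le> 2 ^ k * B"
proof -
  obtain h where h: "h holomorphic_on ball 0 1" "\<And>t. t \<in> ball 0 1 \<Longrightarrow> g t = t ^ k * h t"
    using holomorphic_factor_power[OF g _ O] by auto
  have "norm (h t) \<le> 2 ^ k * B" if t: "norm t \<le> 1/2" for t
  proof (rule maximum_modulus_frontier[of h "cball 0 (1/2)"])
    show "h holomorphic_on interior (cball 0 (1/2))"
      by (rule holomorphic_on_subset[OF h(1)]) auto
    show "continuous_on (closure (cball 0 (1/2))) h"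
      by (rule continuous_on_subset[OF holomorphic_on_imp_continuous_on[OF h(1)]]) auto
    show "norm (h z) \<le> 2 ^ k * B" if "z \<in> frontier (cball 0 (1/2))" for z
    proof -
      have z: "norm z = 1/2" "z \<in> ball 0 1" using that by (simp_all add: frontier_cball)
      have "norm (g z) = norm (z ^ k * h z)" using h(2)[OF z(2)] by (rule arg_cong)
      then have "norm (g z) = (1/2) ^ k * norm (h z)" by (simp only: norm_mult norm_power z(1))
      moreover have "norm (g z) \<le> B" using B z by simp
      ultimately have "(1/2) ^ k * norm (h z) \<le> B" by linarith
      then have "2 ^ k * ((1/2) ^ k * norm (h z)) \<le> 2 ^ k * B" by (intro mult_left_mono) auto
      moreover have "2 ^ k * (1/2 :: real) ^ k = 1" by (simp flip: power_mult_distrib)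
      ultimately show ?thesis by (simp only: mult.assoc[symmetric])
    qed
    show "t \<in> cball 0 (1/2)" using t by simp
  qed auto
  with h show thesis using that by blast
qed

text \<open>Division by \<open>t ^ k\<close> on the complex line through \<open>Z\<close>. The
  constants \<open>M\<close> may vary with the direction \<open>v\<close>; uniformity comes from the
  bound \<open>B\<close>.\<close>

lemma vanishing_order_bound:
  fixes u :: "complex ^ 'n \<Rightarrow> complex"
  assumes u: "holomorphic_fun_on u (ball 0 1)"
    and B: "\<And>Z. Z \<in> ball 0 1 \<Longrightarrow> norm (u Z) \<le> B"
    and O: "\<And>v. norm v = 1 \<Longrightarrow> \<exists>M. \<forall>\<^sub>F t in at 0. norm (u (t *s v)) \<le> M * norm t ^ k"
    and k: "k > 0" and Z: "norm Z \<le> 1/2"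
  shows "norm (u Z) \<le> 2 ^ k * B * norm Z ^ k"
proof -
  obtain v where v: "norm v = 1" "Z = of_real (norm Z) *s v"
  proof (cases "Z = 0")
    case True
    then show ?thesis using that[of "axis undefined 1"] by (simp add: norm_axis_complex)
  next
    case False
    then have "of_real (norm Z) * of_real (inverse (norm Z)) = (1::complex)"
      by (simp flip: of_real_mult)
    then have "Z = of_real (norm Z) *s (of_real (inverse (norm Z)) *s Z)" by simp
    moreover have "norm (of_real (inverse (norm Z)) *s Z) = 1"
      using False by (simp only: norm_smult_vec norm_of_real) simp
    ultimately show ?thesis using that by blast
  qed
  have in_ball: "t *s v \<in> ball 0 1" if "t \<in> ball 0 1" for t
    using that v(1) by (simp add: norm_smult_vec)
  have "(\<lambda>t. u (t *s v)) holomorphic_on ball 0 1"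
    using holomorphic_slice[OF u open_ball, of 0 1 0 v] in_ball by (simp only: add_0_left)
  then obtain h where h: "\<And>t. t \<in> ball 0 1 \<Longrightarrow> u (t *s v) = t ^ k * h t"
    "\<And>t. norm t \<le> 1/2 \<Longrightarrow> norm (h t) \<le> 2 ^ k * B"
    by (rule holomorphic_factor_power_bound[OF _ B[OF in_ball] O[OF v(1)]]) blast+
  have "u Z = of_real (norm Z) ^ k * h (of_real (norm Z))"
  proof -
    have "u Z = u (of_real (norm Z) *s v)" by (rule arg_cong[OF v(2)])
    also have "\<dots> = of_real (norm Z) ^ k * h (of_real (norm Z))"
      by (rule h(1)) (use Z in simp)
    finally show ?thesis .
  qed
  then have "norm (u Z) = norm Z ^ k * norm (h (of_real (norm Z)))"
    by (simp add: norm_mult norm_power)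
  also have "\<dots> \<le> norm Z ^ k * (2 ^ k * B)"
    using h(2)[of "of_real (norm Z)"] Z by (intro mult_left_mono) auto
  finally show ?thesis by (simp add: mult_ac)
qed

text \<open>\<open>p\<close> is the coefficient of the pure power of \<open>Z $ (i + 1)\<close>,
  read off on that coordinate axis. The remainder is split at the projection of \<open>Z\<close> to
  the axis: along the axis it has order \<open>k + 1\<close>, and leaving the axis costs
  \<open>norm (Z $ i)\<close> times a derivative of size \<open>norm Z ^ (k - 1)\<close>.\<close>

lemma vanishing_order_expansion:
  fixes u :: "complex ^ 2 \<Rightarrow> complex"
  assumes u: "holomorphic_fun_on u (ball 0 1)"
    and B: "\<And>Z. Z \<in> ball 0 1 \<Longrightarrow> norm (u Z) \<le> B"
    and O: "\<And>v. norm v = 1 \<Longrightarrow> \<exists>M. \<forall>\<^sub>F t in at 0. norm (u (t *s v)) \<le> M * norm t ^ k"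
    and k: "k > 0"
  shows "\<exists>p. norm p \<le> 40 ^ k * B \<and> (\<forall>Z. norm Z \<le> 1/16 \<longrightarrow>
    norm (u Z - p * (Z $ (i + 1)) ^ k) \<le> 40 ^ k * B * (norm (Z $ i) * norm Z ^ (k - 1) + norm Z ^ (k + 1)))"
proof -
  have B0: "0 \<le> B" using order_trans[OF norm_ge_zero B[of 0]] by simp
  note bd = vanishing_order_bound[OF u B O k]
  define e :: "complex ^ 2" where "e = axis (i + 1) 1"
  have e1: "norm e = 1" by (simp add: e_def norm_axis_complex)
  have in_ball: "t *s e \<in> ball 0 1" if "t \<in> ball 0 1" for t
    using that e1 by (simp add: norm_smult_vec)
  have "(\<lambda>t. u (t *s e)) holomorphic_on ball 0 1"
    using holomorphic_slice[OF u open_ball, of 0 1 0 e] in_ball by (simp only: add_0_left)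
  then obtain h where h: "h holomorphic_on ball 0 1" "\<And>t. t \<in> ball 0 1 \<Longrightarrow> u (t *s e) = t ^ k * h t"
    "\<And>t. norm t \<le> 1/2 \<Longrightarrow> norm (h t) \<le> 2 ^ k * B"
    by (rule holomorphic_factor_power_bound[OF _ B[OF in_ball] O[OF e1]]) blast+
  \<comment> \<open>\<open>40 ^ k\<close> is a common bound for \<open>8 * 2 ^ k\<close>, which
    arises on the axis, and for \<open>10 ^ k = 2 ^ k * 5 ^ k\<close>, which arises off the
    axis.\<close>
  have pw: "(16::real) * 2 ^ k \<le> 40 ^ k" "(2::real) ^ k \<le> 40 ^ k" "(10::real) ^ k \<le> 40 ^ k"
  proof -
    obtain m where m: "k = Suc m" using k by (cases k) auto
    have "(2::real) ^ m \<le> 40 ^ m" by (intro power_mono) auto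
    moreover have "(0::real) \<le> 40 ^ m" by simp
    ultimately have "16 * (2 * (2::real) ^ m) \<le> 40 * 40 ^ m" by linarith
    then show "(16::real) * 2 ^ k \<le> 40 ^ k" by (simp only: m power_Suc)
  qed (intro power_mono; simp)+
  have c40: "2 ^ k * B \<le> 40 ^ k * B" "16 * (2 ^ k * B) \<le> 40 ^ k * B" "10 ^ k * B \<le> 40 ^ k * B"
    using pw(2,3)[THEN mult_right_mono, OF B0] pw(1)[THEN mult_right_mono, OF B0]
    by (simp_all only: mult.assoc)
  show ?thesis
  proof (intro exI conjI allI impI)
    show "norm (h 0) \<le> 40 ^ k * B" using h(3)[of 0] c40(1) by simp
    fix Z :: "complex ^ 2" assume Z: "norm Z \<le> 1/16"
    define w where "w = Z $ (i + 1)"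
    have w: "norm w \<le> norm Z" "norm (Z $ i) \<le> norm Z" unfolding w_def by (rule Finite_Cartesian_Product.norm_nth_le)+
    have "norm (u (w *s e) - h 0 * w ^ k) = norm w ^ k * norm (h w - h 0)"
    proof -
      have "u (w *s e) - h 0 * w ^ k = w ^ k * (h w - h 0)"
        using h(2)[of w] w Z by (simp add: algebra_simps)
      then show ?thesis by (simp only: norm_mult norm_power)
    qed
    also have "\<dots> \<le> norm w ^ k * (8 * (2 ^ k * B) * norm w)"
    proof -
      have "norm (h w - h 0) \<le> 2 * (2 ^ k * B) / (1/4) * norm (w - 0)"
      proof (rule lipschitz_of_bound)
        show "h holomorphic_on ball 0 (2 * (1/4))"
          by (rule holomorphic_on_subset[OF h(1)]) auto
        show "norm (h t) \<le> 2 ^ k * B" if "t \<in> ball 0 (2 * (1/4))" for t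
          by (rule h(3)) (use that in simp)
      qed (use w Z in auto)
      then show ?thesis by (intro mult_left_mono) auto
    qed
    also have "\<dots> = 8 * (2 ^ k * B) * norm w ^ (k + 1)" by simp
    also have "\<dots> \<le> 40 ^ k * B * norm Z ^ (k + 1)"
    proof (rule mult_mono)
      have "0 \<le> 2 ^ k * B" using B0 by simp
      then show "8 * (2 ^ k * B) \<le> 40 ^ k * B" using c40(2) by linarith
      show "norm w ^ (k + 1) \<le> norm Z ^ (k + 1)" using w by (intro power_mono) auto
    qed (use B0 in auto)
    finally have 1: "norm (u (w *s e) - h 0 * w ^ k) \<le> 40 ^ k * B * norm Z ^ (k + 1)" .
    have 2: "norm (u Z - u (w *s e)) \<le> 40 ^ k * B * (norm (Z $ i) * norm Z ^ (k - 1))"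
    proof (cases "Z = 0")
      case True
      then show ?thesis using B0 by (simp add: w_def)
    next
      case False
      \<comment> \<open>Moving by at most \<open>2 * r\<close> off the axis keeps the norm below
        \<open>5 * norm Z\<close>, at most 5/16, where the bound by vanishing order applies; and
        \<open>Z $ i\<close> lies in the half of this disc.\<close>
      define r where "r = 2 * norm Z"
      have r: "0 < r" using False by (simp add: r_def)
      have small: "norm (w *s e + t *s axis i 1) \<le> 5 * norm Z" if "t \<in> ball 0 (2 * r)" for t :: complex
      proof -
        have "norm (w *s e + t *s axis i 1) \<le> norm w + norm t"
          using norm_triangle_ineq[of "w *s e" "t *s axis i 1"] by (simp add: norm_smult_vec e1 norm_axis_complex)
        then show ?thesis using that w by (simp add: r_def)
      qed
      have Zeq: "Z = w *s e + (Z $ i) *s axis i 1"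
      proof -
        have "axis (i + 1) (Z $ (i + 1)) = w *s e" by (simp add: w_def e_def vec_eq_iff axis_def)
        then show ?thesis using vec2_decompose[of Z i] by (simp only:)
      qed
      have lip: "norm (u (w *s e + (Z $ i) *s axis i 1) - u (w *s e + 0 *s axis i 1))
          \<le> 2 * (2 ^ k * B * (5 * norm Z) ^ k) / r * norm (Z $ i - 0)"
      proof (rule lipschitz_of_bound)
        show "(\<lambda>t. u (w *s e + t *s axis i 1)) holomorphic_on ball 0 (2 * r)"
        proof (rule holomorphic_slice[OF u])
          fix t :: complex assume "t \<in> ball 0 (2 * r)"
          from small[OF this] Z show "w *s e + t *s axis i 1 \<in> ball 0 1" by simp
        qed simp
        fix t :: complex assume "t \<in> ball 0 (2 * r)"
        note sm = small[OF this]
        have "norm (u (w *s e + t *s axis i 1)) \<le> 2 ^ k * B * norm (w *s e + t *s axis i 1) ^ k"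
          by (rule bd) (use sm Z in auto)
        also have "\<dots> \<le> 2 ^ k * B * (5 * norm Z) ^ k"
          using sm B0 by (intro mult_left_mono power_mono) auto
        finally show "norm (u (w *s e + t *s axis i 1)) \<le> 2 ^ k * B * (5 * norm Z) ^ k" .
      next
        have "norm (Z $ i) < r" using w(2) r unfolding r_def by linarith
        then show "Z $ i \<in> ball 0 r" by simp
      qed (use r in simp_all)
      have cf: "2 * (2 ^ k * B * (5 * norm Z) ^ k) / r = 10 ^ k * B * norm Z ^ (k - 1)"
      proof -
        obtain m where m: "k = Suc m" using k by (cases k) auto
        have "2 ^ k * 5 ^ k = (10::real) ^ k" by (simp flip: power_mult_distrib)
        then have "2 * (2 ^ k * B * (5 * norm Z) ^ k) = 10 ^ k * B * norm Z ^ (k - 1) * r"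
          by (simp add: r_def power_mult_distrib m algebra_simps)
        moreover have "r \<noteq> 0" using r by simp
        ultimately show ?thesis by (metis nonzero_mult_div_cancel_right)
      qed
      have "norm (u Z - u (w *s e)) \<le> 10 ^ k * B * norm Z ^ (k - 1) * norm (Z $ i)"
        using lip unfolding cf Zeq[symmetric] vector_smult_lzero add_0_right diff_0_right .
      also have "\<dots> \<le> 40 ^ k * B * norm Z ^ (k - 1) * norm (Z $ i)"
        by (rule mult_right_mono[OF mult_right_mono[OF c40(3)]]) auto
      finally show ?thesis by (simp add: mult_ac)
    qed
    show "norm (u Z - h 0 * Z $ (i + 1) ^ k) \<le> 40 ^ k * B * (norm (Z $ i) * norm Z ^ (k - 1) + norm Z ^ (k + 1))"
      using 1 2 norm_triangle_ineq[of "u Z - u (w *s e)" "u (w *s e) - h 0 * w ^ k"]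
      by (simp add: w_def algebra_simps)
  qed
qed

section \<open>The jet of a single map of the sequence\<close>

lemma eventually_at_zero_slice:
  assumes "\<forall>\<^sub>F z in at (0 :: complex ^ 'n). P z" and v: "norm v = 1"
  shows "\<forall>\<^sub>F t in at 0. P (t *s v)"
proof -
  obtain d where d: "d > 0" "\<And>z. z \<noteq> 0 \<Longrightarrow> norm z < d \<Longrightarrow> P z"
    using assms(1) unfolding eventually_at by (auto simp: dist_norm)
  have "P (t *s v)" if "t \<noteq> 0" "norm t < d" for t
  proof (rule d(2))
    show "t *s v \<noteq> 0" using that v by auto
    show "norm (t *s v) < d" using that v by (simp add: norm_smult_vec)
  qed
  then show ?thesis
    unfolding eventually_at using d(1) by (auto simp: dist_norm)
qed

lemma slice_quotient_tendsto:
  fixes f :: "complex ^ 'n \<Rightarrow> complex ^ 'm"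
  assumes L: "complex_linear L" "(f has_derivative L) (at 0)" and f0: "f 0 = 0"
  shows "((\<lambda>t. f (t *s v) $ i / t) \<longlongrightarrow> L v $ i) (at 0)"
proof -
  have "((\<lambda>z. f z $ i) has_derivative (\<lambda>v. L v $ i)) (at (0 + 0 *s v))"
    by (simp add: bounded_linear.has_derivative[OF bounded_linear_vec_nth] L)
  then have "((\<lambda>t. f (0 + t *s v) $ i) has_field_derivative (L v $ i)) (at 0)"
    by (rule slice_has_field_derivative[rotated]) (simp add: complex_linear_scale[OF L(1)])
  then show ?thesis
    by (simp add: has_field_derivative_iff f0)
qed

text \<open>Serves the case \<open>k = 1\<close>, where the second order is obtained from the
  derivative at 0: if value and derivative vanish, two factors \<open>t\<close> can be split
  off.\<close>

lemma second_order_slice: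
  assumes g: "g holomorphic_on ball 0 1" and q: "((\<lambda>t. g t / t) \<longlongrightarrow> 0) (at 0)"
    and g0: "g 0 = 0"
  shows "\<exists>M. \<forall>\<^sub>F t in at 0. norm (g t) \<le> M * norm (t::complex) ^ 2"
proof -
  obtain h where h: "h holomorphic_on ball 0 1" "\<And>z. norm z < 1 \<Longrightarrow> g z = z * h z" "deriv g 0 = h 0"
    using Schwarz3[OF g g0] by auto
  have "(g has_field_derivative 0) (at 0)"
    using q by (simp add: has_field_derivative_iff g0)
  then have "h 0 = 0" using h(3) by (simp add: DERIV_imp_deriv)
  then obtain h2 where h2: "h2 holomorphic_on ball 0 1" "\<And>z. norm z < 1 \<Longrightarrow> h z = z * h2 z"
    using Schwarz3[OF h(1)] by auto
  have "isCont h2 0"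
    using holomorphic_on_imp_continuous_on[OF h2(1)] by (simp add: continuous_on_eq_continuous_at)
  then have "((\<lambda>t. norm (h2 t)) \<longlongrightarrow> norm (h2 0)) (at 0)"
    unfolding isCont_def by (intro tendsto_norm)
  then have "\<forall>\<^sub>F t in at 0. norm (h2 t) < norm (h2 0) + 1"
    by (rule order_tendstoD) simp
  moreover have "\<forall>\<^sub>F t in at (0::complex). norm t < 1"
    unfolding eventually_at by (intro exI[of _ 1]) (simp add: dist_norm)
  ultimately have "\<forall>\<^sub>F t in at 0. norm (g t) \<le> (norm (h2 0) + 1) * norm t ^ 2"
  proof eventually_elim
    case (elim t)
    have "norm (g t) = norm t ^ 2 * norm (h2 t)"
      using h(2)[OF elim(2)] h2(2)[OF elim(2)] by (simp add: norm_mult power2_eq_square)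
    also have "\<dots> \<le> norm t ^ 2 * (norm (h2 0) + 1)" using elim(1) by (intro mult_left_mono) auto
    finally show ?case by (simp add: mult.commute)
  qed
  then show ?thesis by blast
qed

text \<open>The constants depend on \<open>k'\<close> only, because
  \<open>f Z $ i - lam i * Z $ i\<close> is at most 2 on the unit ball for every map of the
  sequence. This makes the jets uniform in time.\<close>

lemma diagonal_jet:
  fixes f :: "complex ^ 2 \<Rightarrow> complex ^ 2"
  assumes hol: "holomorphic_map_on f UNIV"
    and att: "\<And>Z. norm Z < 1 \<Longrightarrow> C * norm Z \<le> norm (f Z) \<and> norm (f Z) \<le> D * norm Z"
    and D: "D < 1" and contact: "order_of_contact k f" and k: "k \<ge> 1"
    and diag: "diagonal_matrix (linear_part f)" and k': "k' = max 2 k"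
  shows "\<exists>lam p. \<forall>i. C \<le> norm (lam i) \<and> norm (lam i) \<le> D \<and> norm (p i) \<le> 2 * 40 ^ k' \<and>
    (\<forall>Z. norm Z \<le> 1/16 \<longrightarrow> norm (f Z $ i - lam i * Z $ i) \<le> 2 * 40 ^ k' * norm Z ^ k' \<and>
      norm (f Z $ i - lam i * Z $ i - p i * Z $ (i + 1) ^ k') \<le>
        2 * 40 ^ k' * (norm (Z $ i) * norm Z ^ (k' - 1) + norm Z ^ (k' + 1)))"
proof -
  obtain L where L: "complex_linear L" "(f has_derivative L) (at 0)"
    using hol unfolding holomorphic_map_on_def by blast
  have f0: "f 0 = 0" using att[of 0] by simp
  define lam where "lam i = linear_part f $ i $ i" for i
  have Lmat: "linear_part f = matrix L"
    unfolding linear_part_def using frechet_derivative_at[OF L(2)] by simp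
  have Lcomp: "L v $ i = lam i * v $ i" for v i
  proof -
    have "L v = linear_part f *v v"
      using matrix_works[OF L(1)] Lmat by simp
    then have "L v $ i = (\<Sum>j\<in>UNIV. linear_part f $ i $ j * v $ j)"
      by (simp add: matrix_vector_mult_def)
    also have "\<dots> = (\<Sum>j\<in>UNIV. if j = i then lam i * v $ i else 0)"
      using diag by (intro sum.cong) (auto simp: diagonal_matrix_def lam_def)
    finally show ?thesis by simp
  qed
  note quot = slice_quotient_tendsto[OF L f0, unfolded Lcomp]
  have near0: "\<forall>\<^sub>F t in at (0::complex). norm t < 1 \<and> t \<noteq> 0"
    unfolding eventually_at by (intro exI[of _ 1]) (simp add: dist_norm)
  have lam_le: "norm (lam i) \<le> D" for i
  proof (rule tendsto_upperbound)
    show "((\<lambda>t. norm (f (t *s axis i 1) $ i / t)) \<longlongrightarrow> norm (lam i)) (at 0)"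
      using tendsto_norm[OF quot[of "axis i 1" i]] by (simp add: axis_def)
    show "\<forall>\<^sub>F t in at 0. norm (f (t *s axis i 1) $ i / t) \<le> D"
      using near0
    proof eventually_elim
      case (elim t)
      have "norm (f (t *s axis i 1) $ i) \<le> norm (f (t *s axis i 1))"
        by (rule Finite_Cartesian_Product.norm_nth_le)
      also have "\<dots> \<le> D * norm t"
        using att[of "t *s axis i 1"] elim by (simp add: norm_smult_vec norm_axis_complex)
      finally show ?case using elim by (simp add: norm_divide divide_le_eq)
    qed
  qed simp
  \<comment> \<open>Along the axis \<open>i\<close> the other component of \<open>f\<close> is
    \<open>o(t)\<close>, since the linear part is diagonal; so the lower attraction bound passes to
    \<open>lam i\<close> alone.\<close>
  have lam_ge: "C \<le> norm (lam i)" for i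
  proof (rule tendsto_lowerbound)
    show "((\<lambda>t. norm (f (t *s axis i 1) $ i / t) + norm (f (t *s axis i 1) $ (i + 1) / t)) \<longlongrightarrow> norm (lam i)) (at 0)"
      using tendsto_add[OF tendsto_norm[OF quot[of "axis i 1" i]] tendsto_norm[OF quot[of "axis i 1" "i + 1"]]]
      by (simp add: axis_def)
    show "\<forall>\<^sub>F t in at 0. C \<le> norm (f (t *s axis i 1) $ i / t) + norm (f (t *s axis i 1) $ (i + 1) / t)"
      using near0
    proof eventually_elim
      case (elim t)
      have "C * norm t \<le> norm (f (t *s axis i 1))"
        using att[of "t *s axis i 1"] elim by (simp add: norm_smult_vec norm_axis_complex)
      also have "\<dots> \<le> norm (f (t *s axis i 1) $ i) + norm (f (t *s axis i 1) $ (i + 1))"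
        by (rule norm_vec2_le)
      finally show ?case using elim by (simp add: norm_divide le_divide_eq flip: add_divide_distrib)
    qed
  qed simp
  define u where "u i Z = f Z $ i - lam i * Z $ i" for i Z
  have hu: "holomorphic_fun_on (u i) (ball 0 1)" for i
    unfolding u_def
    by (intro holomorphic_fun_on_diff holomorphic_fun_on_mult holomorphic_fun_on_const holomorphic_fun_on_nth
        holomorphic_map_on_nth holomorphic_map_on_subset[OF hol]) auto
  have ub: "norm (u i Z) \<le> 2" if "Z \<in> ball 0 1" for i Z
  proof -
    have Z: "norm Z < 1" using that by simp
    have "0 \<le> D" using lam_le[of 1] norm_ge_zero order_trans by blast
    have "norm (f Z $ i) \<le> norm (f Z)" by (rule Finite_Cartesian_Product.norm_nth_le)
    also have "\<dots> \<le> D * norm Z" using att[OF Z] by simp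
    also have "\<dots> \<le> 1 * 1" using Z D \<open>0 \<le> D\<close> by (intro mult_mono) auto
    finally have 1: "norm (f Z $ i) \<le> 1" by simp
    have "norm (lam i * Z $ i) \<le> 1 * 1"
      unfolding norm_mult using lam_le[of i] D Z Finite_Cartesian_Product.norm_nth_le[of Z i]
      by (intro mult_mono) auto
    with 1 show ?thesis unfolding u_def using norm_triangle_ineq4[of "f Z $ i" "lam i * Z $ i"] by simp
  qed
  have uO: "\<exists>M. \<forall>\<^sub>F t in at 0. norm (u i (t *s v)) \<le> M * norm t ^ k'" if v: "norm v = 1" for v i
  proof (cases "k = 1")
    case True
    have "\<exists>M. \<forall>\<^sub>F t in at 0. norm (u i (t *s v)) \<le> M * norm t ^ 2"
    proof (rule second_order_slice)
      have "(\<lambda>t. u i (0 + t *s v)) holomorphic_on ball 0 1"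
        by (rule holomorphic_slice[OF hu]) (use v in \<open>simp_all add: norm_smult_vec\<close>)
      then show "(\<lambda>t. u i (t *s v)) holomorphic_on ball 0 1" by (simp only: add_0_left)
      have "((\<lambda>t. f (t *s v) $ i / t - lam i * v $ i) \<longlongrightarrow> lam i * v $ i - lam i * v $ i) (at 0)"
        by (intro tendsto_diff quot tendsto_const)
      then have "((\<lambda>t. f (t *s v) $ i / t - lam i * v $ i) \<longlongrightarrow> 0) (at 0)" by simp
      then show "((\<lambda>t. u i (t *s v) / t) \<longlongrightarrow> 0) (at 0)"
      proof (rule Lim_transform_eventually)
        show "\<forall>\<^sub>F t in at 0. f (t *s v) $ i / t - lam i * v $ i = u i (t *s v) / t"
          using near0 by eventually_elim (simp add: u_def field_simps)
      qed
      show "u i (0 *s v) = 0" by (simp add: u_def f0)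
    qed
    moreover have "k' = 2" using k' True by simp
    ultimately show ?thesis by simp
  next
    case False
    then have k2: "k \<ge> 2" "k' = k" using k k' by auto
    obtain l where l: "complex_linear l" "(\<lambda>z. norm (f z - l z)) \<in> O[at 0](\<lambda>z. norm z ^ k)"
      using contact unfolding order_of_contact_def by blast
    then obtain c where c: "\<forall>\<^sub>F z in at 0. norm (f z - l z) \<le> c * norm z ^ k"
      by (elim landau_o.bigE) simp
    have ev: "\<forall>\<^sub>F t in at 0. norm (f (t *s v) - l (t *s v)) \<le> c * norm t ^ k"
      using eventually_at_zero_slice[OF c v] v by (simp add: norm_smult_vec)
    have ev': "\<forall>\<^sub>F t in at 0. norm (f (t *s v) $ i - t * l v $ i) \<le> c * norm t ^ k"
      using ev
    proof eventually_elim
      case (elim t)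
      have "f (t *s v) $ i - t * l v $ i = (f (t *s v) - l (t *s v)) $ i"
        by (simp add: complex_linear_scale[OF l(1)])
      then have "norm (f (t *s v) $ i - t * l v $ i) \<le> norm (f (t *s v) - l (t *s v))"
        using Finite_Cartesian_Product.norm_nth_le[of "f (t *s v) - l (t *s v)" i] by (simp only:)
      then show ?case using elim by (rule order_trans)
    qed
    have "((\<lambda>t. f (t *s v) $ i / t - l v $ i) \<longlongrightarrow> 0) (at 0)"
    proof (rule Lim_null_comparison)
      show "\<forall>\<^sub>F t in at 0. norm (f (t *s v) $ i / t - l v $ i) \<le> c * norm t ^ (k - 1)"
        using ev' near0
      proof eventually_elim
        case (elim t)
        have "t * (f (t *s v) $ i / t - l v $ i) = f (t *s v) $ i - t * l v $ i"
          using elim by (simp add: right_diff_distrib)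
        then have "norm t * norm (f (t *s v) $ i / t - l v $ i) = norm (f (t *s v) $ i - t * l v $ i)"
          by (simp only: norm_mult[symmetric])
        also have "\<dots> \<le> norm t * (c * norm t ^ (k - 1))"
          using elim k2 by (cases k) (auto simp: mult_ac)
        finally show ?case using elim by simp
      qed
      have "((\<lambda>t::complex. c * norm t ^ (k - 1)) \<longlongrightarrow> c * norm (0::complex) ^ (k - 1)) (at 0)"
        by (intro tendsto_intros)
      then show "((\<lambda>t::complex. c * norm t ^ (k - 1)) \<longlongrightarrow> 0) (at 0)" using k2 by (simp add: zero_power)
    qed
    then have "((\<lambda>t. f (t *s v) $ i / t) \<longlongrightarrow> l v $ i) (at 0)" by (simp add: LIM_zero_iff)
    \<comment> \<open>The linear map of the contact condition and the derivative are limits of the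
      same difference quotient.\<close>
    then have lv: "l v $ i = lam i * v $ i"
      using quot[of v i] by (intro tendsto_unique[of "at (0::complex)"]) auto
    show ?thesis
      using ev' unfolding lv k2 u_def by (intro exI[of _ c]) (simp add: mult_ac)
  qed
  have "k' > 0" by (simp add: k')
  have "\<forall>i. \<exists>p. norm p \<le> 40 ^ k' * 2 \<and> (\<forall>Z. norm Z \<le> 1/16 \<longrightarrow>
    norm (u i Z - p * (Z $ (i + 1)) ^ k') \<le> 40 ^ k' * 2 * (norm (Z $ i) * norm Z ^ (k' - 1) + norm Z ^ (k' + 1)))"
    by (intro allI vanishing_order_expansion[OF hu ub uO \<open>k' > 0\<close>])
  then obtain p where p: "\<And>i. norm (p i) \<le> 40 ^ k' * 2"
    "\<And>i Z. norm Z \<le> 1/16 \<Longrightarrow> norm (u i Z - p i * (Z $ (i + 1)) ^ k')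
      \<le> 40 ^ k' * 2 * (norm (Z $ i) * norm Z ^ (k' - 1) + norm Z ^ (k' + 1))"
    by metis
  have u1: "norm (u i Z) \<le> 2 * 40 ^ k' * norm Z ^ k'" if "norm Z \<le> 1/16" for i Z
  proof -
    have "norm (u i Z) \<le> 2 ^ k' * 2 * norm Z ^ k'"
      by (rule vanishing_order_bound[OF hu ub uO \<open>k' > 0\<close>]) (use that in auto)
    also have "\<dots> \<le> 2 * 40 ^ k' * norm Z ^ k'"
      using power_mono[of 2 "40::real" k'] by (intro mult_right_mono) auto
    finally show ?thesis .
  qed
  show ?thesis
    using lam_le lam_ge p u1 unfolding u_def
    by (intro exI[of _ lam] exI[of _ p]) (simp add: mult.commute[of _ 2])
qed

section \<open>Trains\<close>

text \<open>Either component loses at most \<mu> per step, while both together gain at least \<nu>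
  per step. A loss of \<open>\<gamma> * n\<close> is tolerated from time \<open>n\<close> on;
  \<gamma> < \<nu> means that an excessive loss of one component forces a rise of the other.\<close>

locale drift =
  fixes W :: "2 \<Rightarrow> nat \<Rightarrow> real" and k :: nat and \<mu> \<nu> \<gamma> :: real
  assumes mu: "0 < \<mu>" and k: "2 \<le> k" and gamma: "\<gamma> = (real k - 1) * \<mu>" and nu: "\<gamma> < \<nu>"
    and step: "W i n - \<mu> \<le> W i (Suc n)"
    and sum: "n \<le> m \<Longrightarrow> \<nu> * (real m - real n) \<le> (W i m - W i n) + (W (i + 1) m - W (i + 1) n)"
begin

text \<open>\<open>W i n\<close> will be the logarithm (with a small loss) of the inverse of the product of the first \<open>n\<close>
  factors in the recursion for the \<open>i\<close>-th component. A bad pair is a stretch of time over which this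
  component can not be removed.\<close>

definition bad :: "2 \<Rightarrow> nat \<Rightarrow> nat \<Rightarrow> bool"
  where "bad i n m \<longleftrightarrow> n < m \<and> W i m < W i n - \<gamma> * n"

lemma gamma_pos: "0 < \<gamma>"
  using mu k by (simp add: gamma)

lemma decrease_le: "n \<le> m \<Longrightarrow> W i n - \<mu> * (real m - real n) \<le> W i m"
proof (induction m rule: dec_induct)
  case (step m)
  then show ?case using drift.step[OF drift_axioms, of i m] by (simp add: algebra_simps)
qed simp

text \<open>At a rate of at most \<mu> per step, a drop by more than \<open>\<gamma> * n\<close>
  takes more than \<open>(k - 1) * n\<close> steps. This gives the geometric growth of the
  trains.\<close>

lemma bad_gap:
  assumes "bad i n m" shows "k * n \<le> m"
proof -
  have "\<gamma> * n < \<mu> * (real m - real n)"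
    using assms decrease_le[of n m i] unfolding bad_def by linarith
  then have "\<mu> * ((real k - 1) * n) < \<mu> * (real m - real n)"
    using gamma by (simp add: mult_ac)
  then have "(real k - 1) * n < real m - real n" using mu by simp
  then have "real (k * n) < real m" by (simp add: algebra_simps)
  then show ?thesis by linarith
qed

text \<open>A train of type \<open>i\<close> starts at \<open>t\<close>; up to time \<open>S\<close> it is known to contain no bad pair.\<close>

definition train_start :: "nat \<Rightarrow> 2 \<Rightarrow> nat \<Rightarrow> bool"
  where "train_start t i S \<longleftrightarrow> 1 \<le> t \<and> t \<le> S \<and>
    (\<forall>m. t \<le> m \<and> m \<le> S \<longrightarrow> W i m - \<gamma> * m \<le> W i S - \<gamma> * S) \<and>
    (\<forall>n m. t \<le> n \<and> m \<le> S \<longrightarrow> \<not> bad i n m)"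

text \<open>From the start \<open>t\<close> no loss at all is tolerated, which will make the
  coefficients bounded there. The reserve \<open>\<gamma> * S\<close> at time \<open>S\<close>
  extends this past \<open>S\<close> for as long as no bad pair begins at \<open>S\<close>.\<close>

definition clean_switch :: "nat \<Rightarrow> 2 \<Rightarrow> nat \<Rightarrow> bool"
  where "clean_switch t i S \<longleftrightarrow> k * t \<le> S \<and> W i t \<le> W i S - \<gamma> * S \<and>
    (\<forall>m. t \<le> m \<and> m \<le> S \<longrightarrow> W i t \<le> W i m)"

text \<open>If \<open>M\<close> is the end of the first bad pair, the next train starts at the maximum of \<open>W i n - \<gamma> n\<close> before
  \<open>M\<close>, so it overlaps the bad stretch entirely; there the other component can only rise.\<close>

lemma next_train:
  assumes inv: "train_start t i S" and ex: "\<exists>n m. S \<le> n \<and> bad i n m"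
  shows "\<exists>t' S'. S \<le> t' \<and> train_start t' (i + 1) S' \<and> clean_switch t' (i + 1) S' \<and> t' < S' \<and>
    (\<forall>n m. t \<le> n \<and> m < S' \<longrightarrow> \<not> bad i n m) \<and> (\<forall>m. S \<le> m \<and> m < S' \<longrightarrow> W i S - \<gamma> * S \<le> W i m)"
proof -
  define M where "M = (LEAST m. \<exists>n. S \<le> n \<and> bad i n m)"
  have "\<exists>n. S \<le> n \<and> bad i n M"
    unfolding M_def by (rule LeastI_ex) (use ex in blast)
  then obtain n0 where n0: "S \<le> n0" "bad i n0 M" by blast
  have least: "\<not> bad i n m" if "S \<le> n" "m < M" for n m
    using not_less_Least[of m "\<lambda>m. \<exists>n. S \<le> n \<and> bad i n m"] that unfolding M_def by blast
  define Z where "Z m = W i m - \<gamma> * m" for m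
  have n0M: "n0 < M" "W i M < Z n0" using n0 by (auto simp: bad_def Z_def)
  have "finite (Z ` {S..<M})" "Z ` {S..<M} \<noteq> {}" using n0(1) n0M by auto
  from Max_in[OF this] obtain n where n: "S \<le> n" "n < M" and nmax: "Z n = Max (Z ` {S..<M})" by auto
  have Zmax': "Z m \<le> Z n" if "S \<le> m" "m < M" for m
    unfolding nmax by (rule Max_ge) (use that in auto)
  have WM: "W i M < Z n" using Zmax'[of n0] n0 n0M by simp
  have Zmax: "Z m \<le> Z n" if "S \<le> m" "m \<le> M" for m
  proof (cases "m = M")
    case True
    have "0 \<le> \<gamma> * m" using gamma_pos by simp
    then show ?thesis using WM True by (simp add: Z_def)
  next
    case False
    then show ?thesis using Zmax'[of m] that by simp
  qed
  have badnM: "bad i n M" using WM n by (simp add: bad_def Z_def)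
  have low: "Z n \<le> W i m" if "n \<le> m" "m < M" for m
  proof (cases "m = n")
    case True
    then show ?thesis using gamma_pos by (simp add: Z_def)
  next
    case False
    then show ?thesis using least[of n m] that n(1) by (simp add: bad_def Z_def)
  qed
  have recM: "W i M \<le> W i m" if "n \<le> m" "m \<le> M" for m
    using low[of m] that WM by (cases "m = M") auto
  have ts: "train_start n (i + 1) M"
    unfolding train_start_def
  proof (intro conjI allI impI)
    show "1 \<le> n" using inv n by (simp add: train_start_def)
    show "n \<le> M" using n by simp
  next
    fix m assume m: "n \<le> m \<and> m \<le> M"
    have "\<nu> * (real M - real m) \<le> (W i M - W i m) + (W (i + 1) M - W (i + 1) m)"
      using sum[of m M i] m by simp
    moreover have "\<gamma> * (real M - real m) \<le> \<nu> * (real M - real m)"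
      using nu m by (intro mult_right_mono) auto
    ultimately show "W (i + 1) m - \<gamma> * m \<le> W (i + 1) M - \<gamma> * M"
      using recM[of m] m by (simp add: algebra_simps)
  next
    fix a b assume ab: "n \<le> a \<and> b \<le> M"
    show "\<not> bad (i + 1) a b"
    proof
      assume bd: "bad (i + 1) a b"
      then have "a < b" by (simp add: bad_def)
      have "\<nu> * (real b - real a) \<le> (W i b - W i a) + (W (i + 1) b - W (i + 1) a)"
        using sum[of a b i] \<open>a < b\<close> by simp
      moreover have "W (i + 1) b - W (i + 1) a < - \<gamma> * a" using bd by (simp add: bad_def)
      \<comment> \<open>Between \<open>a\<close> and \<open>b\<close> component \<open>i\<close>
        rises by at most \<open>\<gamma> * b\<close>. With a drop of the other by more than
        \<open>\<gamma> * a\<close> the joint gain would stay below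
        \<open>\<gamma> * (b - a)\<close>.\<close>
      moreover have "W i b - \<gamma> * b \<le> Z n" using Zmax[of b] ab n \<open>a < b\<close> by (simp add: Z_def)
      moreover have "Z n \<le> W i a" using low[of a] ab \<open>a < b\<close> by simp
      ultimately have "\<nu> * (real b - real a) < \<gamma> * (real b - real a)" by (simp add: algebra_simps)
      then show False using nu \<open>a < b\<close> by simp
    qed
  qed
  have cs: "clean_switch n (i + 1) M"
    unfolding clean_switch_def
  proof (intro conjI allI impI)
    show "k * n \<le> M" by (rule bad_gap[OF badnM])
    have "\<nu> * (real M - real n) \<le> (W i M - W i n) + (W (i + 1) M - W (i + 1) n)"
      using sum[of n M i] n by simp
    moreover have "\<gamma> * (real M - real n) \<le> \<nu> * (real M - real n)"
      using nu n by (intro mult_right_mono) auto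
    moreover have "W i M - W i n \<le> - \<gamma> * n" using WM by (simp add: Z_def)
    ultimately show "W (i + 1) n \<le> W (i + 1) M - \<gamma> * M" by (simp add: algebra_simps)
  next
    fix m assume m: "n \<le> m \<and> m \<le> M"
    have "\<nu> * (real m - real n) \<le> (W i m - W i n) + (W (i + 1) m - W (i + 1) n)"
      using sum[of n m i] m by simp
    moreover have "\<gamma> * (real m - real n) \<le> \<nu> * (real m - real n)"
      using nu m by (intro mult_right_mono) auto
    moreover have "W i m - W i n \<le> \<gamma> * (real m - real n)"
      using Zmax[of m] m n by (simp add: Z_def algebra_simps)
    ultimately show "W (i + 1) n \<le> W (i + 1) m" by simp
  qed
  have nb: "\<not> bad i a b" if ab: "t \<le> a" "b < M" for a b
  proof (cases "S \<le> a")
    case True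
    then show ?thesis using least ab by blast
  next
    case False
    show ?thesis
    proof (cases "b \<le> S")
      case True
      then show ?thesis using inv ab by (auto simp: train_start_def)
    next
      case b: False
      \<comment> \<open>A pair straddling \<open>S\<close> is compared through \<open>S\<close>: the
        train invariant on the left of it, and on the right the fact that \<open>S\<close> and
        \<open>b\<close> form no bad pair.\<close>
      have "W i a - \<gamma> * a \<le> W i S - \<gamma> * S" using inv ab False by (auto simp: train_start_def)
      moreover have "W i S - \<gamma> * S \<le> W i b" using least[of S b] ab b by (auto simp: bad_def)
      ultimately show ?thesis by (auto simp: bad_def)
    qed
  qed
  have "W i S - \<gamma> * S \<le> W i m" if "S \<le> m" "m < M" for m
    using least[of S m] that gamma_pos by (cases "m = S") (auto simp: bad_def)
  with n ts cs nb show ?thesis by (intro exI[of _ n] exI[of _ M]) auto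
qed

text \<open>The last two clauses bound the later products of recursion factors within one train: the
  first by the tolerated loss from any of its times, the second without loss from its very start,
  where the type has just changed.\<close>

lemma trains_exist:
  "\<exists>(\<tau> :: nat \<Rightarrow> 2) T. 1 \<le> T 0 \<and> (\<forall>j. k * T j \<le> T (Suc j)) \<and>
    (\<forall>j n. T j \<le> n \<and> n < T (Suc j) \<longrightarrow> \<tau> n = \<tau> (T j)) \<and>
    (\<forall>n m. T 0 \<le> n \<and> n \<le> m \<and> (\<forall>l\<in>{n..m}. \<tau> l = \<tau> n) \<longrightarrow> W (\<tau> n) n - \<gamma> * n \<le> W (\<tau> n) m) \<and>
    (\<forall>n m. T 0 \<le> n \<and> Suc n \<le> m \<and> \<tau> n \<noteq> \<tau> (Suc n) \<and> (\<forall>l\<in>{Suc n..m}. \<tau> l = \<tau> (Suc n)) \<longrightarrow>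
      W (\<tau> (Suc n)) (Suc n) \<le> W (\<tau> (Suc n)) m)"
proof (cases "\<exists>i n0. \<forall>n m. n0 \<le> n \<longrightarrow> \<not> bad i n m")
  case True
  then obtain i n0 where nb: "\<And>n m. n0 \<le> n \<Longrightarrow> \<not> bad i n m" by blast
  have "W i n - \<gamma> * n \<le> W i m" if "n0 \<le> n" "n \<le> m" for n m
    using nb[of n m] that gamma_pos by (cases "n = m") (auto simp: bad_def)
  \<comment> \<open>The type never switches here, so the clause about switches is vacuous, and
    \<open>T\<close> is any sequence beyond \<open>n0\<close> with growth factor
    \<open>k\<close>.\<close>
  then show ?thesis
    by (intro exI[of _ "\<lambda>_. i"] exI[of _ "\<lambda>j. (n0 + 1) * k ^ j"]) (auto simp: algebra_simps)
next
  case False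
  define P where "P x y \<longleftrightarrow> (case x of (t, i, S) \<Rightarrow> case y of (t', i', S') \<Rightarrow>
    S \<le> t' \<and> i' = i + 1 \<and> train_start t' i' S' \<and> clean_switch t' i' S' \<and> t' < S' \<and>
    (\<forall>n m. t \<le> n \<and> m < S' \<longrightarrow> \<not> bad i n m) \<and> (\<forall>m. S \<le> m \<and> m < S' \<longrightarrow> W i S - \<gamma> * S \<le> W i m))"
    for x y :: "nat \<times> 2 \<times> nat"
  define Q where "Q x \<longleftrightarrow> (case x of (t, i, S) \<Rightarrow> train_start t i S)" for x :: "nat \<times> 2 \<times> nat"
  have ex: "\<exists>y. Q y \<and> P x y" if "Q x" for x
  proof -
    obtain t i S where x: "x = (t, i, S)" by (cases x)
    have "\<exists>n m. S \<le> n \<and> bad i n m" using False by blast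
    from next_train[OF _ this, of t] that obtain t' S' where "P x (t', i + 1, S')" "Q (t', i + 1, S')"
      unfolding x P_def Q_def by auto
    then show ?thesis by blast
  qed
  have "Q (1, 1, 1)" by (auto simp: Q_def train_start_def bad_def)
  then obtain st where st: "\<And>j::nat. Q (st j)" "\<And>j. P (st j) (st (Suc j))"
    using dependent_nat_choice[of "\<lambda>_. Q" "\<lambda>_. P"] ex by metis
  \<comment> \<open>The seed \<open>(1, 1, 1)\<close> is a formal train without a clean switch; its
    successors have one, so the numbering starts at \<open>st 1\<close>.\<close>
  define T where "T j = fst (st (Suc j))" for j
  define \<iota> where "\<iota> j = fst (snd (st (Suc j)))" for j
  define S where "S j = snd (snd (st (Suc j)))" for j
  have stj: "st (Suc j) = (T j, \<iota> j, S j)" for j by (simp add: T_def \<iota>_def S_def)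
  have ts: "train_start (T j) (\<iota> j) (S j)" for j using st(1)[of "Suc j"] by (simp add: Q_def stj)
  have cs: "clean_switch (T j) (\<iota> j) (S j)" for j
  proof -
    have "P (st j) (T j, \<iota> j, S j)" using st(2)[of j] by (simp add: stj)
    then show ?thesis by (cases "st j") (auto simp: P_def)
  qed
  have nxt: "S j \<le> T (Suc j)" "\<iota> (Suc j) = \<iota> j + 1" "T (Suc j) < S (Suc j)"
    "\<And>n m. T j \<le> n \<Longrightarrow> m < S (Suc j) \<Longrightarrow> \<not> bad (\<iota> j) n m"
    "\<And>m. S j \<le> m \<Longrightarrow> m < S (Suc j) \<Longrightarrow> W (\<iota> j) (S j) - \<gamma> * S j \<le> W (\<iota> j) m" for j
    using st(2)[of "Suc j"] by (auto simp: P_def stj)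
  have T1: "1 \<le> T j" for j using ts[of j] by (simp add: train_start_def)
  have grow: "k * T j \<le> T (Suc j)" for j
    using cs[of j] nxt(1)[of j] by (simp add: clean_switch_def)
  have Tless: "T j < T (Suc j)" for j
  proof -
    have "2 * T j \<le> k * T j" using k by (intro mult_right_mono) auto
    then show ?thesis using grow[of j] T1[of j] by linarith
  qed
  then have Tmono: "strict_mono T" by (simp add: strict_mono_Suc_iff)
  define \<tau> where "\<tau> n = \<iota> (LEAST j. n < T (Suc j))" for n
  have tau: "\<tau> n = \<iota> j" if "T j \<le> n" "n < T (Suc j)" for n j
  proof -
    have "(LEAST j. n < T (Suc j)) = j"
    proof (rule Least_equality)
      show "n < T (Suc j)" by fact
      fix y assume "n < T (Suc y)"
      then have "T j < T (Suc y)" using that by simp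
      then show "j \<le> y" using Tmono by (simp add: strict_mono_less)
    qed
    then show ?thesis by (simp add: \<tau>_def)
  qed
  have find: "\<exists>j. T j \<le> n \<and> n < T (Suc j)" if "T 0 \<le> n" for n
  proof -
    define j where "j = (LEAST j. n < T (Suc j))"
    have "n < T (Suc n)" using strict_mono_imp_increasing[OF Tmono, of "Suc n"] by simp
    then have 1: "n < T (Suc j)" unfolding j_def by (rule LeastI)
    have "T j \<le> n"
    proof (cases j)
      case (Suc i)
      then show ?thesis using not_less_Least[of i "\<lambda>j. n < T (Suc j)"] by (simp add: j_def)
    qed (use that in simp)
    show ?thesis by (rule exI[of _ j]) (rule conjI[OF \<open>T j \<le> n\<close> 1])
  qed
  \<comment> \<open>Consecutive trains have different types, so an interval on which \<tau> is
    constant lies within one train.\<close>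
  have run: "m < T (Suc j)" if "T j \<le> n" "n < T (Suc j)" "n \<le> m" "\<forall>l\<in>{n..m}. \<tau> l = \<tau> n" for n m j
  proof (rule ccontr)
    assume "\<not> m < T (Suc j)"
    then have "T (Suc j) \<in> {n..m}" using that(2) by simp
    with that(4) have "\<tau> (T (Suc j)) = \<tau> n" by (rule bspec)
    moreover have "\<tau> (T (Suc j)) = \<iota> (Suc j)" by (rule tau) (simp_all add: Tless)
    moreover have "\<tau> n = \<iota> j" by (rule tau) (rule that)+
    ultimately have "\<iota> j + 1 = \<iota> j" using nxt(2)[of j] by simp
    then show False by simp
  qed
  have c1: "\<tau> n = \<tau> (T j)" if "T j \<le> n \<and> n < T (Suc j)" for j n
    using tau[of j n] tau[of j "T j"] that Tless[of j] by simp
  have c2: "W (\<tau> n) n - \<gamma> * n \<le> W (\<tau> n) m"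
    if H: "T 0 \<le> n" "n \<le> m" "\<forall>l\<in>{n..m}. \<tau> l = \<tau> n" for n m
  proof -
    obtain j where j: "T j \<le> n" "n < T (Suc j)" using find[OF H(1)] by blast
    have "m < T (Suc j)" by (rule run[OF j]) (use H in \<open>simp_all only:\<close>)
    then have "m < S (Suc j)" using nxt(3)[of j] by simp
    then have "\<not> bad (\<tau> n) n m" using nxt(4)[OF j(1)] tau[OF j] by simp
    then show ?thesis using H(2) gamma_pos by (cases "n = m") (simp_all add: bad_def)
  qed
  have c3: "W (\<tau> (Suc n)) (Suc n) \<le> W (\<tau> (Suc n)) m"
    if H: "T 0 \<le> n" "Suc n \<le> m" "\<tau> n \<noteq> \<tau> (Suc n)" "\<forall>l\<in>{Suc n..m}. \<tau> l = \<tau> (Suc n)" for n m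
  proof -
    obtain j where j: "T j \<le> Suc n" "Suc n < T (Suc j)" using find[of "Suc n"] H(1) by auto
    have "T j = Suc n"
    proof (rule ccontr)
      assume "T j \<noteq> Suc n"
      then have "T j \<le> n" "n < T (Suc j)" using j by auto
      from tau[OF this] tau[OF j] H(3) show False by simp
    qed
    have "m < T (Suc j)" by (rule run[OF j]) (use H in \<open>simp_all only:\<close>)
    then have "m < S (Suc j)" using nxt(3)[of j] by simp
    show ?thesis
    proof (cases "m \<le> S j")
      case True
      then show ?thesis using cs[of j] tau[OF j] \<open>T j = Suc n\<close> H(2) by (simp add: clean_switch_def)
    next
      case False
      then have "W (\<iota> j) (S j) - \<gamma> * S j \<le> W (\<iota> j) m" using nxt(5)[of j m] \<open>m < S (Suc j)\<close> by simp
      then show ?thesis using cs[of j] tau[OF j] \<open>T j = Suc n\<close> by (simp add: clean_switch_def)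
    qed
  qed
  show ?thesis
  proof (intro exI[of _ \<tau>] exI[of _ T] conjI allI impI)
    show "1 \<le> T 0" by (rule T1)
    show "k * T j \<le> T (Suc j)" for j by (rule grow)
    show "\<tau> n = \<tau> (T j)" if "T j \<le> n \<and> n < T (Suc j)" for j n
      using that by (rule c1)
    show "W (\<tau> n) n - \<gamma> * n \<le> W (\<tau> n) m"
      if "T 0 \<le> n \<and> n \<le> m \<and> (\<forall>l\<in>{n..m}. \<tau> l = \<tau> n)" for n m
      by (rule c2[OF that[THEN conjunct1] that[THEN conjunct2, THEN conjunct1] that[THEN conjunct2, THEN conjunct2]])
    show "W (\<tau> (Suc n)) (Suc n) \<le> W (\<tau> (Suc n)) m"
      if "T 0 \<le> n \<and> Suc n \<le> m \<and> \<tau> n \<noteq> \<tau> (Suc n) \<and> (\<forall>l\<in>{Suc n..m}. \<tau> l = \<tau> (Suc n))" for n m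
      by (rule c3[OF that[THEN conjunct1] that[THEN conjunct2, THEN conjunct1]
        that[THEN conjunct2, THEN conjunct2, THEN conjunct1] that[THEN conjunct2, THEN conjunct2, THEN conjunct2]])
  qed
qed

end

section \<open>Coefficients of the triangular normal form\<close>

text \<open>The solution of \<open>e n = y n + \<rho> n * e (Suc n)\<close> obtained by substituting
  towards later times. A zero of \<rho> truncates the sum, which is how the trains are kept apart
  below.\<close>

definition backward_series :: "(nat \<Rightarrow> complex) \<Rightarrow> (nat \<Rightarrow> complex) \<Rightarrow> nat \<Rightarrow> complex"
  where "backward_series \<rho> y n = (\<Sum>m. (\<Prod>j<m. \<rho> (n + j)) * y (n + m))"

lemma backward_series_bound:
  assumes y: "\<And>n. norm (y n) \<le> Y" and \<theta>: "0 \<le> \<theta>" "\<theta> < 1"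
    and E: "\<And>m. norm (\<Prod>j<m. \<rho> (n + j)) \<le> E * \<theta> ^ m"
  shows "summable (\<lambda>m. (\<Prod>j<m. \<rho> (n + j)) * y (n + m))"
    and "norm (backward_series \<rho> y n) \<le> E * Y / (1 - \<theta>)"
proof -
  have Y0: "0 \<le> Y" using order_trans[OF norm_ge_zero y[of 0]] .
  have le: "norm ((\<Prod>j<m. \<rho> (n + j)) * y (n + m)) \<le> E * Y * \<theta> ^ m" for m
  proof -
    have "norm (\<Prod>j<m. \<rho> (n + j)) * norm (y (n + m)) \<le> (E * \<theta> ^ m) * Y"
      by (rule mult_mono[OF E y]) (use order_trans[OF norm_ge_zero E] in auto)
    then show ?thesis by (simp only: norm_mult mult_ac)
  qed
  have sg: "summable (\<lambda>m. E * Y * \<theta> ^ m)"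
    using \<theta> by (intro summable_mult summable_geometric) simp
  have sn: "summable (\<lambda>m. norm ((\<Prod>j<m. \<rho> (n + j)) * y (n + m)))"
    by (rule summable_comparison_test'[OF sg]) (simp only: real_norm_def abs_norm_cancel le)
  then show "summable (\<lambda>m. (\<Prod>j<m. \<rho> (n + j)) * y (n + m))" by (rule summable_norm_cancel)
  have "norm (backward_series \<rho> y n) \<le> (\<Sum>m. norm ((\<Prod>j<m. \<rho> (n + j)) * y (n + m)))"
    unfolding backward_series_def by (rule summable_norm[OF sn])
  also have "\<dots> \<le> (\<Sum>m. E * Y * \<theta> ^ m)" by (rule suminf_le[OF le sn sg])
  also have "\<dots> = E * Y * (1 / (1 - \<theta>))"
    using \<theta> by (subst suminf_mult) (auto simp: suminf_geometric intro: summable_geometric)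
  finally show "norm (backward_series \<rho> y n) \<le> E * Y / (1 - \<theta>)" by simp
qed

lemma backward_series_rec:
  assumes "summable (\<lambda>m. (\<Prod>j<m. \<rho> (n + j)) * y (n + m))"
    and "summable (\<lambda>m. (\<Prod>j<m. \<rho> (Suc n + j)) * y (Suc n + m))"
  shows "backward_series \<rho> y n = y n + \<rho> n * backward_series \<rho> y (Suc n)"
proof -
  have shift: "(\<Prod>j<Suc m. \<rho> (n + j)) = \<rho> n * (\<Prod>j<m. \<rho> (Suc n + j))" for m
    by (subst prod.lessThan_Suc_shift) simp
  have "backward_series \<rho> y n = y n + (\<Sum>m. (\<Prod>j<Suc m. \<rho> (n + j)) * y (n + Suc m))"
    unfolding backward_series_def using suminf_split_head[OF assms(1)] by simp
  also have "(\<Sum>m. (\<Prod>j<Suc m. \<rho> (n + j)) * y (n + Suc m))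
      = (\<Sum>m. \<rho> n * ((\<Prod>j<m. \<rho> (Suc n + j)) * y (Suc n + m)))"
    unfolding shift by (simp add: mult.assoc)
  also have "\<dots> = \<rho> n * backward_series \<rho> y (Suc n)"
    unfolding backward_series_def by (rule suminf_mult[OF assms(2)])
  finally show ?thesis .
qed

text \<open>\<open>D0\<close> is the attraction constant of the maps, \<open>D\<close> a slightly
  larger number that sets the scale \<open>D ^ n\<close> of the balls. Orbits decaying like
  \<open>D0 ^ n\<close> will enter such balls because of the gap.\<close>

locale diagonal_jets =
  fixes lam p :: "nat \<Rightarrow> 2 \<Rightarrow> complex" and C D D0 K :: real and k :: nat
  assumes C0: "0 < C" and D0: "0 < D0" "D0 < D" and D1: "D < 1" and CD: "D ^ (k + 1) < C"
    and k2: "2 \<le> k" and lamC: "C \<le> norm (lam n i)" and lamD: "norm (lam n i) \<le> D0"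
    and pK: "norm (p n i) \<le> K" and K1: "1 \<le> K"
begin

lemma Dpos: "0 < D" using D0 by simp

lemma lam_nz: "lam n i \<noteq> 0"
  using lamC[of n i] C0 by auto

text \<open>Conjugation with the shears \<open>Z $ i + c n i * (Z $ (i + 1)) ^ k\<close> turns, up
  to higher order, the coefficient \<open>p\<close> of the pure power into \<open>q\<close>. Only
  the component \<open>\<tau> n\<close> of \<open>c n\<close> is nonzero, so
  \<open>q n (\<tau> n) = 0\<close> is the backward recursion along a train. Just before a switch,
  the first \<open>c\<close> of the new train appears in the other component of \<open>q\<close>,
  whence the need for a bound there.\<close>

theorem normal_form_coefficients:
  "\<exists>\<tau> T c q K' \<kappa>. 1 \<le> T 0 \<and> (\<forall>j. k * T j \<le> T (Suc j)) \<and>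
    (\<forall>j n. T j \<le> n \<and> n < T (Suc j) \<longrightarrow> \<tau> n = \<tau> (T j)) \<and>
    (\<forall>n i. q n i = p n i + c (Suc n) i * lam n (i + 1) ^ k - lam n i * c n i) \<and>
    0 < \<kappa> \<and> \<kappa> < 1 \<and> 1 \<le> K' \<and>
    (\<forall>n\<ge>T 0. q n (\<tau> n) = 0 \<and> (\<forall>i. norm (q n i) \<le> K' \<and> norm (c n i) * (D ^ n) ^ (k - 1) \<le> K' * \<kappa> ^ n))"
proof -
  define L where "L = - ln D"
  have L0: "0 < L" using D1 Dpos by (simp add: L_def)
  \<comment> \<open>Half of the slack in \<open>D ^ (k + 1) < C\<close>, on the logarithmic scale.
    One \<delta> pays for the geometric convergence of the series, the other for keeping the loss
    per step at \<open>L - \<delta>\<close>, strictly below \<open>L\<close>.\<close>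
  define \<delta> where "\<delta> = min (((k + 1) * L + ln C) / 2) (L / 2)"
  have "ln (D ^ (k + 1)) < ln C" using CD Dpos C0 by (subst ln_less_cancel_iff) auto
  moreover have "ln (D ^ (k + 1)) = real (k + 1) * ln D" using Dpos by (simp only: ln_realpow)
  ultimately have "0 < (k + 1) * L + ln C" by (simp add: L_def)
  then have "0 < \<delta>" using L0 by (simp add: \<delta>_def)
  moreover have "\<delta> \<le> ((k + 1) * L + ln C) / 2" "\<delta> \<le> L / 2"
    unfolding \<delta>_def by (rule min.cobounded1, rule min.cobounded2)
  ultimately have \<delta>: "0 < \<delta>" "2 * \<delta> \<le> (k + 1) * L + ln C" "\<delta> \<le> L / 2" by auto
  define r where "r i n = norm (lam n (i + 1)) ^ k / norm (lam n i)" for i n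
  have r0: "0 < r i n" for i n using lam_nz by (simp add: r_def)
  have lnr: "ln (r i n) = k * ln (norm (lam n (i + 1))) - ln (norm (lam n i))" for i n
    using lam_nz by (simp add: r_def ln_div ln_realpow)
  have lnlam: "ln (norm (lam n i)) \<le> - L" "ln C \<le> ln (norm (lam n i))" for n i
  proof -
    have "norm (lam n i) \<le> D" using lamD[of n i] D0 by simp
    then show "ln (norm (lam n i)) \<le> - L" using lam_nz Dpos by (simp add: L_def)
    show "ln C \<le> ln (norm (lam n i))" using lam_nz lamC[of n i] C0 by simp
  qed
  define W where "W i n = (\<Sum>m<n. - ln (r i m) - \<delta>)" for i n
  define \<gamma> where "\<gamma> = (real k - 1) * (L - \<delta>)"
  \<comment> \<open>The product of the two recursion factors is the product of both eigenvalues, in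
    modulus, to the power \<open>k - 1\<close>, hence at most \<open>D ^ (2 * (k - 1))\<close>; the
    two losses \<delta> are then subtracted.\<close>
  define \<nu> where "\<nu> = 2 * (real k - 1) * L - 2 * \<delta>"
  interpret drift W k "L - \<delta>" \<nu> \<gamma>
  proof
    show "0 < L - \<delta>" using \<delta> L0 by simp
    show "2 \<le> k" by (rule k2)
    show "\<gamma> = (real k - 1) * (L - \<delta>)" by (simp add: \<gamma>_def)
    have "1 * (L + \<delta>) \<le> (real k - 1) * (L + \<delta>)" using k2 \<delta> L0 by (intro mult_right_mono) auto
    then show "\<gamma> < \<nu>" using \<delta> L0 by (simp add: \<gamma>_def \<nu>_def algebra_simps)
  next
    fix i n
    have "ln (r i n) \<le> L - 2 * \<delta>"
    proof -
      have "k * ln (norm (lam n (i + 1))) \<le> k * (- L)" using lnlam by (intro mult_left_mono) auto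
      then show ?thesis using lnlam(2)[of n i] \<delta>(2) by (simp add: lnr algebra_simps)
    qed
    then show "W i n - (L - \<delta>) \<le> W i (Suc n)" by (simp add: W_def)
  next
    fix n m :: nat and i :: 2 assume "n \<le> m"
    then show "\<nu> * (real m - real n) \<le> (W i m - W i n) + (W (i + 1) m - W (i + 1) n)"
    proof (induction m rule: dec_induct)
      case (step m)
      have "(real k - 1) * (ln (norm (lam m i)) + ln (norm (lam m (i + 1)))) \<le> (real k - 1) * (- L + - L)"
        using k2 lnlam by (intro mult_left_mono add_mono) auto
      moreover have "ln (r (i + 1) m) = k * ln (norm (lam m i)) - ln (norm (lam m (i + 1)))"
        using lnr[of "i + 1" m] by simp
      ultimately have "\<nu> \<le> (- ln (r i m) - \<delta>) + (- ln (r (i + 1) m) - \<delta>)"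
        unfolding lnr[of i] \<nu>_def by (simp add: algebra_simps)
      then show ?case using step by (simp add: W_def algebra_simps)
    qed simp
  qed
  obtain \<tau> :: "nat \<Rightarrow> 2" and T where T: "1 \<le> T 0" "\<forall>j. k * T j \<le> T (Suc j)"
    "\<forall>j n. T j \<le> n \<and> n < T (Suc j) \<longrightarrow> \<tau> n = \<tau> (T j)"
    and P1: "\<And>n m. T 0 \<le> n \<Longrightarrow> n \<le> m \<Longrightarrow> (\<forall>l\<in>{n..m}. \<tau> l = \<tau> n) \<Longrightarrow> W (\<tau> n) n - \<gamma> * n \<le> W (\<tau> n) m"
    and P2: "\<And>n m. T 0 \<le> n \<Longrightarrow> Suc n \<le> m \<Longrightarrow> \<tau> n \<noteq> \<tau> (Suc n) \<Longrightarrow>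
        (\<forall>l\<in>{Suc n..m}. \<tau> l = \<tau> (Suc n)) \<Longrightarrow> W (\<tau> (Suc n)) (Suc n) \<le> W (\<tau> (Suc n)) m"
    using trains_exist by metis
  \<comment> \<open>The value 0 at the last time of a train cuts the series there: the new train
    handles the other component, and \<open>c\<close> of the old type is 0 from then on until its
    next turn.\<close>
  define \<rho> where "\<rho> n = (if \<tau> (Suc n) = \<tau> n then lam n (\<tau> n + 1) ^ k / lam n (\<tau> n) else 0)" for n
  define y where "y n = p n (\<tau> n) / lam n (\<tau> n)" for n
  define \<theta> where "\<theta> = exp (- \<delta>)"
  have \<theta>: "0 < \<theta>" "\<theta> < 1" using \<delta> by (auto simp: \<theta>_def)
  have prod: "(\<Prod>j<m. norm (\<rho> (n + j))) = exp (- (W (\<tau> n) (n + m) - W (\<tau> n) n)) * \<theta> ^ m"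
    if "\<forall>l\<in>{n..n + m}. \<tau> l = \<tau> n" for n m
    using that
  proof (induction m)
    case 0
    show ?case by simp
  next
    case (Suc m)
    have "\<tau> (n + m) = \<tau> n" "\<tau> (Suc (n + m)) = \<tau> n"
      using Suc.prems[rule_format, of "n + m"] Suc.prems[rule_format, of "Suc (n + m)"] by simp_all
    then have "norm (\<rho> (n + m)) = r (\<tau> n) (n + m)"
      by (simp add: \<rho>_def r_def norm_divide norm_power)
    also have "\<dots> = exp (ln (r (\<tau> n) (n + m)))" using r0 by simp
    also have "\<dots> = exp (- (W (\<tau> n) (n + Suc m) - W (\<tau> n) (n + m))) * \<theta>"
      by (simp add: W_def \<theta>_def flip: exp_add)
    finally have 1: "norm (\<rho> (n + m)) = exp (- (W (\<tau> n) (n + Suc m) - W (\<tau> n) (n + m))) * \<theta>" .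
    have 2: "(\<Prod>j<m. norm (\<rho> (n + j))) = exp (- (W (\<tau> n) (n + m) - W (\<tau> n) n)) * \<theta> ^ m"
      by (rule Suc.IH) (rule ballI, rule Suc.prems[rule_format], simp)
    have 3: "exp (- (W (\<tau> n) (n + Suc m) - W (\<tau> n) n))
        = exp (- (W (\<tau> n) (n + m) - W (\<tau> n) n)) * exp (- (W (\<tau> n) (n + Suc m) - W (\<tau> n) (n + m)))"
      by (subst exp_add[symmetric]) simp
    show ?case
      unfolding prod.lessThan_Suc 1 2 3 power_Suc by (simp only: mult_ac)
  qed
  have prod0: "(\<Prod>j<m. norm (\<rho> (n + j))) = 0" if "\<not> (\<forall>l\<in>{n..n + m}. \<tau> l = \<tau> n)" for n m
  proof -
    have "\<exists>j<m. \<tau> (Suc (n + j)) \<noteq> \<tau> (n + j)"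
    proof (rule ccontr)
      assume a: "\<not> (\<exists>j<m. \<tau> (Suc (n + j)) \<noteq> \<tau> (n + j))"
      have "j \<le> m \<Longrightarrow> \<tau> (n + j) = \<tau> n" for j using a by (induction j) auto
      then have "\<tau> l = \<tau> n" if "l \<in> {n..n + m}" for l
        using that by (metis add_le_cancel_left atLeastAtMost_iff le_Suc_ex)
      with \<open>\<not> (\<forall>l\<in>{n..n + m}. \<tau> l = \<tau> n)\<close> show False by blast
    qed
    then obtain j where "j < m" "\<rho> (n + j) = 0" by (auto simp: \<rho>_def)
    then show ?thesis by (intro prod_zero) auto
  qed
  have prod_le: "norm (\<Prod>j<m. \<rho> (n + j)) \<le> exp (\<gamma> * n) * \<theta> ^ m" if "T 0 \<le> n" for n m
  proof (cases "\<forall>l\<in>{n..n + m}. \<tau> l = \<tau> n")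
    case True
    have "- (W (\<tau> n) (n + m) - W (\<tau> n) n) \<le> \<gamma> * n" using P1[OF \<open>T 0 \<le> n\<close> _ True] by simp
    then show ?thesis unfolding prod_norm[symmetric] prod[OF True] using \<theta> by (intro mult_right_mono) auto
  next
    case False
    show ?thesis unfolding prod_norm[symmetric] prod0[OF False] using \<theta> by simp
  qed
  have prod_le': "norm (\<Prod>j<m. \<rho> (Suc n + j)) \<le> 1 * \<theta> ^ m" if "T 0 \<le> n" "\<tau> n \<noteq> \<tau> (Suc n)" for n m
  proof (cases "\<forall>l\<in>{Suc n..Suc n + m}. \<tau> l = \<tau> (Suc n)")
    case True
    have "- (W (\<tau> (Suc n)) (Suc n + m) - W (\<tau> (Suc n)) (Suc n)) \<le> 0"
      using P2[OF \<open>T 0 \<le> n\<close> _ that(2) True] by simp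
    then show ?thesis unfolding prod_norm[symmetric] prod[OF True] using \<theta> by (intro mult_right_mono) auto
  next
    case False
    show ?thesis unfolding prod_norm[symmetric] prod0[OF False] using \<theta> by simp
  qed
  define Y where "Y = K / C"
  have Y: "norm (y n) \<le> Y" for n
    unfolding y_def Y_def norm_divide by (intro frac_le pK lamC C0) (use K1 in simp)
  have Y0: "0 \<le> Y" using K1 C0 by (simp add: Y_def)
  define e where "e = backward_series \<rho> y"
  define G where "G = Y / (1 - \<theta>)"
  have G0: "0 \<le> G" using Y0 \<theta> by (simp add: G_def)
  have e_le: "norm (e n) \<le> exp (\<gamma> * n) * G" if "T 0 \<le> n" for n
    using backward_series_bound(2)[OF Y less_imp_le[OF \<theta>(1)] \<theta>(2) prod_le[OF that]]
    by (simp add: e_def G_def)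
  have e_le': "norm (e (Suc n)) \<le> G" if "T 0 \<le> n" "\<tau> n \<noteq> \<tau> (Suc n)" for n
    using backward_series_bound(2)[OF Y less_imp_le[OF \<theta>(1)] \<theta>(2) prod_le'[OF that]]
    by (simp add: e_def G_def)
  have e_rec: "e n = y n + \<rho> n * e (Suc n)" if "T 0 \<le> n" for n
    unfolding e_def
    by (rule backward_series_rec; rule backward_series_bound(1)[OF Y less_imp_le[OF \<theta>(1)] \<theta>(2) prod_le])
      (use that in auto)
  define c where "c n i = (if i = \<tau> n then e n else 0)" for n i
  define q where "q n i = p n i + c (Suc n) i * lam n (i + 1) ^ k - lam n i * c n i" for n i
  \<comment> \<open>The growth \<open>exp (\<gamma> * n)\<close> of the coefficients against the
    factor \<open>exp (- L * (k - 1) * n)\<close> of \<open>(D ^ n) ^ (k - 1)\<close> leaves exactly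
    this rate.\<close>
  define \<kappa> where "\<kappa> = exp (- ((real k - 1) * \<delta>))"
  define K' where "K' = K + G + 1"
  have q_main: "q n (\<tau> n) = 0" if "T 0 \<le> n" for n
  proof -
    have "lam n (\<tau> n) * \<rho> n = (if \<tau> (Suc n) = \<tau> n then lam n (\<tau> n + 1) ^ k else 0)"
      using lam_nz[of n "\<tau> n"] by (simp add: \<rho>_def)
    moreover have "lam n (\<tau> n) * e n = p n (\<tau> n) + (lam n (\<tau> n) * \<rho> n) * e (Suc n)"
      unfolding e_rec[OF that] y_def using lam_nz[of n "\<tau> n"] by (simp add: distrib_left)
    ultimately have "lam n (\<tau> n) * e n
        = p n (\<tau> n) + (if \<tau> (Suc n) = \<tau> n then lam n (\<tau> n + 1) ^ k else 0) * e (Suc n)" by simp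
    then show ?thesis
      by (cases "\<tau> (Suc n) = \<tau> n") (simp_all add: q_def c_def eq_commute[of "\<tau> n"])
  qed
  have q_le: "norm (q n i) \<le> K'" if "T 0 \<le> n" for n i
  proof (cases "i = \<tau> n")
    case True
    then show ?thesis using q_main[OF that] K1 G0 by (simp add: K'_def)
  next
    case False
    have "norm (c (Suc n) i) \<le> G"
      using e_le'[OF that] False G0 by (auto simp: c_def)
    moreover have "norm (lam n (i + 1) ^ k) \<le> 1"
      unfolding norm_power using lamD[of n "i + 1"] D0 D1 by (intro power_le_one) auto
    ultimately have "norm (c (Suc n) i * lam n (i + 1) ^ k) \<le> G * 1"
      unfolding norm_mult using G0 by (intro mult_mono) auto
    moreover have "q n i = p n i + c (Suc n) i * lam n (i + 1) ^ k"
      using False by (simp add: q_def c_def)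
    ultimately show ?thesis
      using norm_triangle_ineq[of "p n i" "c (Suc n) i * lam n (i + 1) ^ k"] pK[of n i] by (simp add: K'_def)
  qed
  have c_le: "norm (c n i) * (D ^ n) ^ (k - 1) \<le> K' * \<kappa> ^ n" if "T 0 \<le> n" for n i
  proof -
    have "norm (c n i) \<le> exp (\<gamma> * n) * G"
      using e_le[OF that] G0 by (auto simp: c_def)
    then have "norm (c n i) * (D ^ n) ^ (k - 1) \<le> exp (\<gamma> * n) * G * (D ^ n) ^ (k - 1)"
      using Dpos by (intro mult_right_mono) auto
    also have "\<dots> = exp (\<gamma> * n) * G * exp (- L * (real n * (real k - 1)))"
    proof -
      have "(D ^ n) ^ (k - 1) = exp (- L) ^ (n * (k - 1))"
        using Dpos by (simp add: L_def power_mult)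
      also have "\<dots> = exp (- L * (real n * (real k - 1)))"
        using k2 by (subst exp_of_nat_mult[symmetric]) (simp add: of_nat_diff algebra_simps)
      finally show ?thesis by simp
    qed
    also have "\<dots> = G * \<kappa> ^ n"
    proof -
      have "\<gamma> * n + - L * (real n * (real k - 1)) = real n * (- ((real k - 1) * \<delta>))"
        by (simp add: \<gamma>_def algebra_simps)
      then have "exp (\<gamma> * n) * exp (- L * (real n * (real k - 1))) = \<kappa> ^ n"
        unfolding \<kappa>_def exp_of_nat_mult[symmetric] exp_add[symmetric] by simp
      then show ?thesis by (metis mult.assoc mult.commute)
    qed
    also have "\<dots> \<le> K' * \<kappa> ^ n"
      using K1 by (intro mult_right_mono) (auto simp: K'_def \<kappa>_def)
    finally show ?thesis .
  qed
  have "0 < \<kappa>" "\<kappa> < 1" using k2 \<delta> by (auto simp: \<kappa>_def)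
  moreover have "1 \<le> K'" using K1 G0 by (simp add: K'_def)
  ultimately show ?thesis
    using T q_main q_le c_le
    by (intro exI[of _ \<tau>] exI[of _ T] exI[of _ c] exI[of _ q] exI[of _ K'] exI[of _ \<kappa>] conjI allI impI)
      (simp_all only: q_def)
qed

end

section \<open>A priori bounds for the approximate conjugacies\<close>

lemma norm_power_diff_le:
  fixes z w :: complex
  assumes z: "norm z \<le> r" and w: "norm w \<le> r"
  shows "norm (z ^ m - w ^ m) \<le> real m * r ^ (m - 1) * norm (z - w)"
proof (induction m)
  case (Suc m)
  have r: "0 \<le> r" using order_trans[OF norm_ge_zero z] .
  have "z ^ Suc m - w ^ Suc m = z * (z ^ m - w ^ m) + (z - w) * w ^ m" by (simp add: algebra_simps)
  then have "norm (z ^ Suc m - w ^ Suc m) \<le> norm z * norm (z ^ m - w ^ m) + norm (z - w) * norm w ^ m"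
    using norm_triangle_ineq[of "z * (z ^ m - w ^ m)" "(z - w) * w ^ m"] by (simp only: norm_mult norm_power)
  also have "\<dots> \<le> r * (real m * r ^ (m - 1) * norm (z - w)) + norm (z - w) * r ^ m"
    using Suc z w r by (intro add_mono mult_mono power_mono) auto
  also have "r * (real m * r ^ (m - 1) * norm (z - w)) = real m * r ^ m * norm (z - w)"
    by (cases m) simp_all
  finally show ?case by (simp add: algebra_simps)
qed simp

locale normal_form = diagonal_jets +
  fixes f :: "nat \<Rightarrow> complex ^ 2 \<Rightarrow> complex ^ 2"
    and \<tau> :: "nat \<Rightarrow> 2" and c q :: "nat \<Rightarrow> 2 \<Rightarrow> complex" and K' \<kappa> :: real and n1 :: nat
  assumes f_hol: "holomorphic_map_on (f n) UNIV"
    and f_le: "norm Z < 1 \<Longrightarrow> norm (f n Z) \<le> D0 * norm Z"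
    and f_jet1: "norm Z \<le> 1/16 \<Longrightarrow> norm (f n Z $ i - lam n i * Z $ i) \<le> K * norm Z ^ k"
    and f_jet: "norm Z \<le> 1/16 \<Longrightarrow> norm (f n Z $ i - lam n i * Z $ i - p n i * (Z $ (i + 1)) ^ k)
        \<le> K * (norm (Z $ i) * norm Z ^ (k - 1) + norm Z ^ (k + 1))"
    and q_eq: "q n i = p n i + c (Suc n) i * lam n (i + 1) ^ k - lam n i * c n i"
    and kappa: "0 < \<kappa>" "\<kappa> < 1" and K'1: "1 \<le> K'"
    and q_main: "n1 \<le> n \<Longrightarrow> q n (\<tau> n) = 0" and q_le: "n1 \<le> n \<Longrightarrow> norm (q n i) \<le> K'"
    and c_le: "n1 \<le> n \<Longrightarrow> norm (c n i) * (D ^ n) ^ (k - 1) \<le> K' * \<kappa> ^ n"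
begin

definition g :: "nat \<Rightarrow> complex ^ 2 \<Rightarrow> complex ^ 2"
  where "g n Z = (\<chi> i. lam n i * Z $ i + q n i * (Z $ (i + 1)) ^ k)"

text \<open>An inverse of \<open>g n\<close> when one of the two coefficients vanishes: if
  \<open>q n i\<close> is not 0, component \<open>i + 1\<close> is purely linear, so dividing it by
  its eigenvalue recovers the coordinate whose power has to be subtracted.\<close>

definition ginv :: "nat \<Rightarrow> complex ^ 2 \<Rightarrow> complex ^ 2"
  where "ginv n Z = (\<chi> i. (Z $ i - q n i * (Z $ (i + 1) / lam n (i + 1)) ^ k) / lam n i)"

lemma q_cases: "n1 \<le> n \<Longrightarrow> q n i = 0 \<or> q n (i + 1) = 0"
  using q_main[of n] index2_cases[of "\<tau> n" i] by auto

lemma g_ginv: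
  assumes "n1 \<le> n" shows "g n (ginv n Z) = Z"
proof -
  have "g n (ginv n Z) $ i = Z $ i" for i
    using q_cases[OF assms, of i] lam_nz[of n] by (elim disjE) (simp_all add: g_def ginv_def)
  then show ?thesis unfolding vec_eq_iff ..
qed

lemma ginv_g:
  assumes "n1 \<le> n" shows "ginv n (g n Z) = Z"
proof -
  have "ginv n (g n Z) $ i = Z $ i" for i
    using q_cases[OF assms, of i] lam_nz[of n] by (elim disjE) (simp_all add: g_def ginv_def)
  then show ?thesis unfolding vec_eq_iff ..
qed

lemma g_hol: "holomorphic_map_on (g n) UNIV"
  unfolding holomorphic_map_on_iff g_def
  by (auto intro!: holomorphic_fun_on_add holomorphic_fun_on_mult holomorphic_fun_on_const
      holomorphic_fun_on_power holomorphic_fun_on_nth)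

lemma ginv_hol: "holomorphic_map_on (ginv n) UNIV"
  unfolding holomorphic_map_on_iff ginv_def
  by (auto intro!: holomorphic_fun_on_diff holomorphic_fun_on_mult holomorphic_fun_on_const
      holomorphic_fun_on_power holomorphic_fun_on_nth holomorphic_fun_on_divide_const)

text \<open>\<open>X d n\<close> and \<open>\<Psi> d n\<close> are obtained by pulling back \<open>d\<close> steps from time \<open>n + d\<close> to time \<open>n\<close>. The
  components of \<open>X\<close> solve linear equations and absorb the terms of order \<open>k\<close> other than the pure powers.\<close>

primrec X :: "nat \<Rightarrow> nat \<Rightarrow> complex ^ 2 \<Rightarrow> complex ^ 2" where
  "X 0 = (\<lambda>n Z. Z)"
| "X (Suc d) = (\<lambda>n Z. \<chi> i. (X d (Suc n) (f n Z) $ i - p n i * (Z $ (i + 1)) ^ k) / lam n i)"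

primrec \<Psi> :: "nat \<Rightarrow> nat \<Rightarrow> complex ^ 2 \<Rightarrow> complex ^ 2" where
  "\<Psi> 0 = (\<lambda>n Z. \<chi> i. Z $ i + c n i * (Z $ (i + 1)) ^ k)"
| "\<Psi> (Suc d) = (\<lambda>n Z. ginv n (\<Psi> d (Suc n) (f n Z)))"

lemma Psi_hol: "holomorphic_map_on (\<Psi> d n) UNIV"
proof (induction d arbitrary: n)
  case 0
  show ?case
    unfolding holomorphic_map_on_iff
    by (auto intro!: holomorphic_fun_on_add holomorphic_fun_on_mult holomorphic_fun_on_const
      holomorphic_fun_on_power holomorphic_fun_on_nth)
next
  case (Suc d)
  show ?case
    unfolding \<Psi>.simps
    by (rule holomorphic_map_on_compose[OF holomorphic_map_on_compose[OF f_hol Suc] ginv_hol]) auto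
qed

section \<open>Scales, contraction rates and constants of the estimates\<close>

definition s :: "nat \<Rightarrow> real" where "s n = D ^ n"

lemma s_pos: "0 < s n" using Dpos by (simp add: s_def)

lemma s_Suc: "s (Suc n) = D * s n" by (simp add: s_def)

lemma s_le1: "s n \<le> 1" using Dpos D1 by (simp add: s_def power_le_one)

lemma s_tendsto: "s \<longlonglongrightarrow> 0"
  unfolding s_def using Dpos D1 by (intro LIMSEQ_realpow_zero) auto

lemma f_ball: "norm Z \<le> r * s n \<Longrightarrow> r \<le> 1 \<Longrightarrow> s n < 1 \<Longrightarrow> norm (f n Z) \<le> r * s (Suc n)"
proof -
  assume Z: "norm Z \<le> r * s n" and r: "r \<le> 1" and sn: "s n < 1"
  have "r * s n \<le> 1 * s n" using r s_pos[of n] by (intro mult_right_mono) auto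
  then have "norm Z < 1" using Z sn by simp
  then have "norm (f n Z) \<le> D0 * norm Z" by (rule f_le)
  also have "\<dots> \<le> D * (r * s n)" using Z D0 Dpos by (intro mult_mono) auto
  finally show ?thesis by (simp add: s_Suc mult_ac)
qed

text \<open>The worse of two rates relative to the eigenvalue: at most \<open>D ^ (k - 1)\<close>
  for terms containing \<open>Z $ i\<close>, and \<open>D ^ (k + 1) / C\<close> for terms of order
  \<open>k + 1\<close>. The number \<theta> halfway to 1 leaves room to absorb mixed errors.\<close>

definition "\<theta>0 = max D (D ^ (k + 1) / C)"
definition "\<theta> = (1 + \<theta>0) / 2"
text \<open>The fixed point of \<open>M * \<theta> + K / C = M\<close>, which closes the induction
  in \<open>X_bound\<close>.\<close>

definition "M = K / (C * (1 - \<theta>))"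
text \<open>The four error constants of \<open>Psi_bound\<close>: \<open>A1\<close> for replacing
  \<open>Z\<close> by \<open>X\<close> in the pure power, \<open>A2\<close> for expanding the next
  shear, \<open>A3\<close> for the coupling through \<open>c\<close>, and \<open>A4\<close> for the
  coupling that carries \<open>M'\<close> itself.\<close>

definition "A1 = K * k * 2 ^ k * M"
definition "A2 = k * 3 ^ (k - 1) * K * K' / D ^ (k - 1)"
definition "A3 = 2 * K' * K' * k * 10 ^ k"
definition "A4 = 2 * K' * k * 5 ^ k"
text \<open>Large enough for two absorptions: the second entry absorbs the quadratic or higher part
  of \<open>f n\<close> in \<open>omega_contract\<close>, the third makes \<open>A4 / V\<close> at
  most \<open>C * (1 - \<theta>) / 2\<close>, so that \<open>M'\<close> can be chosen without
  circularity.\<close>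

definition "V = max 1 (max (K / (C * (\<theta> - \<theta>0))) (2 * A4 / (C * (1 - \<theta>))))"
text \<open>The fixed point of \<open>(A1 + A2 + A3) / C + (1 - \<theta>) / 2 * M' + \<theta> * M' =
  M'\<close>.\<close>

definition "M' = 2 * (A1 + A2 + A3) / (C * (1 - \<theta>))"

text \<open>A bound by \<open>\<omega>\<close> distinguishes terms of order \<open>k\<close> containing the factor \<open>Z $ i\<close>, which contract under
  \<open>u \<mapsto> u \<circ> f\<^sub>n / \<lambda>\<^sub>i\<close>, from the others, which do so only from order \<open>k + 1\<close> on.\<close>

definition \<omega> :: "nat \<Rightarrow> 2 \<Rightarrow> complex ^ 2 \<Rightarrow> real"
  where "\<omega> n i Z = norm (Z $ i) * s n ^ (k - 1) + V * s n ^ (k + 1)"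

definition good :: "nat \<Rightarrow> bool"
  where "good n \<longleftrightarrow> n1 \<le> n \<and> s n \<le> 1/16 \<and> V * s n \<le> 1 \<and> 2 * M * s n \<le> 1 \<and> K * s n \<le> 1 \<and>
    2 * M' * s n \<le> 1 \<and> 2 ^ k * K' * \<kappa> ^ n \<le> 1"

lemma theta0: "0 < \<theta>0" "\<theta>0 < 1"
  using Dpos D1 CD C0 by (auto simp: \<theta>0_def)

lemma theta: "\<theta>0 < \<theta>" "\<theta> < 1" "0 < \<theta>"
  using theta0 by (auto simp: \<theta>_def)

lemma consts_nonneg: "0 \<le> M" "0 \<le> A1" "0 \<le> A2" "0 \<le> A3" "0 \<le> A4" "0 \<le> M'" "1 \<le> V"
proof -
  show M: "0 \<le> M" using K1 C0 theta by (simp add: M_def)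
  show A: "0 \<le> A1" "0 \<le> A2" "0 \<le> A3" "0 \<le> A4"
    using K1 K'1 M Dpos by (auto simp: A1_def A2_def A3_def A4_def)
  show "0 \<le> M'" using A C0 theta by (simp add: M'_def)
  show "1 \<le> V" by (simp add: V_def)
qed

lemma eventually_good: "eventually good sequentially"
proof -
  have 1: "\<forall>\<^sub>F n in sequentially. a * s n \<le> e" if "0 < e" for a e
  proof -
    have "(\<lambda>n. a * s n) \<longlonglongrightarrow> a * 0" by (intro tendsto_intros s_tendsto)
    then have "\<forall>\<^sub>F n in sequentially. a * s n < e" using that by (intro order_tendstoD(2)) auto
    then show ?thesis by (rule eventually_mono) simp
  qed
  have "(\<lambda>n. 2 ^ k * K' * \<kappa> ^ n) \<longlonglongrightarrow> 2 ^ k * K' * 0"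
    using kappa by (intro tendsto_intros LIMSEQ_realpow_zero) auto
  then have "\<forall>\<^sub>F n in sequentially. 2 ^ k * K' * \<kappa> ^ n < 1" by (intro order_tendstoD(2)) auto
  then have 2: "\<forall>\<^sub>F n in sequentially. 2 ^ k * K' * \<kappa> ^ n \<le> 1" by (rule eventually_mono) simp
  show ?thesis
    unfolding good_def
    using 1[OF zero_less_one, of 16]
      1[OF zero_less_one, of V] 1[OF zero_less_one, of "2 * M"] 1[OF zero_less_one, of K]
      1[OF zero_less_one, of "2 * M'"] 2 eventually_ge_at_top[of n1]
    by eventually_elim simp
qed

lemma s_powers: "s n ^ (k - 1) * s n ^ k \<le> s n ^ (k + 1)" "s n ^ (k - 1) \<le> s n" "s n ^ k \<le> s n * s n"
proof -
  have "s n ^ (k - 1) * s n ^ k = s n ^ (k - 1 + k)" by (simp add: power_add)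
  also have "\<dots> \<le> s n ^ (k + 1)"
    using k2 s_pos[of n] s_le1[of n] by (intro power_decreasing) auto
  finally show "s n ^ (k - 1) * s n ^ k \<le> s n ^ (k + 1)" .
  show "s n ^ (k - 1) \<le> s n"
    using power_decreasing[of 1 "k - 1" "s n"] k2 s_pos[of n] s_le1[of n] by simp
  show "s n ^ k \<le> s n * s n"
    using power_decreasing[of 2 k "s n"] k2 s_pos[of n] s_le1[of n] by (simp add: power2_eq_square)
qed

lemma omega_ge: "norm (Z $ i) * s n ^ (k - 1) \<le> \<omega> n i Z" "V * s n ^ (k + 1) \<le> \<omega> n i Z"
    "s n ^ (k + 1) \<le> \<omega> n i Z" "0 \<le> \<omega> n i Z"
proof -
  have 0: "0 \<le> s n ^ (k + 1)" "0 \<le> s n ^ (k - 1)" using s_pos[of n] by auto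
  have 1: "1 * s n ^ (k + 1) \<le> V * s n ^ (k + 1)"
    using consts_nonneg(7) 0 by (intro mult_right_mono)
  have 2: "0 \<le> norm (Z $ i) * s n ^ (k - 1)" using 0 by simp
  show "norm (Z $ i) * s n ^ (k - 1) \<le> \<omega> n i Z" "V * s n ^ (k + 1) \<le> \<omega> n i Z"
    "s n ^ (k + 1) \<le> \<omega> n i Z" "0 \<le> \<omega> n i Z"
    using 0 1 2 unfolding \<omega>_def by linarith+
qed

lemma omega_le:
  assumes "good n" "norm Z \<le> s n" shows "\<omega> n i Z \<le> 2 * s n ^ k"
proof -
  have "norm (Z $ i) * s n ^ (k - 1) \<le> s n * s n ^ (k - 1)"
    using assms s_pos[of n] Finite_Cartesian_Product.norm_nth_le[of Z i] by (intro mult_right_mono) auto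
  also have "\<dots> = s n ^ k" using k2 by (simp add: power_eq_if)
  finally have 1: "norm (Z $ i) * s n ^ (k - 1) \<le> s n ^ k" .
  have "V * s n * s n ^ k \<le> 1 * s n ^ k"
    using assms s_pos[of n] by (intro mult_right_mono) (auto simp: good_def)
  with 1 show ?thesis by (simp add: \<omega>_def mult_ac)
qed

text \<open>In the first summand \<open>Z $ i\<close> becomes \<open>lam n i * Z $ i\<close>, so the
  eigenvalue appears by itself and the scale adds \<open>D ^ (k - 1)\<close>. The error has order
  \<open>k + 1\<close> and is absorbed by the second summand, which contracts by
  \<open>D ^ (k + 1)\<close>, strictly faster than \<open>C * \<theta>\<close>.\<close>

lemma omega_contract:
  assumes gd: "good n" and Z: "norm Z \<le> s n"
  shows "\<omega> (Suc n) i (f n Z) \<le> norm (lam n i) * \<theta> * \<omega> n i Z"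
proof -
  let ?l = "norm (lam n i)"
  have s0: "0 < s n" by (rule s_pos)
  have "norm Z \<le> 1/16" using Z gd by (simp add: good_def)
  then have "norm (f n Z $ i - lam n i * Z $ i) \<le> K * norm Z ^ k" by (rule f_jet1)
  also have "\<dots> \<le> K * s n ^ k" using Z K1 by (intro mult_left_mono power_mono) auto
  finally have fi: "norm (f n Z $ i) \<le> ?l * norm (Z $ i) + K * s n ^ k"
    using norm_triangle_ineq[of "f n Z $ i - lam n i * Z $ i" "lam n i * Z $ i"] by (simp add: norm_mult)
  have Dk: "D ^ (k - 1) \<le> \<theta>" "D ^ (k - 1) \<le> 1"
  proof -
    have "D ^ (k - 1) \<le> D ^ 1" using k2 Dpos D1 by (intro power_decreasing) auto
    then show "D ^ (k - 1) \<le> \<theta>" using theta by (simp add: \<theta>0_def)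
    show "D ^ (k - 1) \<le> 1" using Dpos D1 by (simp add: power_le_one)
  qed
  have "norm (f n Z $ i) * s (Suc n) ^ (k - 1) \<le> (?l * norm (Z $ i) + K * s n ^ k) * (D ^ (k - 1) * s n ^ (k - 1))"
    unfolding s_Suc power_mult_distrib using fi Dpos s0 by (intro mult_right_mono) auto
  also have "\<dots> = D ^ (k - 1) * (?l * norm (Z $ i) * s n ^ (k - 1)) + D ^ (k - 1) * (K * (s n ^ (k - 1) * s n ^ k))"
    by (simp add: algebra_simps)
  also have "\<dots> \<le> \<theta> * (?l * norm (Z $ i) * s n ^ (k - 1)) + 1 * (K * s n ^ (k + 1))"
    using Dk s0 K1 Dpos theta s_powers(1)[of n] by (intro add_mono mult_mono) auto
  finally have 1: "norm (f n Z $ i) * s (Suc n) ^ (k - 1)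
      \<le> ?l * \<theta> * (norm (Z $ i) * s n ^ (k - 1)) + K * s n ^ (k + 1)" by (simp add: mult_ac)
  have "K / (C * (\<theta> - \<theta>0)) \<le> V" by (simp add: V_def)
  then have "K \<le> V * (C * (\<theta> - \<theta>0))" using C0 theta by (simp add: pos_divide_le_eq)
  moreover have "D ^ (k + 1) \<le> C * \<theta>0"
    using C0 by (simp add: \<theta>0_def pos_divide_le_eq[symmetric] mult.commute[of C])
  then have "V * D ^ (k + 1) \<le> V * (C * \<theta>0)" using consts_nonneg(7) by (intro mult_left_mono) auto
  moreover have "C * (\<theta> * V) \<le> ?l * (\<theta> * V)"
    using lamC[of n i] theta consts_nonneg(7) by (intro mult_right_mono) auto
  ultimately have "K + V * D ^ (k + 1) \<le> ?l * \<theta> * V" by (simp add: algebra_simps)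
  then have "(K + V * D ^ (k + 1)) * s n ^ (k + 1) \<le> ?l * \<theta> * V * s n ^ (k + 1)"
    using s0 by (intro mult_right_mono) auto
  then have 2: "K * s n ^ (k + 1) + V * s (Suc n) ^ (k + 1) \<le> ?l * \<theta> * (V * s n ^ (k + 1))"
    unfolding s_Suc power_mult_distrib by (simp only: ring_distribs mult.assoc)
  show ?thesis using 1 2 unfolding \<omega>_def ring_distribs by linarith
qed

text \<open>The constant must not depend on the number \<open>d\<close> of steps: the contraction of
  \<omega> by \<open>norm (lam n i) * \<theta>\<close> outweighs the division by the eigenvalue, and
  the new error adds \<open>K / C\<close>.\<close>

lemma X_bound:
  assumes "\<And>m. n \<le> m \<Longrightarrow> good m" and "norm Z \<le> s n"
  shows "norm (X d n Z $ i - Z $ i) \<le> M * \<omega> n i Z"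
  using assms
proof (induction d arbitrary: n Z)
  case 0
  then show ?case using consts_nonneg(1) omega_ge(4)[of n i Z] by simp
next
  case (Suc d)
  have gd: "good n" using Suc.prems by simp
  have Z: "norm Z \<le> 1/16" using Suc.prems(2) gd unfolding good_def by linarith
  have fZ: "norm (f n Z) \<le> s (Suc n)"
  proof -
    have "s n < 1" using gd unfolding good_def by linarith
    then show ?thesis using f_ball[of Z 1 n] Suc.prems(2) by simp
  qed
  let ?l = "lam n i"
  have "norm (X d (Suc n) (f n Z) $ i - f n Z $ i) \<le> M * \<omega> (Suc n) i (f n Z)"
    using Suc.prems(1) by (intro Suc.IH fZ) simp
  also have "\<dots> \<le> M * (norm ?l * \<theta> * \<omega> n i Z)"
    by (intro mult_left_mono omega_contract gd Suc.prems consts_nonneg)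
  finally have 1: "norm (X d (Suc n) (f n Z) $ i - f n Z $ i) \<le> norm ?l * (M * \<theta> * \<omega> n i Z)"
    by (simp add: mult_ac)
  have "norm (f n Z $ i - ?l * Z $ i - p n i * (Z $ (i + 1)) ^ k)
      \<le> K * (norm (Z $ i) * norm Z ^ (k - 1) + norm Z ^ (k + 1))" by (rule f_jet[OF Z])
  also have "\<dots> \<le> K * \<omega> n i Z"
  proof (rule mult_left_mono)
    have "norm (Z $ i) * norm Z ^ (k - 1) \<le> norm (Z $ i) * s n ^ (k - 1)"
      using Suc.prems by (intro mult_left_mono power_mono) auto
    moreover have "norm Z ^ (k + 1) \<le> s n ^ (k + 1)" using Suc.prems by (intro power_mono) auto
    moreover have "1 * s n ^ (k + 1) \<le> V * s n ^ (k + 1)"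
      using consts_nonneg(7) s_pos[of n] by (intro mult_right_mono) auto
    ultimately show "norm (Z $ i) * norm Z ^ (k - 1) + norm Z ^ (k + 1) \<le> \<omega> n i Z"
      unfolding \<omega>_def by linarith
  qed (use K1 in simp)
  also have "\<dots> = C * (K / C * \<omega> n i Z)" using C0 by simp
  also have "\<dots> \<le> norm ?l * (K / C * \<omega> n i Z)"
    using lamC[of n i] K1 C0 omega_ge(4)[of n i Z] by (intro mult_right_mono) auto
  finally have 2: "norm (f n Z $ i - ?l * Z $ i - p n i * (Z $ (i + 1)) ^ k) \<le> norm ?l * (K / C * \<omega> n i Z)" .
  have "?l * (X (Suc d) n Z $ i - Z $ i) = (X d (Suc n) (f n Z) $ i - f n Z $ i)
      + (f n Z $ i - ?l * Z $ i - p n i * (Z $ (i + 1)) ^ k)"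
  proof -
    have "?l * X (Suc d) n Z $ i = X d (Suc n) (f n Z) $ i - p n i * (Z $ (i + 1)) ^ k"
      using lam_nz[of n i] by simp
    then show ?thesis by (simp only: right_diff_distrib) simp
  qed
  then have "norm (?l * (X (Suc d) n Z $ i - Z $ i))
      \<le> norm ?l * (M * \<theta> * \<omega> n i Z) + norm ?l * (K / C * \<omega> n i Z)"
    using norm_triangle_le[OF add_mono[OF 1 2]] by (simp only:)
  then have "norm ?l * norm (X (Suc d) n Z $ i - Z $ i)
      \<le> norm ?l * (M * \<theta> * \<omega> n i Z) + norm ?l * (K / C * \<omega> n i Z)"
    by (simp only: norm_mult)
  also have "\<dots> = norm ?l * ((M * \<theta> + K / C) * \<omega> n i Z)" by (simp add: algebra_simps)
  also have "M * \<theta> + K / C = M"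
  proof -
    have "K / C = M * (1 - \<theta>)" using C0 theta by (simp add: M_def)
    then show ?thesis by (simp add: algebra_simps)
  qed
  finally show ?case using lam_nz[of n i] by simp
qed

lemma X_size:
  assumes gd: "\<And>m. n \<le> m \<Longrightarrow> good m" and Z: "norm Z \<le> s n"
  shows "norm (X d n Z $ i - Z $ i) \<le> 2 * M * s n ^ k" "norm (X d n Z $ i) \<le> 2 * s n"
proof -
  have g: "good n" using gd by simp
  have "norm (X d n Z $ i - Z $ i) \<le> M * \<omega> n i Z" by (rule X_bound[OF gd Z])
  also have "\<dots> \<le> M * (2 * s n ^ k)"
    by (intro mult_left_mono omega_le g Z consts_nonneg)
  finally show 1: "norm (X d n Z $ i - Z $ i) \<le> 2 * M * s n ^ k" by (simp add: mult_ac)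
  have "2 * M * s n ^ k \<le> 2 * M * (s n * s n)"
    using s_powers(3)[of n] consts_nonneg by (intro mult_left_mono) auto
  also have "\<dots> = (2 * M * s n) * s n" by simp
  also have "\<dots> \<le> 1 * s n" using g s_pos[of n] by (intro mult_right_mono) (auto simp: good_def)
  finally have "norm (X d n Z $ i - Z $ i) \<le> s n" using 1 by simp
  moreover have "norm (Z $ i) \<le> s n" using Z Finite_Cartesian_Product.norm_nth_le[of Z i] by simp
  ultimately show "norm (X d n Z $ i) \<le> 2 * s n"
    using norm_triangle_ineq[of "X d n Z $ i - Z $ i" "Z $ i"] by simp
qed

text \<open>The shear applied to \<open>X\<close> satisfies the nonlinear recursion of \<Psi> up to
  errors controlled by \<omega>, because \<open>q\<close> was chosen so that the pure powers cancel.
  The deviation therefore obeys a contracting recursion, apart from a one-way coupling between the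
  components.\<close>

lemma Psi_bound:
  assumes "\<And>m. n \<le> m \<Longrightarrow> good m" and "norm Z \<le> s n"
  shows "norm (\<Psi> d n Z $ i - X d n Z $ i - c n i * (X d n Z $ (i + 1)) ^ k) \<le> M' * \<omega> n i Z"
  using assms
proof (induction d arbitrary: n Z i)
  case 0
  then show ?case using consts_nonneg omega_ge(4)[of n i Z] by simp
next
  case (Suc d)
  have gd: "good n" using Suc.prems by simp
  have n1: "n1 \<le> n" using gd by (simp add: good_def)
  have s0: "0 < s n" by (rule s_pos)
  have fZ: "norm (f n Z) \<le> s (Suc n)"
  proof -
    have "s n < 1" using gd unfolding good_def by linarith
    then show ?thesis using f_ball[of Z 1 n] Suc.prems(2) by simp
  qed
  define x where "x = X (Suc d) n Z"
  define X' where "X' = X d (Suc n) (f n Z)"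
  define \<psi> where "\<psi> = \<Psi> (Suc d) n Z"
  define P' where "P' = \<Psi> d (Suc n) (f n Z)"
  define u where "u j = \<psi> $ j - x $ j - c n j * (x $ (j + 1)) ^ k" for j
  \<comment> \<open>The errors, in order: the power term evaluated at \<open>Z\<close> instead of
    \<open>x\<close>, the expansion of the next shear, and the deviation one step later.\<close>
  define R where "R j = p n j * ((Z $ (j + 1)) ^ k - (x $ (j + 1)) ^ k)
    + c (Suc n) j * ((lam n (j + 1) * x $ (j + 1) + p n (j + 1) * (Z $ j) ^ k) ^ k - (lam n (j + 1) * x $ (j + 1)) ^ k)
    + (P' $ j - X' $ j - c (Suc n) j * (X' $ (j + 1)) ^ k)" for j
  have X'_eq: "X' $ j = lam n j * x $ j + p n j * (Z $ (j + 1)) ^ k" for j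
    using lam_nz[of n j] by (simp add: x_def X'_def)
  have P'_eq: "P' $ j = lam n j * \<psi> $ j + q n j * (\<psi> $ (j + 1)) ^ k" for j
  proof -
    have "P' = g n \<psi>" using g_ginv[OF n1] by (simp add: \<psi>_def P'_def)
    then show ?thesis by (simp add: g_def)
  qed
  \<comment> \<open>By \<open>q_eq\<close> the coefficient of \<open>(x $ (j + 1)) ^ k\<close>
    collected from the shears and from \<open>p\<close> is \<open>q n j + lam n j * c n j\<close>;
    this leaves only the difference of powers.\<close>
  have u_eq: "lam n j * u j = R j - q n j * ((\<psi> $ (j + 1)) ^ k - (x $ (j + 1)) ^ k)" for j
  proof -
    have "X' $ (j + 1) = lam n (j + 1) * x $ (j + 1) + p n (j + 1) * (Z $ j) ^ k"
      using X'_eq[of "j + 1"] by simp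
    then show ?thesis
      unfolding u_def R_def by (simp add: X'_eq[of j] P'_eq[of j] q_eq algebra_simps)
  qed
  have xs: "norm (x $ j - Z $ j) \<le> 2 * M * s n ^ k" "norm (x $ j) \<le> 2 * s n"
    "norm (x $ j - Z $ j) \<le> M * \<omega> n j Z" for j
    unfolding x_def using Suc.prems by (intro X_size X_bound; simp)+
  have Zj: "norm (Z $ j) \<le> s n" for j
    using Suc.prems(2) Finite_Cartesian_Product.norm_nth_le[of Z j] by simp
  have R_le: "norm (R j) \<le> (A1 + A2) * \<omega> n j Z + norm (lam n j) * (\<theta> * (M' * \<omega> n j Z))" for j
  proof -
    have "norm ((Z $ (j + 1)) ^ k - (x $ (j + 1)) ^ k)
        \<le> k * (2 * s n) ^ (k - 1) * norm (Z $ (j + 1) - x $ (j + 1))"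
      by (rule norm_power_diff_le) (use Zj[of "j + 1"] xs(2) s0 in auto)
    also have "\<dots> \<le> k * (2 * s n) ^ (k - 1) * (2 * M * s n ^ k)"
      using xs(1)[of "j + 1"] s0 by (intro mult_left_mono) (auto simp: norm_minus_commute)
    also have "\<dots> = k * 2 ^ k * M * (s n ^ (k - 1) * s n ^ k)"
      using k2 by (simp add: power_mult_distrib power_eq_if[of 2 k])
    also have "\<dots> \<le> k * 2 ^ k * M * \<omega> n j Z"
      using order_trans[OF s_powers(1) omega_ge(3)] consts_nonneg(1) by (intro mult_left_mono) auto
    finally have "norm (p n j * ((Z $ (j + 1)) ^ k - (x $ (j + 1)) ^ k)) \<le> K * (k * 2 ^ k * M * \<omega> n j Z)"
      unfolding norm_mult using pK[of n j] K1 by (intro mult_mono) auto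
    then have 1: "norm (p n j * ((Z $ (j + 1)) ^ k - (x $ (j + 1)) ^ k)) \<le> A1 * \<omega> n j Z"
      by (simp add: A1_def mult_ac)
    have lx: "norm (lam n (j + 1) * x $ (j + 1)) \<le> 2 * s n"
    proof -
      have "norm (lam n (j + 1)) * norm (x $ (j + 1)) \<le> 1 * (2 * s n)"
        using lamD[of n "j + 1"] D0 D1 xs(2)[of "j + 1"] by (intro mult_mono) auto
      then show ?thesis by (simp add: norm_mult)
    qed
    have pz: "norm (p n (j + 1) * (Z $ j) ^ k) \<le> K * (norm (Z $ j) * s n ^ (k - 1))"
    proof -
      have "norm (Z $ j) ^ k = norm (Z $ j) * norm (Z $ j) ^ (k - 1)" using k2 by (simp add: power_eq_if)
      also have "\<dots> \<le> norm (Z $ j) * s n ^ (k - 1)"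
        using Zj[of j] by (intro mult_left_mono power_mono) auto
      finally show ?thesis
        unfolding norm_mult norm_power using pK[of n "j + 1"] K1 by (intro mult_mono) auto
    qed
    have "K * (norm (Z $ j) * s n ^ (k - 1)) \<le> K * (s n * s n)"
      using Zj[of j] s_powers(2)[of n] s0 K1 by (intro mult_left_mono mult_mono) auto
    also have "\<dots> = (K * s n) * s n" by simp
    also have "\<dots> \<le> 1 * s n" using gd s0 by (intro mult_right_mono) (auto simp: good_def)
    finally have pz': "norm (p n (j + 1) * (Z $ j) ^ k) \<le> s n" using pz by simp
    have "norm ((lam n (j + 1) * x $ (j + 1) + p n (j + 1) * (Z $ j) ^ k) ^ k - (lam n (j + 1) * x $ (j + 1)) ^ k)
        \<le> k * (3 * s n) ^ (k - 1) * norm ((lam n (j + 1) * x $ (j + 1) + p n (j + 1) * (Z $ j) ^ k) - lam n (j + 1) * x $ (j + 1))"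
      using lx pz' s0 norm_triangle_ineq[of "lam n (j + 1) * x $ (j + 1)" "p n (j + 1) * (Z $ j) ^ k"]
      by (intro norm_power_diff_le) auto
    also have "\<dots> \<le> k * (3 * s n) ^ (k - 1) * (K * (norm (Z $ j) * s n ^ (k - 1)))"
      using pz s0 by (intro mult_left_mono) auto
    also have "\<dots> \<le> k * (3 * s n) ^ (k - 1) * (K * \<omega> n j Z)"
      using omega_ge(1)[of Z j n] s0 K1 by (intro mult_left_mono) auto
    finally have "norm (c (Suc n) j) * norm ((lam n (j + 1) * x $ (j + 1) + p n (j + 1) * (Z $ j) ^ k) ^ k - (lam n (j + 1) * x $ (j + 1)) ^ k)
        \<le> norm (c (Suc n) j) * (k * (3 * s n) ^ (k - 1) * (K * \<omega> n j Z))" by (intro mult_left_mono) auto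
    also have "\<dots> = (norm (c (Suc n) j) * s (Suc n) ^ (k - 1)) * (k * 3 ^ (k - 1) * K * \<omega> n j Z / D ^ (k - 1))"
      using Dpos by (simp add: s_Suc power_mult_distrib)
    also have "\<dots> \<le> K' * (k * 3 ^ (k - 1) * K * \<omega> n j Z / D ^ (k - 1))"
    proof (rule mult_right_mono)
      have "norm (c (Suc n) j) * s (Suc n) ^ (k - 1) \<le> K' * \<kappa> ^ Suc n"
        unfolding s_def using c_le[of "Suc n" j] n1 by simp
      also have "\<dots> \<le> K' * 1" using kappa K'1 by (intro mult_left_mono power_le_one) auto
      finally show "norm (c (Suc n) j) * s (Suc n) ^ (k - 1) \<le> K'" by simp
    qed (use K1 omega_ge(4)[of n j Z] Dpos in auto)
    finally have 2: "norm (c (Suc n) j * ((lam n (j + 1) * x $ (j + 1) + p n (j + 1) * (Z $ j) ^ k) ^ k - (lam n (j + 1) * x $ (j + 1)) ^ k))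
        \<le> A2 * \<omega> n j Z" by (simp add: norm_mult A2_def mult_ac)
    have "norm (P' $ j - X' $ j - c (Suc n) j * (X' $ (j + 1)) ^ k) \<le> M' * \<omega> (Suc n) j (f n Z)"
      unfolding P'_def X'_def using Suc.prems(1) by (intro Suc.IH fZ) simp
    also have "\<dots> \<le> M' * (norm (lam n j) * \<theta> * \<omega> n j Z)"
      by (intro mult_left_mono omega_contract gd Suc.prems consts_nonneg)
    finally have 3: "norm (P' $ j - X' $ j - c (Suc n) j * (X' $ (j + 1)) ^ k)
        \<le> norm (lam n j) * (\<theta> * (M' * \<omega> n j Z))" by (simp add: mult_ac)
    show ?thesis
      unfolding R_def distrib_right[of A1 A2]
      by (rule norm_triangle_le[OF add_mono[OF norm_triangle_le[OF add_mono[OF 1 2]] 3]])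
  qed
  have M'eq: "(A1 + A2 + A3) / C + (1 - \<theta>) / 2 * M' + \<theta> * M' = M'"
  proof -
    have "(A1 + A2 + A3) / C = (1 - \<theta>) / 2 * M'"
      using C0 theta by (simp add: M'_def divide_simps)
    then have "(A1 + A2 + A3) / C + (1 - \<theta>) / 2 * M' + \<theta> * M' = (1 - \<theta>) / 2 * M' + (1 - \<theta>) / 2 * M' + \<theta> * M'"
      by (simp only:)
    also have "\<dots> = M'" by (simp add: field_simps)
    finally show ?thesis .
  qed
  have close: "norm (u j) \<le> M' * \<omega> n j Z"
    if "norm (lam n j * u j) \<le> (A1 + A2 + A3) * \<omega> n j Z + C * ((1 - \<theta>) / 2) * M' * \<omega> n j Z
      + norm (lam n j) * (\<theta> * (M' * \<omega> n j Z))" for j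
  proof -
    have "(A1 + A2 + A3) * \<omega> n j Z + C * ((1 - \<theta>) / 2) * M' * \<omega> n j Z
        = C * (((A1 + A2 + A3) / C + (1 - \<theta>) / 2 * M') * \<omega> n j Z)"
      using C0 by (simp add: algebra_simps add_divide_distrib)
    also have "\<dots> \<le> norm (lam n j) * (((A1 + A2 + A3) / C + (1 - \<theta>) / 2 * M') * \<omega> n j Z)"
      using lamC[of n j] consts_nonneg C0 theta omega_ge(4)[of n j Z] by (intro mult_right_mono) auto
    finally have "norm (lam n j) * norm (u j) \<le> norm (lam n j) *
        (((A1 + A2 + A3) / C + (1 - \<theta>) / 2 * M' + \<theta> * M') * \<omega> n j Z)"
      using that by (simp add: norm_mult algebra_simps)
    then show ?thesis unfolding M'eq using lam_nz[of n j] by simp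
  qed
  have nn: "0 \<le> A3 * \<omega> n j Z" "0 \<le> C * ((1 - \<theta>) / 2) * M' * \<omega> n j Z" for j
    using consts_nonneg C0 theta omega_ge(4)[of n j Z] by auto
  txt \<open>At most one of the two components is coupled to the other, so the free one is estimated first.\<close>
  have easy: "norm (u j) \<le> M' * \<omega> n j Z" if "q n j = 0" for j
  proof (rule close)
    have "lam n j * u j = R j" using u_eq[of j] that by simp
    then show "norm (lam n j * u j) \<le> (A1 + A2 + A3) * \<omega> n j Z + C * ((1 - \<theta>) / 2) * M' * \<omega> n j Z
      + norm (lam n j) * (\<theta> * (M' * \<omega> n j Z))"
      using R_le[of j] nn[of j] by (simp only: ring_distribs)
  qed
  have "norm (u i) \<le> M' * \<omega> n i Z"
  proof (cases "q n i = 0")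
    case True
    then show ?thesis by (rule easy)
  next
    case False
    then have q0: "q n (i + 1) = 0" using q_cases[OF n1, of i] by simp
    \<comment> \<open>The shear in component \<open>i + 1\<close> may have an unbounded coefficient,
      but its weight \<open>s n ^ (k - 1)\<close> uses up all factors of \<open>x $ i\<close> except
      one. The remaining factor is at most \<open>y\<close>, and \<open>s n ^ (k - 1) * y\<close> is
      comparable to \<open>\<omega> n i Z\<close>.\<close>
    define y where "y = norm (Z $ i) + M * \<omega> n i Z"
    have y0: "0 \<le> y" using consts_nonneg(1) omega_ge(4)[of n i Z] by (simp add: y_def)
    have xi: "norm (x $ i) \<le> y"
      using xs(3)[of i] norm_triangle_ineq[of "x $ i - Z $ i" "Z $ i"] by (simp add: y_def)
    have cn: "norm (c n i') * s n ^ (k - 1) \<le> K' * \<kappa> ^ n" for i'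
      unfolding s_def by (rule c_le[OF n1])
    have cx: "norm (c n (i + 1) * (x $ i) ^ k) \<le> 2 ^ k * (K' * \<kappa> ^ n) * norm (x $ i)"
    proof -
      have "norm (x $ i) ^ k = norm (x $ i) ^ (k - 1) * norm (x $ i)"
        using k2 by (simp add: power_eq_if)
      also have "\<dots> \<le> (2 * s n) ^ (k - 1) * norm (x $ i)"
        using xs(2)[of i] by (intro mult_right_mono power_mono) auto
      finally have "norm (c n (i + 1)) * norm (x $ i) ^ k \<le> norm (c n (i + 1)) * ((2 * s n) ^ (k - 1) * norm (x $ i))"
        by (intro mult_left_mono) auto
      also have "\<dots> = 2 ^ (k - 1) * (norm (c n (i + 1)) * s n ^ (k - 1)) * norm (x $ i)"
        by (simp add: power_mult_distrib)
      also have "\<dots> \<le> 2 ^ k * (K' * \<kappa> ^ n) * norm (x $ i)"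
        by (rule mult_right_mono[OF mult_mono[OF _ cn[of "i + 1"]]])
          (use s0 in \<open>auto intro!: power_increasing mult_nonneg_nonneg\<close>)
      finally show ?thesis by (simp add: norm_mult norm_power)
    qed
    have small: "2 ^ k * (K' * \<kappa> ^ n) \<le> 1" using gd by (simp add: good_def mult_ac)
    have dx: "\<psi> $ (i + 1) - x $ (i + 1) = u (i + 1) + c n (i + 1) * (x $ i) ^ k"
      by (simp add: u_def)
    have u1: "norm (u (i + 1)) \<le> M' * \<omega> n (i + 1) Z" by (rule easy[OF q0])
    have om1: "\<omega> n (i + 1) Z \<le> 2 * s n ^ k" by (rule omega_le[OF gd Suc.prems(2)])
    have "norm (\<psi> $ (i + 1)) \<le> 5 * s n \<and> norm (\<psi> $ (i + 1) - x $ (i + 1)) \<le> 2 ^ k * K' * y + M' * \<omega> n (i + 1) Z"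
    proof
      have "2 ^ k * (K' * \<kappa> ^ n) * norm (x $ i) \<le> 1 * (2 * s n)"
        using small xs(2)[of i] kappa K'1 by (intro mult_mono) auto
      then have 1: "norm (c n (i + 1) * (x $ i) ^ k) \<le> 2 * s n" using cx by simp
      have "M' * \<omega> n (i + 1) Z \<le> M' * (2 * (s n * s n))"
        using om1 s_powers(3)[of n] consts_nonneg by (intro mult_left_mono) auto
      also have "\<dots> = (2 * M' * s n) * s n" by simp
      also have "\<dots> \<le> 1 * s n" using gd s0 by (intro mult_right_mono) (auto simp: good_def)
      finally have 2: "norm (u (i + 1)) \<le> s n" using u1 by simp
      have "\<psi> $ (i + 1) = x $ (i + 1) + (\<psi> $ (i + 1) - x $ (i + 1))" by simp
      then have "\<psi> $ (i + 1) = x $ (i + 1) + u (i + 1) + c n (i + 1) * (x $ i) ^ k"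
        by (simp only: dx add.assoc)
      then show "norm (\<psi> $ (i + 1)) \<le> 5 * s n"
        using 1 2 xs(2)[of "i + 1"] norm_triangle_ineq[of "x $ (i + 1)" "u (i + 1)"]
          norm_triangle_ineq[of "x $ (i + 1) + u (i + 1)" "c n (i + 1) * (x $ i) ^ k"] by simp
      have "K' * \<kappa> ^ n \<le> K' * 1" using kappa K'1 by (intro mult_left_mono power_le_one) auto
      then have "2 ^ k * (K' * \<kappa> ^ n) \<le> 2 ^ k * K'" by simp
      then have "2 ^ k * (K' * \<kappa> ^ n) * norm (x $ i) \<le> 2 ^ k * K' * y"
        using xi K'1 kappa by (intro mult_mono) auto
      then show "norm (\<psi> $ (i + 1) - x $ (i + 1)) \<le> 2 ^ k * K' * y + M' * \<omega> n (i + 1) Z"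
        unfolding dx using cx u1 norm_triangle_ineq[of "u (i + 1)" "c n (i + 1) * (x $ i) ^ k"] by linarith
    qed
    then have psi: "norm (\<psi> $ (i + 1)) \<le> 5 * s n"
      and psi_x: "norm (\<psi> $ (i + 1) - x $ (i + 1)) \<le> 2 ^ k * K' * y + M' * \<omega> n (i + 1) Z" by auto
    have "norm ((\<psi> $ (i + 1)) ^ k - (x $ (i + 1)) ^ k)
        \<le> k * (5 * s n) ^ (k - 1) * norm (\<psi> $ (i + 1) - x $ (i + 1))"
      using psi xs(2)[of "i + 1"] s0 by (intro norm_power_diff_le) auto
    also have "\<dots> \<le> k * (5 * s n) ^ (k - 1) * (2 ^ k * K' * y + M' * \<omega> n (i + 1) Z)"
      using psi_x s0 by (intro mult_left_mono) auto
    finally have "norm (q n i) * norm ((\<psi> $ (i + 1)) ^ k - (x $ (i + 1)) ^ k)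
        \<le> K' * (k * (5 * s n) ^ (k - 1) * (2 ^ k * K' * y + M' * \<omega> n (i + 1) Z))"
      using q_le[OF n1, of i] K'1 by (intro mult_mono) auto
    also have "\<dots> = K' * K' * k * (5 ^ (k - 1) * 2 ^ k) * (s n ^ (k - 1) * y)
        + K' * k * 5 ^ (k - 1) * M' * (s n ^ (k - 1) * \<omega> n (i + 1) Z)"
      by (simp add: power_mult_distrib algebra_simps)
    also have "\<dots> \<le> K' * K' * k * (5 ^ k * 2 ^ k) * (2 * \<omega> n i Z) + K' * k * 5 ^ k * M' * (2 * (\<omega> n i Z / V))"
    proof -
      have "s n ^ (k - 1) * (M * \<omega> n i Z) \<le> s n * (M * \<omega> n i Z)"
        using s_powers(2)[of n] consts_nonneg(1) omega_ge(4)[of n i Z] by (intro mult_right_mono) auto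
      also have "\<dots> = (M * s n) * \<omega> n i Z" by simp
      also have "\<dots> \<le> 1 * \<omega> n i Z"
      proof (rule mult_right_mono)
        have "0 \<le> M * s n" using consts_nonneg(1) s0 by simp
        then show "M * s n \<le> 1" using gd unfolding good_def by linarith
      qed (rule omega_ge(4))
      finally have T1: "s n ^ (k - 1) * y \<le> 2 * \<omega> n i Z"
        using omega_ge(1)[of Z i n] by (simp add: y_def algebra_simps)
      have V0: "0 < V" using consts_nonneg(7) by simp
      have "s n ^ (k - 1) * \<omega> n (i + 1) Z \<le> s n ^ (k - 1) * (2 * s n ^ k)"
        using om1 s0 by (intro mult_left_mono) auto
      also have "\<dots> \<le> 2 * s n ^ (k + 1)" using s_powers(1)[of n] by simp
      \<comment> \<open>The gain 1/V is kept on purpose: this term carries the unknown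
        \<open>M'\<close> and has to be absorbed.\<close>
      also have "s n ^ (k + 1) \<le> \<omega> n i Z / V"
        using omega_ge(2)[of n i Z] V0 by (simp add: pos_le_divide_eq mult.commute)
      finally have T2: "s n ^ (k - 1) * \<omega> n (i + 1) Z \<le> 2 * (\<omega> n i Z / V)" by simp
      have p5: "(5::real) ^ (k - 1) \<le> 5 ^ k" by (intro power_increasing) auto
      show ?thesis
      proof (rule add_mono[OF mult_mono[OF _ T1] mult_mono[OF _ T2]])
        show "K' * K' * k * (5 ^ (k - 1) * 2 ^ k) \<le> K' * K' * k * (5 ^ k * 2 ^ k)"
          using p5 K'1 by (intro mult_left_mono mult_right_mono) auto
        show "K' * k * 5 ^ (k - 1) * M' \<le> K' * k * 5 ^ k * M'"
          using p5 K'1 consts_nonneg by (intro mult_left_mono mult_right_mono) auto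
      qed (use K'1 consts_nonneg s0 y0 omega_ge(4) in auto)
    qed
    also have "\<dots> = A3 * \<omega> n i Z + A4 / V * M' * \<omega> n i Z"
      by (simp add: A3_def A4_def mult_ac flip: power_mult_distrib)
    also have "A4 / V * M' * \<omega> n i Z \<le> C * ((1 - \<theta>) / 2) * M' * \<omega> n i Z"
    proof (intro mult_right_mono consts_nonneg omega_ge(4))
      have V0: "0 < V" using consts_nonneg(7) by simp
      have "2 * A4 / (C * (1 - \<theta>)) \<le> V" by (simp add: V_def)
      then have "2 * A4 \<le> V * (C * (1 - \<theta>))" using C0 theta by (simp add: pos_divide_le_eq)
      then show "A4 / V \<le> C * ((1 - \<theta>) / 2)" using V0 by (simp add: pos_divide_le_eq mult_ac)
    qed
    finally have qterm: "norm (q n i * ((\<psi> $ (i + 1)) ^ k - (x $ (i + 1)) ^ k))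
        \<le> A3 * \<omega> n i Z + C * ((1 - \<theta>) / 2) * M' * \<omega> n i Z" by (simp add: norm_mult)
    show ?thesis
    proof (rule close)
      show "norm (lam n i * u i) \<le> (A1 + A2 + A3) * \<omega> n i Z + C * ((1 - \<theta>) / 2) * M' * \<omega> n i Z
        + norm (lam n i) * (\<theta> * (M' * \<omega> n i Z))"
        unfolding u_eq
        using norm_triangle_ineq4[of "R i" "q n i * ((\<psi> $ (i + 1)) ^ k - (x $ (i + 1)) ^ k)"] qterm R_le[of i]
        unfolding ring_distribs by linarith
    qed
  qed
  then show ?case by (simp add: u_def x_def \<psi>_def)
qed

end

section \<open>Compactness\<close>

text \<open>The Cauchy estimate on the complex line through \<open>Z\<close> in the direction of
  \<open>v\<close>. The 8 is a product of three factors 2: from Cauchy on an open disc, from the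
  radius \<open>R / 2\<close> left around \<open>Z\<close>, and from adding two components.\<close>

lemma derivative_bound_of_bound:
  fixes h :: "complex ^ 2 \<Rightarrow> complex ^ 2"
  assumes h: "holomorphic_map_on h (ball 0 R)" and R: "0 < R"
    and B: "\<And>Z. Z \<in> ball 0 R \<Longrightarrow> norm (h Z) \<le> B"
    and Z: "Z \<in> ball 0 (R / 2)" and L: "complex_linear L" "(h has_derivative L) (at Z)"
  shows "norm (L v) \<le> 8 * B / R * norm v"
proof (cases "v = 0")
  case True
  then have "L v = 0" using complex_linear_scale[OF L(1), of 0 v] by simp
  then show ?thesis using True by simp
next
  case False
  define e where "e = of_real (inverse (norm v)) *s v"
  have e: "norm e = 1"
    using False unfolding e_def by (simp only: norm_smult_vec norm_of_real) simp
  have v: "v = of_real (norm v) *s e"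
  proof -
    have "of_real (norm v) * of_real (inverse (norm v)) = (1::complex)"
      using False by (simp flip: of_real_mult)
    then show ?thesis by (simp add: e_def)
  qed
  have inb: "Z + t *s e \<in> ball 0 R" if "t \<in> ball 0 (R / 2)" for t
  proof -
    have "norm (Z + t *s e) \<le> norm Z + norm t"
      using norm_triangle_ineq[of Z "t *s e"] e by (simp add: norm_smult_vec)
    then show ?thesis using that Z by simp
  qed
  have comp: "norm (L e $ i) \<le> 4 * B / R" for i
  proof -
    have "((\<lambda>z. h z $ i) has_derivative (\<lambda>v. L v $ i)) (at (Z + 0 *s e))"
      by (simp add: bounded_linear.has_derivative[OF bounded_linear_vec_nth] L)
    then have "((\<lambda>t. h (Z + t *s e) $ i) has_field_derivative (L e $ i)) (at 0)"
      by (rule slice_has_field_derivative[rotated]) (simp add: complex_linear_scale[OF L(1)])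
    then have d: "deriv (\<lambda>t. h (Z + t *s e) $ i) 0 = L e $ i" by (rule DERIV_imp_deriv)
    have "norm (deriv (\<lambda>t. h (Z + t *s e) $ i) 0) \<le> 2 * B / (R / 2)"
    proof (rule deriv_bound_ball)
      show "(\<lambda>t. h (Z + t *s e) $ i) holomorphic_on ball 0 (R / 2)"
        by (rule holomorphic_slice[OF holomorphic_map_on_nth[OF h] open_ball inb])
      show "norm (h (Z + t *s e) $ i) \<le> B" if "t \<in> ball 0 (R / 2)" for t
        by (rule order_trans[OF Finite_Cartesian_Product.norm_nth_le B[OF inb[OF that]]])
    qed (use R in simp)
    then show ?thesis by (simp add: d)
  qed
  have "norm (L e) \<le> 8 * B / R"
    using norm_vec2_le[of "L e" 1] comp[of 1] comp[of "1 + 1"] by simp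
  moreover have "L v = of_real (norm v) *s L e"
    by (subst v) (rule complex_linear_scale[OF L(1)])
  ultimately have "norm (L v) = norm v * norm (L e)" by (simp add: norm_smult_vec)
  also have "\<dots> \<le> norm v * (8 * B / R)"
    using \<open>norm (L e) \<le> 8 * B / R\<close> by (intro mult_left_mono) auto
  finally show ?thesis by (simp only: mult.commute)
qed

lemma lipschitz_of_bound_map:
  fixes h :: "complex ^ 2 \<Rightarrow> complex ^ 2"
  assumes h: "holomorphic_map_on h (ball 0 R)" and R: "0 < R"
    and B: "\<And>Z. Z \<in> ball 0 R \<Longrightarrow> norm (h Z) \<le> B"
    and x: "x \<in> ball 0 (R / 2)" and y: "y \<in> ball 0 (R / 2)"
  shows "norm (h x - h y) \<le> 8 * B / R * norm (x - y)"
proof -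
  have "\<forall>Z\<in>ball 0 (R / 2). \<exists>L. complex_linear L \<and> (h has_derivative L) (at Z)"
    using h R by (auto simp: holomorphic_map_on_def)
  from bchoice[OF this] obtain L
    where "\<forall>Z\<in>ball 0 (R / 2). complex_linear (L Z) \<and> (h has_derivative L Z) (at Z)" by (elim exE)
  then have L: "complex_linear (L Z)" "(h has_derivative L Z) (at Z)" if "Z \<in> ball 0 (R / 2)" for Z :: "complex ^ 2"
    using that by blast+
  show ?thesis
  proof (rule differentiable_bound[OF convex_ball[of 0 "R / 2"] _ _ x y])
    fix Z :: "complex ^ 2" assume Z: "Z \<in> ball 0 (R / 2)"
    show "(h has_derivative L Z) (at Z within ball 0 (R / 2))"
      using L(2)[OF Z] by (rule has_derivative_at_withinI)
    show "onorm (L Z) \<le> 8 * B / R"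
      by (rule onorm_le) (rule derivative_bound_of_bound[OF h R B Z L(1)[OF Z] L(2)[OF Z]])
  qed
qed

text \<open>By the Cauchy estimate the derivatives form a uniformly Cauchy sequence on the half
  ball; their pointwise limit is complex linear and is the derivative of the limit map.\<close>

lemma holomorphic_map_uniform_limit:
  fixes hs :: "nat \<Rightarrow> complex ^ 2 \<Rightarrow> complex ^ 2"
  assumes hs: "\<And>n. holomorphic_map_on (hs n) (ball 0 R)" and R: "0 < R"
    and lim: "\<And>e. 0 < e \<Longrightarrow> \<exists>N. \<forall>n\<ge>N. \<forall>x\<in>ball 0 R. norm (hs n x - h x) < e"
  shows "holomorphic_map_on h (ball 0 (R / 2))"
proof -
  let ?S = "ball 0 (R / 2) :: (complex ^ 2) set"
  have sub: "?S \<subseteq> ball 0 R" using R by auto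
  have "\<forall>n. \<exists>L. \<forall>x\<in>?S. complex_linear (L x) \<and> (hs n has_derivative L x) (at x)"
    using hs sub by (intro allI bchoice) (auto simp: holomorphic_map_on_def)
  from choice[OF this] obtain L
    where "\<forall>n. \<forall>x\<in>?S. complex_linear (L n x) \<and> (hs n has_derivative L n x) (at x)" by (elim exE)
  then have L: "complex_linear (L n x)" "(hs n has_derivative L n x) (at x)" if "x \<in> ?S" for n x
    using that by blast+
  have diff: "\<exists>N. \<forall>n\<ge>N. \<forall>m\<ge>N. \<forall>x\<in>?S. \<forall>v. norm (L n x v - L m x v) \<le> e * norm v" if e: "0 < e" for e
  proof -
    define e' where "e' = e * R / 16"
    have "0 < e'" using e R by (simp add: e'_def)
    from lim[OF this] obtain N where N: "\<And>n x. n \<ge> N \<Longrightarrow> x \<in> ball 0 R \<Longrightarrow> norm (hs n x - h x) < e'" by blast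
    show ?thesis
    proof (intro exI allI impI ballI)
      fix n m x v assume nm: "N \<le> n" "N \<le> m" and x: "x \<in> ?S"
      have "norm (L n x v - L m x v) \<le> 8 * (2 * e') / R * norm v"
      proof (rule derivative_bound_of_bound[OF _ R _ x, where h = "\<lambda>x. hs n x - hs m x"])
        show "holomorphic_map_on (\<lambda>x. hs n x - hs m x) (ball 0 R)"
          unfolding holomorphic_map_on_iff
          by (auto intro!: holomorphic_fun_on_diff holomorphic_map_on_nth hs)
        show "norm (hs n Z - hs m Z) \<le> 2 * e'" if "Z \<in> ball 0 R" for Z
          using N[OF nm(1) that] N[OF nm(2) that] norm_triangle_ineq4[of "hs n Z - h Z" "hs m Z - h Z"] by simp
        show "complex_linear (\<lambda>v. L n x v - L m x v)"
          by (intro complex_linearI)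
            (simp_all add: complex_linear_add[OF L(1)[OF x]] complex_linear_scale[OF L(1)[OF x]] vec_eq_iff algebra_simps)
        show "((\<lambda>x. hs n x - hs m x) has_derivative (\<lambda>v. L n x v - L m x v)) (at x)"
          by (intro has_derivative_diff L x)
      qed
      then show "norm (L n x v - L m x v) \<le> e * norm v" using R by (simp add: e'_def)
    qed
  qed
  have "\<exists>l. (\<lambda>n. L n x v) \<longlonglongrightarrow> l" if x: "x \<in> ?S" for x v
  proof -
    have "Cauchy (\<lambda>n. L n x v)"
      unfolding Cauchy_iff
    proof (intro allI impI)
      fix e :: real assume e: "0 < e"
      define e' where "e' = e / (norm v + 1)"
      have e': "0 < e'" using e by (simp add: e'_def add_nonneg_pos)
      from diff[OF this] obtain N where N: "\<forall>n\<ge>N. \<forall>m\<ge>N. \<forall>x\<in>?S. \<forall>v. norm (L n x v - L m x v) \<le> e' * norm v" by blast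
      have "e' * norm v < e' * (norm v + 1)" using e' by (intro mult_strict_left_mono) auto
      also have "\<dots> = e" unfolding e'_def using norm_ge_zero[of v] by (simp add: add_nonneg_eq_0_iff)
      finally show "\<exists>M. \<forall>m\<ge>M. \<forall>n\<ge>M. norm (L m x v - L n x v) < e"
        using N x by (meson order_le_less_trans)
    qed
    then show ?thesis by (simp add: Cauchy_convergent_iff convergent_def)
  qed
  then obtain g' where g': "\<And>x v. x \<in> ?S \<Longrightarrow> (\<lambda>n. L n x v) \<longlonglongrightarrow> g' x v" by metis
  have "\<exists>g. \<forall>x\<in>?S. (\<lambda>n. hs n x) \<longlonglongrightarrow> g x \<and> (g has_derivative g' x) (at x within ?S)"
  proof (rule has_derivative_sequence)
    show "(hs n has_derivative L n x) (at x within ?S)" if "x \<in> ?S" for n x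
      using L(2)[OF that] by (rule has_derivative_at_withinI)
    show "\<forall>\<^sub>F n in sequentially. \<forall>x\<in>?S. \<forall>v. norm (L n x v - g' x v) \<le> e * norm v" if "0 < e" for e
    proof -
      from diff[OF that] obtain N where N: "\<forall>n\<ge>N. \<forall>m\<ge>N. \<forall>x\<in>?S. \<forall>v. norm (L n x v - L m x v) \<le> e * norm v" by blast
      have "norm (L n x v - g' x v) \<le> e * norm v" if n: "n \<ge> N" and x: "x \<in> ?S" for n x v
      proof (rule tendsto_upperbound)
        show "(\<lambda>m. norm (L n x v - L m x v)) \<longlonglongrightarrow> norm (L n x v - g' x v)"
          by (intro tendsto_intros g' x)
        show "\<forall>\<^sub>F m in sequentially. norm (L n x v - L m x v) \<le> e * norm v"
          using eventually_ge_at_top[of N] by (rule eventually_mono) (use N n x in blast)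
      qed simp
      then show ?thesis unfolding eventually_sequentially by blast
    qed
    have lim0: "(\<lambda>n. hs n x) \<longlonglongrightarrow> h x" if "x \<in> ball 0 R" for x
      unfolding LIMSEQ_iff using lim that by blast
    show "(\<lambda>n. hs n 0) \<longlonglongrightarrow> h 0" by (rule lim0) (use R in simp)
    show "0 \<in> ?S" using R by simp
  qed simp
  then obtain g where g: "\<And>x. x \<in> ?S \<Longrightarrow> (\<lambda>n. hs n x) \<longlonglongrightarrow> g x"
    "\<And>x. x \<in> ?S \<Longrightarrow> (g has_derivative g' x) (at x within ?S)" by blast
  have gh: "g x = h x" if "x \<in> ?S" for x
  proof -
    have "(\<lambda>n. hs n x) \<longlonglongrightarrow> h x"
      unfolding LIMSEQ_iff using lim that sub by blast
    then show ?thesis using g(1)[OF that] LIMSEQ_unique by blast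
  qed
  show ?thesis
    unfolding holomorphic_map_on_def
  proof (intro conjI ballI)
    fix x assume x: "x \<in> ?S"
    have "(g has_derivative g' x) (at x)" using g(2)[OF x] unfolding at_within_open[OF x open_ball] .
    then have "(h has_derivative g' x) (at x)"
      by (rule has_derivative_transform_within_open[of _ _ _ _ ?S]) (use x gh in auto)
    moreover have "complex_linear (g' x)"
    proof (rule complex_linearI)
      fix v w :: "complex ^ 2" and a :: complex
      have "(\<lambda>n. L n x (v + w)) \<longlonglongrightarrow> g' x v + g' x w"
        unfolding complex_linear_add[OF L(1)[OF x]] by (intro tendsto_add g' x)
      then show "g' x (v + w) = g' x v + g' x w" using g'[OF x] LIMSEQ_unique by blast
      have "bounded_linear (\<lambda>v :: complex ^ 2. a *s v)"
        unfolding linear_conv_bounded_linear[symmetric]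
        by (rule linearI) (simp_all add: vec_eq_iff algebra_simps)
      then have "(\<lambda>n. L n x (a *s v)) \<longlonglongrightarrow> a *s g' x v"
        unfolding complex_linear_scale[OF L(1)[OF x]] by (rule bounded_linear.tendsto[OF _ g'[OF x]])
      then show "g' x (a *s v) = a *s g' x v" using g'[OF x] LIMSEQ_unique by blast
    qed
    ultimately show "\<exists>L. complex_linear L \<and> (h has_derivative L) (at x)" by blast
  qed simp
qed

text \<open>Uniform bounds give equi-Lipschitz families on the smaller balls. One subsequence has to
  serve all \<open>n\<close> at once, since the limits at consecutive times are later related by an
  identity.\<close>

lemma diagonal_montel:
  fixes F :: "nat \<Rightarrow> nat \<Rightarrow> complex ^ 2 \<Rightarrow> complex ^ 2" and R B :: "nat \<Rightarrow> real"
  assumes F: "\<And>N n. holomorphic_map_on (F N n) (ball 0 (R n))" and R: "\<And>n. 0 < R n"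
    and B: "\<And>N n Z. Z \<in> ball 0 (R n) \<Longrightarrow> norm (F N n Z) \<le> B n"
  shows "\<exists>r G. strict_mono (r :: nat \<Rightarrow> nat) \<and>
    (\<forall>n e. 0 < e \<longrightarrow> (\<exists>N0. \<forall>N\<ge>N0. \<forall>Z\<in>cball 0 (R n / 4). norm (F (r N) n Z - G n Z) < e))"
proof -
  define P where "P n s \<longleftrightarrow> (\<exists>G. \<forall>e. 0 < e \<longrightarrow>
    (\<exists>N0. \<forall>N\<ge>N0. \<forall>Z\<in>cball 0 (R n / 4). norm (F (s N) n Z - G Z) < e))" for n and s :: "nat \<Rightarrow> nat"
  interpret subseqs P
  proof
    fix n and s :: "nat \<Rightarrow> nat"
    have sub: "cball 0 (R n / 4) \<subseteq> (ball 0 (R n / 2) :: (complex ^ 2) set)"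
      "cball 0 (R n / 4) \<subseteq> (ball 0 (R n) :: (complex ^ 2) set)"
      using R[of n] by auto
    have B0: "0 \<le> B n" using order_trans[OF norm_ge_zero B[of 0 n 0]] R[of n] by simp
    define K where "K = 8 * B n / R n + 1"
    have K: "0 < K" using B0 R[of n] by (simp add: K_def add_nonneg_pos)
    have lip: "norm (F N n x - F N n y) \<le> K * norm (x - y)"
      if "x \<in> cball 0 (R n / 4)" "y \<in> cball 0 (R n / 4)" for N and x y :: "complex ^ 2"
    proof -
      have "norm (F N n x - F N n y) \<le> 8 * B n / R n * norm (x - y)"
        by (rule lipschitz_of_bound_map[OF F R B subsetD[OF sub(1) that(1)] subsetD[OF sub(1) that(2)]])
      also have "\<dots> \<le> K * norm (x - y)" by (intro mult_right_mono) (auto simp: K_def)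
      finally show ?thesis .
    qed
    obtain g k where k: "strict_mono (k :: nat \<Rightarrow> nat)"
      "\<And>e. 0 < e \<Longrightarrow> \<exists>N. \<forall>n' x. n' \<ge> N \<and> x \<in> cball 0 (R n / 4) \<longrightarrow> norm (F (s (k n')) n x - g x) < e"
    proof (rule Arzela_Ascoli[of "cball 0 (R n / 4)" "\<lambda>N. F (s N) n" "B n"])
      show "norm (F (s N) n x) \<le> B n" if "x \<in> cball 0 (R n / 4)" for N and x :: "complex ^ 2"
        using B that sub by blast
      fix x :: "complex ^ 2" and e :: real assume x: "x \<in> cball 0 (R n / 4)" and e: "(0::real) < e"
      show "\<exists>d>0. \<forall>N y. y \<in> cball 0 (R n / 4) \<and> norm (x - y) < d \<longrightarrow> norm (F (s N) n x - F (s N) n y) < e"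
      proof (intro exI[of _ "e / K"] conjI allI impI)
        show "0 < e / K" using e K by simp
        fix N y assume y: "y \<in> cball 0 (R n / 4) \<and> norm (x - y) < e / K"
        have "norm (F (s N) n x - F (s N) n y) \<le> K * norm (x - y)" using lip x y by blast
        also have "\<dots> < e" using y K by (simp add: pos_less_divide_eq mult.commute)
        finally show "norm (F (s N) n x - F (s N) n y) < e" .
      qed
    qed auto
    show "\<exists>r'. strict_mono r' \<and> P n (s \<circ> r')"
      unfolding P_def o_def
    proof (intro exI[of _ k] conjI exI[of _ g] allI impI)
      show "strict_mono k" by (rule k(1))
      fix e :: real assume "0 < e"
      from k(2)[OF this] obtain N where "\<forall>n' x. n' \<ge> N \<and> x \<in> cball 0 (R n / 4) \<longrightarrow> norm (F (s (k n')) n x - g x) < e"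
        by (elim exE)
      then show "\<exists>N0. \<forall>N\<ge>N0. \<forall>Z\<in>cball 0 (R n / 4). norm (F (s (k N)) n Z - g Z) < e"
        by (intro exI[of _ N]) simp
    qed
  qed
  \<comment> \<open>The diagonal sequence is a subsequence of the \<open>n\<close>-th one only from
    index \<open>Suc n\<close> on; the shift is undone at the end, where it only enlarges
    \<open>N0\<close>.\<close>
  have "P n (diagseq \<circ> ((+) (Suc n)))" for n
  proof (rule diagseq_holds)
    fix r s n assume r: "strict_mono (r :: nat \<Rightarrow> nat)" and Ps: "P n s"
    from Ps obtain G where G: "\<And>e. 0 < e \<Longrightarrow>
      (\<exists>N0. \<forall>N\<ge>N0. \<forall>Z\<in>cball 0 (R n / 4). norm (F (s N) n Z - G Z) < e)" unfolding P_def by blast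
    show "P n (s \<circ> r)"
      unfolding P_def o_def
    proof (intro exI[of _ G] allI impI)
      fix e :: real assume "0 < e"
      from G[OF this] obtain N0 where N0: "\<And>N Z. N \<ge> N0 \<Longrightarrow> Z \<in> cball 0 (R n / 4) \<Longrightarrow> norm (F (s N) n Z - G Z) < e"
        by blast
      have "norm (F (s (r N)) n Z - G Z) < e" if "N \<ge> N0" "Z \<in> cball 0 (R n / 4)" for N Z
        by (rule N0) (use that strict_mono_imp_increasing[OF r, of N] in auto)
      then show "\<exists>N0. \<forall>N\<ge>N0. \<forall>Z\<in>cball 0 (R n / 4). norm (F (s (r N)) n Z - G Z) < e" by blast
    qed
  qed
  then have PP: "P n (\<lambda>N. diagseq (Suc n + N))" for n by (simp only: o_def)
  have "\<forall>n. \<exists>G. \<forall>e. 0 < e \<longrightarrow>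
      (\<exists>N0. \<forall>N\<ge>N0. \<forall>Z\<in>cball 0 (R n / 4). norm (F (diagseq (Suc n + N)) n Z - G Z) < e)"
  proof
    show "\<exists>G. \<forall>e. 0 < e \<longrightarrow>
      (\<exists>N0. \<forall>N\<ge>N0. \<forall>Z\<in>cball 0 (R n / 4). norm (F (diagseq (Suc n + N)) n Z - G Z) < e)" for n
      using PP[of n] unfolding P_def by simp
  qed
  from choice[OF this] obtain G where "\<forall>n e. 0 < e \<longrightarrow>
      (\<exists>N0. \<forall>N\<ge>N0. \<forall>Z\<in>cball 0 (R n / 4). norm (F (diagseq (Suc n + N)) n Z - G n Z) < e)"
    by (elim exE)
  then have G: "\<exists>N0. \<forall>N\<ge>N0. \<forall>Z\<in>cball 0 (R n / 4). norm (F (diagseq (Suc n + N)) n Z - G n Z) < e"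
    if "0 < e" for n and e :: real
    using that by simp
  show ?thesis
  proof (intro exI[of _ diagseq] exI[of _ G] conjI allI impI)
    show "strict_mono diagseq" by (rule subseq_diagseq)
    fix n and e :: real assume "0 < e"
    from G[OF this] obtain N0 where N0: "\<And>N Z. N \<ge> N0 \<Longrightarrow> Z \<in> cball 0 (R n / 4) \<Longrightarrow>
      norm (F (diagseq (Suc n + N)) n Z - G n Z) < e" by blast
    have "norm (F (diagseq N) n Z - G n Z) < e" if "N \<ge> Suc n + N0" "Z \<in> cball 0 (R n / 4)" for N Z
      using N0[of "N - Suc n" Z] that by simp
    then show "\<exists>N0. \<forall>N\<ge>N0. \<forall>Z\<in>cball 0 (R n / 4). norm (F (diagseq N) n Z - G n Z) < e" by blast
  qed
qed

context normal_form
begin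

text \<open>Relative to the radius \<open>s n\<close>, the errors of \<open>X\<close> and \<Psi> are
  of order \<open>s n\<close> and the shear is of order \<open>\<kappa> ^ n\<close>; all tend to
  0.\<close>

lemma Psi_close:
  assumes \<epsilon>: "0 < \<epsilon>"
  shows "\<exists>n0\<ge>n1. (\<forall>n\<ge>n0. s n \<le> 1/16) \<and> (\<forall>n\<ge>n0. \<forall>d Z. norm Z \<le> s n \<longrightarrow> norm (\<Psi> d n Z - Z) \<le> \<epsilon> * s n)"
proof -
  define b where "b n = 2 * ((2 * M + 2 * M') * s n + 2 ^ k * K' * \<kappa> ^ n)" for n
  have "b \<longlonglongrightarrow> 2 * ((2 * M + 2 * M') * 0 + 2 ^ k * K' * 0)"
    unfolding b_def using kappa by (intro tendsto_intros s_tendsto LIMSEQ_realpow_zero) auto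
  then have "\<forall>\<^sub>F n in sequentially. b n < \<epsilon>" using \<epsilon> by (intro order_tendstoD(2)) auto
  with eventually_good obtain n0 where n0: "\<And>n. n0 \<le> n \<Longrightarrow> good n" "\<And>n. n0 \<le> n \<Longrightarrow> b n < \<epsilon>"
    unfolding eventually_sequentially by (metis (no_types) nle_le order_trans)
  have "norm (\<Psi> d n Z - Z) \<le> \<epsilon> * s n" if n: "n0 \<le> n" and Z: "norm Z \<le> s n" for n d Z
  proof -
    have gd: "\<And>m. n \<le> m \<Longrightarrow> good m" using n0(1) n by simp
    have s0: "0 < s n" by (rule s_pos)
    have sk: "s n ^ k \<le> s n * s n" by (rule s_powers)
    have comp: "norm ((\<Psi> d n Z - Z) $ i) \<le> ((2 * M + 2 * M') * s n + 2 ^ k * K' * \<kappa> ^ n) * s n" for i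
    proof -
      define x where "x = X d n Z"
      have 1: "norm (x $ i - Z $ i) \<le> 2 * M * (s n * s n)"
        using X_size(1)[OF gd Z, of d i] mult_left_mono[OF sk, of "2 * M"] consts_nonneg(1) by (simp add: x_def)
      have "norm (c n i * (x $ (i + 1)) ^ k) \<le> norm (c n i) * (2 * s n) ^ k"
        unfolding norm_mult norm_power x_def using X_size(2)[OF gd Z]
        by (intro mult_left_mono power_mono) auto
      also have "\<dots> = 2 ^ k * (norm (c n i) * s n ^ (k - 1)) * s n"
        using k2 by (simp add: power_mult_distrib power_eq_if[of "s n" k])
      also have "\<dots> \<le> 2 ^ k * (K' * \<kappa> ^ n) * s n"
        using c_le[of n i] gd[of n] s0 by (intro mult_right_mono mult_left_mono) (auto simp: good_def s_def)
      finally have 2: "norm (c n i * (x $ (i + 1)) ^ k) \<le> 2 ^ k * (K' * \<kappa> ^ n) * s n" .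
      have "norm (\<Psi> d n Z $ i - x $ i - c n i * (x $ (i + 1)) ^ k) \<le> M' * \<omega> n i Z"
        unfolding x_def by (rule Psi_bound[OF gd Z])
      also have "\<dots> \<le> M' * (2 * s n ^ k)" using gd by (intro mult_left_mono omega_le Z consts_nonneg) auto
      also have "\<dots> \<le> M' * (2 * (s n * s n))" using sk consts_nonneg by (intro mult_left_mono) auto
      finally have 3: "norm (\<Psi> d n Z $ i - x $ i - c n i * (x $ (i + 1)) ^ k) \<le> M' * (2 * (s n * s n))" .
      have "(\<Psi> d n Z - Z) $ i = (\<Psi> d n Z $ i - x $ i - c n i * (x $ (i + 1)) ^ k)
          + c n i * (x $ (i + 1)) ^ k + (x $ i - Z $ i)" by simp
      also have "norm \<dots> \<le> M' * (2 * (s n * s n)) + 2 ^ k * (K' * \<kappa> ^ n) * s n + 2 * M * (s n * s n)"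
        by (rule norm_triangle_le[OF add_mono[OF norm_triangle_le[OF add_mono[OF 3 2]] 1]])
      finally show ?thesis by (simp add: algebra_simps)
    qed
    have "norm (\<Psi> d n Z - Z) \<le> norm ((\<Psi> d n Z - Z) $ 1) + norm ((\<Psi> d n Z - Z) $ (1 + 1))"
      by (rule norm_vec2_le)
    also have "\<dots> \<le> b n * s n" using comp[of 1] comp[of "1 + 1"] unfolding b_def ring_distribs by linarith
    also have "\<dots> \<le> \<epsilon> * s n" using n0(2)[OF n] s0 by (intro mult_right_mono) auto
    finally show ?thesis .
  qed
  moreover have "n1 \<le> n0" "\<forall>n\<ge>n0. s n \<le> 1/16" using n0(1) by (auto simp: good_def)
  ultimately show ?thesis by blast
qed

text \<open>For maps pulled back from one common final time the conjugacy relation is exact, and it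
  passes to the limit because \<open>g n\<close> is continuous. The radius \<open>s n / 8\<close> is
  a quarter from compactness, halved by the limit theorem; 1/128 is the closeness used in
  \<open>near_identity\<close>.\<close>

lemma local_conjugacy:
  "\<exists>n0\<ge>n1. \<exists>G. (\<forall>n\<ge>n0. s n \<le> 1/16) \<and> (\<forall>n\<ge>n0. holomorphic_map_on (G n) (ball 0 (s n / 8)) \<and>
    (\<forall>Z. norm Z < s n / 8 \<longrightarrow> norm (G n Z - Z) \<le> s n / 128 \<and> G (Suc n) (f n Z) = g n (G n Z)))"
proof -
  obtain n0 where n0: "n1 \<le> n0" "\<And>n. n0 \<le> n \<Longrightarrow> s n \<le> 1/16"
    and close: "\<And>n d Z. n0 \<le> n \<Longrightarrow> norm Z \<le> s n \<Longrightarrow> norm (\<Psi> d n Z - Z) \<le> 1/128 * s n"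
    using Psi_close[of "1/128"] by (metis zero_less_divide_1_iff zero_less_numeral)
  \<comment> \<open>The final time \<open>n0 + N\<close> is the same for all \<open>m\<close>. For
    \<open>m > N\<close> the subtraction gives 0 and \<open>F N m\<close> is the plain shear, which
    obeys the same bounds.\<close>
  define F where "F N m = \<Psi> (N - m) (n0 + m)" for N m
  have F_hol: "holomorphic_map_on (F N m) (ball 0 (s (n0 + m)))" for N m
    unfolding F_def by (rule holomorphic_map_on_subset[OF Psi_hol]) auto
  have F_le: "norm (F N m Z) \<le> 2 * s (n0 + m)" if "Z \<in> ball 0 (s (n0 + m))" for N m Z
  proof -
    have "norm Z \<le> s (n0 + m)" using that by simp
    then show ?thesis
      using close[of "n0 + m" Z "N - m"] norm_triangle_sub[of "F N m Z" Z] s_pos[of "n0 + m"] by (simp add: F_def)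
  qed
  from diagonal_montel[of F "\<lambda>m. s (n0 + m)" "\<lambda>m. 2 * s (n0 + m)", OF F_hol s_pos F_le] obtain r G where r: "strict_mono (r :: nat \<Rightarrow> nat)"
    and G: "\<And>m e. 0 < e \<Longrightarrow> \<exists>N0. \<forall>N\<ge>N0. \<forall>Z\<in>cball 0 (s (n0 + m) / 4). norm (F (r N) m Z - G m Z) < e"
    by blast
  have lim: "(\<lambda>N. F (r N) m Z) \<longlonglongrightarrow> G m Z" if "norm Z \<le> s (n0 + m) / 4" for m Z
    unfolding LIMSEQ_iff
  proof (intro allI impI)
    fix e :: real assume "0 < e"
    from G[OF this, of m] obtain N0 where "\<forall>N\<ge>N0. \<forall>Z\<in>cball 0 (s (n0 + m) / 4). norm (F (r N) m Z - G m Z) < e" ..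
    then show "\<exists>N0. \<forall>N\<ge>N0. norm (F (r N) m Z - G m Z) < e" using that by (intro exI[of _ N0]) simp
  qed
  have G_hol: "holomorphic_map_on (G m) (ball 0 (s (n0 + m) / 8))" for m
  proof -
    have "holomorphic_map_on (G m) (ball 0 (s (n0 + m) / 4 / 2))"
    proof (rule holomorphic_map_uniform_limit)
      show "holomorphic_map_on (F (r N) m) (ball 0 (s (n0 + m) / 4))" for N
        by (rule holomorphic_map_on_subset[OF F_hol]) (use s_pos[of "n0 + m"] in auto)
      show "0 < s (n0 + m) / 4" using s_pos[of "n0 + m"] by simp
      fix e :: real assume "0 < e"
      from G[OF this, of m] obtain N0 where "\<forall>N\<ge>N0. \<forall>Z\<in>cball 0 (s (n0 + m) / 4). norm (F (r N) m Z - G m Z) < e" ..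
      then show "\<exists>N. \<forall>n\<ge>N. \<forall>x\<in>ball 0 (s (n0 + m) / 4). norm (F (r n) m x - G m x) < e"
        by (intro exI[of _ N0]) simp
    qed
    then show ?thesis by simp
  qed
  have G_close: "norm (G m Z - Z) \<le> s (n0 + m) / 128" if Z: "norm Z < s (n0 + m) / 8" for m Z
  proof (rule tendsto_upperbound)
    show "(\<lambda>N. norm (F (r N) m Z - Z)) \<longlonglongrightarrow> norm (G m Z - Z)"
      by (intro tendsto_intros lim) (use Z s_pos[of "n0 + m"] in simp)
    have "norm (F (r N) m Z - Z) \<le> s (n0 + m) / 128" for N
      using close[of "n0 + m" Z "r N - m"] Z s_pos[of "n0 + m"] by (simp add: F_def)
    then show "\<forall>\<^sub>F N in sequentially. norm (F (r N) m Z - Z) \<le> s (n0 + m) / 128" by simp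
  qed simp
  have G_conj: "G (Suc m) (f (n0 + m) Z) = g (n0 + m) (G m Z)" if Z: "norm Z < s (n0 + m) / 8" for m Z
  proof -
    have "s (n0 + m) < 1" using n0(2)[of "n0 + m"] by simp
    then have fZ: "norm (f (n0 + m) Z) \<le> s (n0 + Suc m) / 4"
      using f_ball[of Z "1/4" "n0 + m"] Z s_pos[of "n0 + m"] by simp
    have cont: "isCont (g (n0 + m)) (G m Z)"
      using holomorphic_map_on_continuous[OF g_hol] by (simp add: continuous_on_eq_continuous_at)
    have "norm Z \<le> s (n0 + m) / 4" using Z s_pos[of "n0 + m"] by simp
    then have 1: "(\<lambda>N. g (n0 + m) (F (r N) m Z)) \<longlonglongrightarrow> g (n0 + m) (G m Z)"
      by (intro isCont_tendsto_compose[OF cont] lim)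
    \<comment> \<open>Once the final time lies beyond \<open>m\<close>, this is the recursion of
      \<Psi> solved with \<open>g_ginv\<close>.\<close>
    have "g (n0 + m) (F (r N) m Z) = F (r N) (Suc m) (f (n0 + m) Z)" if "N \<ge> Suc m" for N
    proof -
      have "Suc m \<le> r N" using that strict_mono_imp_increasing[OF r, of N] by simp
      then have "r N - m = Suc (r N - Suc m)" by simp
      then have "F (r N) m Z = ginv (n0 + m) (F (r N) (Suc m) (f (n0 + m) Z))"
        unfolding F_def by simp
      then show ?thesis using g_ginv[of "n0 + m"] n0(1) by simp
    qed
    then have "\<forall>\<^sub>F N in sequentially. g (n0 + m) (F (r N) m Z) = F (r N) (Suc m) (f (n0 + m) Z)"
      unfolding eventually_sequentially by blast
    then have "(\<lambda>N. F (r N) (Suc m) (f (n0 + m) Z)) \<longlonglongrightarrow> g (n0 + m) (G m Z)"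
      using 1 by (rule Lim_transform_eventually[rotated])
    then show ?thesis using lim[OF fZ] LIMSEQ_unique by blast
  qed
  show ?thesis
  proof (intro exI[of _ n0] exI[of _ "\<lambda>n. G (n - n0)"] conjI allI impI)
    fix n assume n: "n0 \<le> n"
    then have eq: "n0 + (n - n0) = n" "Suc n - n0 = Suc (n - n0)" by auto
    show "s n \<le> 1/16" by (rule n0(2)[OF n])
    show "holomorphic_map_on (G (n - n0)) (ball 0 (s n / 8))" using G_hol[of "n - n0"] unfolding eq .
    fix Z :: "complex ^ 2" assume Z: "norm Z < s n / 8"
    show "norm (G (n - n0) Z - Z) \<le> s n / 128" using G_close[of Z "n - n0"] Z unfolding eq by simp
    show "G (Suc n - n0) (f n Z) = g n (G (n - n0) Z)" using G_conj[of Z "n - n0"] Z unfolding eq by simp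
  qed (rule n0(1))
qed

end

text \<open>The difference to the identity has Lipschitz constant
  \<open>8 * (R / 128) / (R / 8) = 1/2\<close> on the ball of radius \<open>R / 16\<close>;
  injectivity, injective derivatives and a ball in the image all follow from this
  contraction.\<close>

lemma near_identity:
  fixes h :: "complex ^ 2 \<Rightarrow> complex ^ 2"
  assumes h: "holomorphic_map_on h (ball 0 (R / 8))" and R: "0 < R"
    and close: "\<And>Z. norm Z < R / 8 \<Longrightarrow> norm (h Z - Z) \<le> R / 128"
  shows "inj_on h (ball 0 (R / 16))"
    and "ball 0 (R / 64) \<subseteq> h ` ball 0 (R / 16)"
    and "\<And>Z L v. Z \<in> ball 0 (R / 16) \<Longrightarrow> complex_linear L \<Longrightarrow> (h has_derivative L) (at Z) \<Longrightarrow> L v = 0 \<Longrightarrow> v = 0"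
proof -
  let ?e = "\<lambda>Z. h Z - Z"
  have e: "holomorphic_map_on ?e (ball 0 (R / 8))"
    using h unfolding holomorphic_map_on_iff by (auto intro!: holomorphic_fun_on_diff holomorphic_fun_on_nth)
  have R8: "0 < R / 8" and R16: "R / 8 / 2 = R / 16" using R by auto
  have eb: "norm (?e Z) \<le> R / 128" if "Z \<in> ball 0 (R / 8)" for Z using close that by simp
  have lip: "norm (?e x - ?e y) \<le> 1/2 * norm (x - y)" if "x \<in> ball 0 (R / 16)" "y \<in> ball 0 (R / 16)" for x y
    using lipschitz_of_bound_map[OF e R8 eb, of x y] that R unfolding R16 by simp
  show "inj_on h (ball 0 (R / 16))"
  proof (rule inj_onI)
    fix x y assume "x \<in> ball 0 (R / 16)" "y \<in> ball 0 (R / 16)" "h x = h y"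
    then have "norm (x - y) \<le> 1/2 * norm (x - y)" using lip[of x y] by (simp add: norm_minus_commute)
    then show "x = y" by simp
  qed
  show "v = 0" if Z: "Z \<in> ball 0 (R / 16)" and L: "complex_linear L" "(h has_derivative L) (at Z)" and v: "L v = 0"
    for Z L v
  proof -
    have "norm (L v - v) \<le> 8 * (R / 128) / (R / 8) * norm v"
    proof (rule derivative_bound_of_bound[OF e R8 eb])
      show "Z \<in> ball 0 (R / 8 / 2)" using Z unfolding R16 .
      show "complex_linear (\<lambda>v. L v - v)"
        by (intro complex_linearI)
          (simp_all add: complex_linear_add[OF L(1)] complex_linear_scale[OF L(1)] vec_eq_iff algebra_simps)
      show "(?e has_derivative (\<lambda>v. L v - v)) (at Z)"
        by (intro has_derivative_diff L has_derivative_ident)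
    qed
    then have "norm v \<le> 1/2 * norm v" using v R by simp
    then show "v = 0" by simp
  qed
  show "ball 0 (R / 64) \<subseteq> h ` ball 0 (R / 16)"
  proof
    fix w :: "complex ^ 2" assume "w \<in> ball 0 (R / 64)"
    then have w: "norm w < R / 64" by simp
    \<comment> \<open>\<open>h x = w\<close> is solved as a fixed point of
      \<open>w - (h x - x)\<close>. The radius lies between \<open>R / 64 + R / 128\<close>, the
      size of the image, and \<open>R / 16\<close>.\<close>
    let ?S = "cball 0 (R / 20) :: (complex ^ 2) set"
    have S: "?S \<subseteq> ball 0 (R / 16)" "?S \<subseteq> ball 0 (R / 8)" using R by auto
    have "\<exists>!x\<in>?S. w - ?e x = x"
    proof (rule Banach_fix)
      show "complete ?S" by (simp add: compact_imp_complete)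
      show "?S \<noteq> {}" using R by auto
      show "0 \<le> (1/2 :: real)" "(1/2 :: real) < 1" by auto
      show "(\<lambda>x. w - ?e x) ` ?S \<subseteq> ?S"
      proof
        fix y assume "y \<in> (\<lambda>x. w - ?e x) ` ?S"
        then obtain x where x: "x \<in> ?S" "y = w - ?e x" by blast
        have "norm y \<le> norm w + norm (?e x)" unfolding x(2) by (rule norm_triangle_ineq4)
        also have "\<dots> \<le> R / 64 + R / 128" using w eb[OF subsetD[OF S(2) x(1)]] by linarith
        finally show "y \<in> ?S" using R by simp
      qed
      show "dist (w - ?e x) (w - ?e y) \<le> 1/2 * dist x y" if "x \<in> ?S" "y \<in> ?S" for x y
      proof -
        have "(w - ?e x) - (w - ?e y) = ?e y - ?e x" by simp
        then have "norm ((w - ?e x) - (w - ?e y)) = norm (?e x - ?e y)" by (simp only: norm_minus_commute)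
        then show ?thesis
          using lip[of x y] subsetD[OF S(1), of x] subsetD[OF S(1), of y] that by (simp add: dist_norm)
      qed
    qed
    then obtain x where x: "x \<in> ?S" "w - ?e x = x" by blast
    then have "h x = w" by (simp add: algebra_simps)
    then show "w \<in> h ` ball 0 (R / 16)" using x S by blast
  qed
qed

section \<open>Gluing\<close>

lemma biholomorphism_derivative_inj:
  fixes h :: "complex ^ 'n \<Rightarrow> complex ^ 'n"
  assumes h: "biholomorphism UNIV UNIV h hi" and L: "(h has_derivative L) (at z)" and v: "L v = 0"
  shows "v = 0"
proof -
  have "holomorphic_map_on hi UNIV" using h by (simp add: biholomorphism_def)
  then obtain M where M: "(hi has_derivative M) (at (h z))"
    unfolding holomorphic_map_on_def by blast
  have "((\<lambda>z. hi (h z)) has_derivative (\<lambda>v. M (L v))) (at z)"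
    using has_derivative_compose[OF L M] .
  moreover have "(\<lambda>z. hi (h z)) = (\<lambda>z. z)" using h by (auto simp: biholomorphism_def)
  ultimately have "((\<lambda>z. z) has_derivative (\<lambda>v. M (L v))) (at z)" by simp
  then have "(\<lambda>v. M (L v)) = (\<lambda>v. v)" using has_derivative_ident by (rule has_derivative_unique)
  then have "M (L v) = v" by meson
  moreover have "M 0 = 0" using M by (rule has_derivative_linear[THEN linear_0])
  ultimately show ?thesis using v by simp
qed

text \<open>The inverse of a complex linear bijection is complex linear, so the real inverse
  function theorem already yields a holomorphic inverse.\<close>

lemma biholomorphismI:
  fixes h :: "complex ^ 'n \<Rightarrow> complex ^ 'n"
  assumes hol: "holomorphic_map_on h S" and img: "h ` S = T" and inj: "inj_on h S"
    and dinj: "\<And>z. z \<in> S \<Longrightarrow> \<exists>L. complex_linear L \<and> (h has_derivative L) (at z) \<and> (\<forall>v. L v = 0 \<longrightarrow> v = 0)"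
    and T: "open T"
  shows "biholomorphism S T h (inv_into S h)"
  unfolding biholomorphism_def
proof (intro conjI ballI)
  show "holomorphic_map_on h S" "h ` S = T" by fact+
  show "inv_into S h (h z) = z" if "z \<in> S" for z using inj that by simp
  show "h (inv_into S h w) = w" if "w \<in> T" for w using img that by (simp add: f_inv_into_f)
  show "inv_into S h ` T = S" using img inj by (metis inv_into_image_cancel subset_refl)
  show "holomorphic_map_on (inv_into S h) T"
    unfolding holomorphic_map_on_def
  proof (intro conjI ballI)
    show "open T" by fact
    fix w assume "w \<in> T"
    then obtain z where z: "z \<in> S" "w = h z" using img by auto
    from dinj[OF z(1)] obtain L where L: "complex_linear L" "(h has_derivative L) (at z)" "\<And>v. L v = 0 \<Longrightarrow> v = 0"
      by blast
    have lin: "linear L" using L(2) by (rule has_derivative_linear)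
    have "inj L" using L(3) by (simp add: linear_injective_0[OF lin])
    then obtain L' where L': "linear L'" "\<And>x. L' (L x) = x" "\<And>x. L (L' x) = x"
      using linear_injective_isomorphism[OF lin] by blast
    have "complex_linear L'"
    proof (rule complex_linearI)
      show "L' (x + y) = L' x + L' y" for x y using L'(1) by (rule linear_add)
      show "L' (a *s x) = a *s L' x" for a x
        using complex_linear_scale[OF L(1), of a "L' x"] L'(2)[of "a *s L' x"] L'(3) by simp
    qed
    moreover have "(inv_into S h has_derivative L') (at (h z))"
    proof (rule has_derivative_inverse_strong[where S = S and f = h and x = z and f' = L])
      show "open S" using hol by (rule holomorphic_map_on_open)
      show "z \<in> S" by fact
      show "continuous_on S h" using hol by (rule holomorphic_map_on_continuous)
      show "inv_into S h (h x) = x" if "x \<in> S" for x using inj that by simp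
      show "(h has_derivative L) (at z)" by fact
      show "L \<circ> L' = id" using L'(3) by auto
    qed
    ultimately show "\<exists>L. complex_linear L \<and> (inv_into S h has_derivative L) (at w)"
      using z(2) by blast
  qed
qed

text \<open>The maps \<Gamma>i \<circ> \<psi> \<circ> \<Phi> at different times agree on increasing
  open sets exhausting the domain, so they define one map. \<open>cover\<close> gives surjectivity:
  every orbit of the model sequence eventually reaches the image of a local conjugacy.\<close>

lemma glued_biholomorphism:
  fixes \<Phi> \<Gamma> \<Gamma>i \<psi> :: "nat \<Rightarrow> complex ^ 'n \<Rightarrow> complex ^ 'n" and b :: "nat \<Rightarrow> real"
  assumes \<Phi>: "\<And>m. holomorphic_automorphism (\<Phi> m)"
    and \<Gamma>: "\<And>m. biholomorphism UNIV UNIV (\<Gamma> m) (\<Gamma>i m)"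
    and stay: "\<And>m Z. \<Phi> m Z \<in> ball 0 (b m) \<Longrightarrow> \<Phi> (Suc m) Z \<in> ball 0 (b (Suc m))"
    and conj: "\<And>m Z. \<Phi> m Z \<in> ball 0 (b m) \<Longrightarrow>
      \<Gamma>i (Suc m) (\<psi> (Suc m) (\<Phi> (Suc m) Z)) = \<Gamma>i m (\<psi> m (\<Phi> m Z))"
    and \<psi>: "\<And>m. holomorphic_map_on (\<psi> m) (ball 0 (b m))" "\<And>m. inj_on (\<psi> m) (ball 0 (b m))"
    and d\<psi>: "\<And>m Z L v. Z \<in> ball 0 (b m) \<Longrightarrow> complex_linear L \<Longrightarrow> (\<psi> m has_derivative L) (at Z) \<Longrightarrow> L v = 0 \<Longrightarrow> v = 0"
    and cover: "\<And>W. \<exists>m. \<Gamma> m W \<in> \<psi> m ` ball 0 (b m)"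
  shows "biholomorphic {Z. \<exists>m. \<Phi> m Z \<in> ball 0 (b m)} (UNIV :: (complex ^ 'n) set)"
proof -
  define U where "U m = {Z. \<Phi> m Z \<in> ball 0 (b m)}" for m
  define \<Omega> where "\<Omega> = {Z. \<exists>m. \<Phi> m Z \<in> ball 0 (b m)}"
  define H where "H Z = \<Gamma>i (LEAST m. Z \<in> U m) (\<psi> (LEAST m. Z \<in> U m) (\<Phi> (LEAST m. Z \<in> U m) Z))" for Z
  have \<Phi>hol: "holomorphic_map_on (\<Phi> m) UNIV" and \<Phi>i: "\<exists>h. biholomorphism UNIV UNIV (\<Phi> m) h" for m
    using \<Phi>[of m] by (auto simp: holomorphic_automorphism_def biholomorphism_def)
  have \<Gamma>ihol: "holomorphic_map_on (\<Gamma>i m) UNIV" and \<Gamma>i_bih: "biholomorphism UNIV UNIV (\<Gamma>i m) (\<Gamma> m)"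
    and \<Gamma>\<Gamma>i: "\<Gamma> m (\<Gamma>i m W) = W" "\<Gamma>i m (\<Gamma> m W) = W" for m W
    using \<Gamma>[of m] by (auto simp: biholomorphism_def)
  have step: "Z \<in> U (Suc m)" if "Z \<in> U m" for Z m using stay that by (simp add: U_def)
  have mono: "Z \<in> U n" if "Z \<in> U m" "m \<le> n" for Z m n
    using that(2) by (induction n rule: dec_induct) (use that(1) step in auto)
  have const: "\<Gamma>i n (\<psi> n (\<Phi> n Z)) = \<Gamma>i m (\<psi> m (\<Phi> m Z))" if "Z \<in> U m" "m \<le> n" for Z m n
    using that(2)
  proof (induction n rule: dec_induct)
    case (step n)
    have "\<Phi> n Z \<in> ball 0 (b n)" using mono[OF that(1) step(1)] by (simp add: U_def)
    from conj[OF this] step show ?case by simp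
  qed simp
  have H_eq: "H Z = \<Gamma>i m (\<psi> m (\<Phi> m Z))" if "Z \<in> U m" for Z m
  proof -
    have "Z \<in> U (LEAST m. Z \<in> U m)" "(LEAST m. Z \<in> U m) \<le> m"
      using that by (auto intro: LeastI Least_le)
    from const[OF this] show ?thesis by (simp add: H_def)
  qed
  have U_open: "open (U m)" for m
  proof -
    have "U m = \<Phi> m -` ball 0 (b m)" by (auto simp: U_def)
    then show ?thesis
      using open_vimage[OF open_ball[of 0 "b m"] holomorphic_map_on_continuous[OF \<Phi>hol[of m]]] by simp
  qed
  have \<Omega>U: "\<Omega> = (\<Union>m. U m)" by (auto simp: \<Omega>_def U_def)
  have deriv: "\<exists>L. complex_linear L \<and> (H has_derivative L) (at Z) \<and> (\<forall>v. L v = 0 \<longrightarrow> v = 0)" if Z: "Z \<in> \<Omega>" for Z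
  proof -
    obtain m where m: "Z \<in> U m" using Z by (auto simp: \<Omega>U)
    obtain L1 where L1: "complex_linear L1" "(\<Phi> m has_derivative L1) (at Z)"
      using \<Phi>hol[of m] by (auto simp: holomorphic_map_on_def)
    have inb: "\<Phi> m Z \<in> ball 0 (b m)" using m by (simp add: U_def)
    obtain L2 where L2: "complex_linear L2" "(\<psi> m has_derivative L2) (at (\<Phi> m Z))"
      using \<psi>(1)[of m] inb unfolding holomorphic_map_on_def by blast
    obtain L3 where L3: "complex_linear L3" "(\<Gamma>i m has_derivative L3) (at (\<psi> m (\<Phi> m Z)))"
      using \<Gamma>ihol[of m] by (auto simp: holomorphic_map_on_def)
    have "((\<lambda>Z. \<Gamma>i m (\<psi> m (\<Phi> m Z))) has_derivative (\<lambda>v. L3 (L2 (L1 v)))) (at Z)"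
      by (rule has_derivative_compose[OF has_derivative_compose[OF L1(2) L2(2)] L3(2)])
    then have "(H has_derivative (\<lambda>v. L3 (L2 (L1 v)))) (at Z)"
      by (rule has_derivative_transform_within_open[OF _ U_open m]) (simp add: H_eq)
    moreover have "complex_linear (\<lambda>v. L3 (L2 (L1 v)))"
      by (rule complex_linear_compose[OF complex_linear_compose[OF L1(1) L2(1)] L3(1)])
    moreover have "v = 0" if "L3 (L2 (L1 v)) = 0" for v
    proof -
      obtain h where "biholomorphism UNIV UNIV (\<Phi> m) h" using \<Phi>i by blast
      note i1 = biholomorphism_derivative_inj[OF this L1(2)]
      have "L2 (L1 v) = 0" by (rule biholomorphism_derivative_inj[OF \<Gamma>i_bih L3(2) that])
      then have "L1 v = 0" by (rule d\<psi>[OF inb L2])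
      then show ?thesis by (rule i1)
    qed
    ultimately show ?thesis by blast
  qed
  have "biholomorphism \<Omega> UNIV H (inv_into \<Omega> H)"
  proof (rule biholomorphismI)
    show "holomorphic_map_on H \<Omega>"
      unfolding holomorphic_map_on_def
    proof (intro conjI ballI)
      show "open \<Omega>" unfolding \<Omega>U using U_open by (rule open_UN[OF ballI])
      fix z assume "z \<in> \<Omega>"
      from deriv[OF this] show "\<exists>L. complex_linear L \<and> (H has_derivative L) (at z)" by blast
    qed
    show "H ` \<Omega> = UNIV"
    proof
      show "UNIV \<subseteq> H ` \<Omega>"
      proof
        fix W
        obtain m y where y: "y \<in> ball 0 (b m)" "\<Gamma> m W = \<psi> m y" using cover[of W] by blast
        obtain Z where Z: "\<Phi> m Z = y" using \<Phi>i[of m] unfolding biholomorphism_def by (metis UNIV_I)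
        have "Z \<in> U m" using y Z by (simp add: U_def)
        then have "H Z = W" using H_eq[of Z m] y(2) Z \<Gamma>\<Gamma>i(2)[of m W] by simp
        then show "W \<in> H ` \<Omega>" using \<open>Z \<in> U m\<close> by (auto simp: \<Omega>U)
      qed
    qed simp
    show "inj_on H \<Omega>"
    proof (rule inj_onI)
      fix x y assume "x \<in> \<Omega>" "y \<in> \<Omega>" and eq: "H x = H y"
      then obtain m n where "x \<in> U m" "y \<in> U n" by (auto simp: \<Omega>U)
      then have xy: "x \<in> U (max m n)" "y \<in> U (max m n)" using mono by auto
      let ?k = "max m n"
      have "\<Gamma>i ?k (\<psi> ?k (\<Phi> ?k x)) = \<Gamma>i ?k (\<psi> ?k (\<Phi> ?k y))" using eq H_eq xy by simp
      then have "\<psi> ?k (\<Phi> ?k x) = \<psi> ?k (\<Phi> ?k y)" by (metis \<Gamma>\<Gamma>i(1))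
      then have "\<Phi> ?k x = \<Phi> ?k y"
        using inj_onD[OF \<psi>(2)[of ?k]] xy by (simp add: U_def)
      then show "x = y" using \<Phi>i[of ?k] unfolding biholomorphism_def by (metis UNIV_I)
    qed
    show "\<And>z. z \<in> \<Omega> \<Longrightarrow> \<exists>L. complex_linear L \<and> (H has_derivative L) (at z) \<and> (\<forall>v. L v = 0 \<longrightarrow> v = 0)"
      by (rule deriv)
  qed simp
  then show ?thesis unfolding biholomorphic_def \<Omega>_def by blast
qed

lemma biholomorphism_compose:
  assumes "biholomorphism UNIV UNIV h hi" "biholomorphism UNIV UNIV g gi"
  shows "biholomorphism UNIV UNIV (\<lambda>z. g (h z)) (\<lambda>w. hi (gi w))"
proof -
  have h: "holomorphic_map_on h UNIV" "h ` UNIV = UNIV" "\<And>z. hi (h z) = z"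
      "holomorphic_map_on hi UNIV" "hi ` UNIV = UNIV" "\<And>z. h (hi z) = z"
    and g: "holomorphic_map_on g UNIV" "g ` UNIV = UNIV" "\<And>z. gi (g z) = z"
      "holomorphic_map_on gi UNIV" "gi ` UNIV = UNIV" "\<And>z. g (gi z) = z"
    using assms unfolding biholomorphism_def by simp_all
  show ?thesis
    unfolding biholomorphism_def
  proof (intro conjI ballI)
    show "holomorphic_map_on (\<lambda>z. g (h z)) UNIV"
      by (rule holomorphic_map_on_compose[OF h(1) g(1)]) simp
    show "holomorphic_map_on (\<lambda>w. hi (gi w)) UNIV"
      by (rule holomorphic_map_on_compose[OF g(4) h(4)]) simp
    show "(\<lambda>z. g (h z)) ` UNIV = UNIV" unfolding image_image[of g h, symmetric] h(2) by (rule g(2))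
    show "(\<lambda>w. hi (gi w)) ` UNIV = UNIV" unfolding image_image[of hi gi, symmetric] g(5) by (rule h(5))
  qed (simp_all only: h g)
qed

section \<open>The basin of the normal form\<close>

locale train_normal_form = normal_form +
  fixes T :: "nat \<Rightarrow> nat"
  assumes n1: "n1 = T 0" "1 \<le> T 0" and T_grow: "k * T j \<le> T (Suc j)"
    and T_const: "T j \<le> n \<Longrightarrow> n < T (Suc j) \<Longrightarrow> \<tau> n = \<tau> (T j)"
begin

section \<open>Growth of the train starting times\<close>

lemma T_ge: "k ^ j * T i \<le> T (i + j)"
proof (induction j)
  case (Suc j)
  have "k ^ Suc j * T i = k * (k ^ j * T i)" by simp
  also have "\<dots> \<le> k * T (i + j)" using Suc by (intro mult_left_mono) auto
  also have "\<dots> \<le> T (i + Suc j)" using T_grow[of "i + j"] by simp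
  finally show ?case .
qed simp

lemma T_pos: "1 \<le> T j"
proof -
  have "1 * 1 \<le> k ^ j * T 0" using k2 n1 by (intro mult_mono) auto
  also have "\<dots> \<le> T (0 + j)" by (rule T_ge)
  finally show ?thesis by simp
qed

lemma T_less: "T j < T (Suc j)"
proof -
  have "2 * T j \<le> k * T j" using k2 by (intro mult_right_mono) auto
  then show ?thesis using T_grow[of j] T_pos[of j] by linarith
qed

lemma T_index: "j \<le> T j"
  using strict_mono_imp_increasing[of T j] T_less by (simp add: strict_mono_Suc_iff)

lemma T_ge_n1: "n1 \<le> T j"
  using T_less by (simp add: n1 lift_Suc_mono_le less_imp_le)

text \<open>On a train, component \<open>\<tau> n\<close> evolves linearly by itself and only drives
  the other one. However long the train, the degree is raised to \<open>k\<close> just once, and the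
  driving terms sum geometrically.\<close>

lemma train_bound:
  assumes orbit: "\<And>n. T j \<le> n \<Longrightarrow> w (Suc n) = g n (w n)"
  shows "norm (w (T (Suc j))) \<le> 2 * D ^ (T (Suc j) - T j) *
    (norm (w (T j)) + K' / (D * (1 - D)) * norm (w (T j)) ^ k)"
proof -
  define t where "t = T j"
  define v where "v = norm (w t)"
  define i where "i = \<tau> t"
  have v0: "0 \<le> v" by (simp add: v_def)
  have main: "norm (w (t + m) $ i) \<le> D ^ m * v \<and>
      norm (w (t + m) $ (i + 1)) \<le> D ^ m * (v + K' / D * v ^ k * (\<Sum>l<m. D ^ l))"
    if "t + m \<le> T (Suc j)" for m
    using that
  proof (induction m)
    case 0
    then show ?case using Finite_Cartesian_Product.norm_nth_le[of "w t"] by (simp add: v_def)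
  next
    case (Suc m)
    define S where "S = (\<Sum>l<m. D ^ l)"
    have IH: "norm (w (t + m) $ i) \<le> D ^ m * v"
      "norm (w (t + m) $ (i + 1)) \<le> D ^ m * (v + K' / D * v ^ k * S)" using Suc by (auto simp: S_def)
    have tm: "T j \<le> t + m" "t + m < T (Suc j)" using Suc.prems by (auto simp: t_def)
    have nn: "n1 \<le> t + m" using tm(1) T_ge_n1[of j] by simp
    have w: "w (Suc (t + m)) = g (t + m) (w (t + m))" using orbit[OF tm(1)] by simp
    have "\<tau> (t + m) = i" using T_const[OF tm] by (simp add: i_def t_def)
    then have q0: "q (t + m) i = 0" using q_main[OF nn] by simp
    have lamD': "norm (lam n l) \<le> D" for n l using lamD[of n l] D0 by simp
    have 1: "norm (w (t + Suc m) $ i) \<le> D ^ Suc m * v"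
    proof -
      have "norm (w (t + Suc m) $ i) = norm (lam (t + m) i) * norm (w (t + m) $ i)"
        by (simp add: w g_def q0 norm_mult)
      also have "\<dots> \<le> D * (D ^ m * v)" using lamD' IH(1) Dpos by (intro mult_mono) auto
      finally show ?thesis by simp
    qed
    have "norm (w (t + m) $ i) ^ k \<le> (D ^ m * v) ^ k" using IH(1) by (intro power_mono) auto
    also have "\<dots> = (D ^ m) ^ k * v ^ k" by (simp add: power_mult_distrib)
    \<comment> \<open>One factor \<open>D ^ m\<close> remains as decay in front, the other is the
      new term of the geometric sum.\<close>
    also have "\<dots> \<le> (D ^ m) ^ 2 * v ^ k"
      using k2 Dpos D1 v0 by (intro mult_right_mono power_decreasing) (auto simp: power_le_one)
    finally have pk: "norm (w (t + m) $ i) ^ k \<le> (D ^ m) ^ 2 * v ^ k" .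
    have "norm (w (t + Suc m) $ (i + 1)) \<le> norm (lam (t + m) (i + 1)) * norm (w (t + m) $ (i + 1))
        + norm (q (t + m) (i + 1)) * norm (w (t + m) $ i) ^ k"
      using norm_triangle_ineq[of "lam (t + m) (i + 1) * w (t + m) $ (i + 1)" "q (t + m) (i + 1) * (w (t + m) $ i) ^ k"]
      by (simp add: w g_def norm_mult norm_power)
    also have "\<dots> \<le> D * (D ^ m * (v + K' / D * v ^ k * S)) + K' * ((D ^ m) ^ 2 * v ^ k)"
      using lamD'[of "t + m" "i + 1"] IH(2) pk q_le[OF nn, of "i + 1"] Dpos K'1
      by (intro add_mono mult_mono) auto
    also have "K' * ((D ^ m) ^ 2 * v ^ k) = D ^ Suc m * (K' / D * v ^ k * D ^ m)"
      using Dpos by (simp add: power2_eq_square)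
    also have "D * (D ^ m * (v + K' / D * v ^ k * S)) + D ^ Suc m * (K' / D * v ^ k * D ^ m)
        = D ^ Suc m * (v + K' / D * v ^ k * (S + D ^ m))"
      by (simp only: power_Suc ring_distribs mult.assoc add.assoc)
    finally show ?case using 1 by (simp add: S_def)
  qed
  define m where "m = T (Suc j) - T j"
  have tm: "t + m = T (Suc j)" using T_less[of j] by (simp add: m_def t_def)
  have "(\<Sum>l<m. D ^ l) \<le> 1 / (1 - D)"
    using Dpos D1 by (simp add: geometric_sum divide_le_cancel sum_gp_strict)
  then have "K' / D * v ^ k * (\<Sum>l<m. D ^ l) \<le> K' / D * v ^ k * (1 / (1 - D))"
    using K'1 Dpos v0 by (intro mult_left_mono) auto
  then have geo: "K' / D * v ^ k * (\<Sum>l<m. D ^ l) \<le> K' / (D * (1 - D)) * v ^ k" by simp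
  have Dm: "0 \<le> D ^ m" using Dpos by simp
  have pos: "0 \<le> K' / (D * (1 - D)) * v ^ k" using K'1 Dpos D1 v0 by simp
  have "norm (w (t + m) $ i) \<le> D ^ m * (v + K' / (D * (1 - D)) * v ^ k)"
    using main[of m] tm mult_left_mono[OF _ Dm, of v "v + K' / (D * (1 - D)) * v ^ k"] pos by simp
  moreover have "norm (w (t + m) $ (i + 1)) \<le> D ^ m * (v + K' / (D * (1 - D)) * v ^ k)"
    using main[of m] tm mult_left_mono[OF _ Dm, of "v + K' / D * v ^ k * (\<Sum>l<m. D ^ l)" "v + K' / (D * (1 - D)) * v ^ k"] geo by simp
  ultimately have "norm (w (t + m) $ i) + norm (w (t + m) $ (i + 1))
      \<le> D ^ m * (v + K' / (D * (1 - D)) * v ^ k) + D ^ m * (v + K' / (D * (1 - D)) * v ^ k)"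
    by (rule add_mono)
  from order_trans[OF norm_vec2_le this]
  have "norm (w (t + m)) \<le> 2 * D ^ m * (v + K' / (D * (1 - D)) * v ^ k)" by (simp only: mult.assoc) (simp only: mult_2)
  then show ?thesis unfolding tm unfolding v_def t_def m_def .
qed

text \<open>An orbit that never gets small must stay above 1 at late train starts, since otherwise a
  single train would shrink it below \<rho>. Then \<open>ln (v j)\<close> is multiplied by at most
  \<open>k\<close> per train, minus a multiple of \<open>T j\<close>; as \<open>T j\<close> also
  grows by the factor \<open>k\<close>, the rescaled logarithm decreases linearly and turns
  negative.\<close>

lemma orbit_gets_small:
  assumes orbit: "\<And>n. n0 \<le> n \<Longrightarrow> w (Suc n) = g n (w n)" and \<rho>: "0 < \<rho>"
  shows "\<exists>n\<ge>n0. norm (w n) \<le> \<rho>"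
proof (rule ccontr)
  assume "\<not> (\<exists>n\<ge>n0. norm (w n) \<le> \<rho>)"
  then have big: "\<rho> < norm (w n)" if "n0 \<le> n" for n using that by force
  define E where "E = 2 * (1 + K' / (D * (1 - D)))"
  define v where "v j = norm (w (T j))" for j
  have c0: "0 \<le> K' / (D * (1 - D))" using K'1 Dpos D1 by simp
  have E2: "2 \<le> E" using c0 by (simp add: E_def)
  have rec: "v (Suc j) \<le> E * D ^ T j * max 1 (v j) ^ k" if "n0 \<le> T j" for j
  proof -
    let ?m = "max 1 (v j)"
    have v0: "0 \<le> v j" by (simp add: v_def)
    have "v j \<le> ?m ^ 1" by simp
    also have "\<dots> \<le> ?m ^ k" using k2 by (intro power_increasing) auto
    finally have 1: "v j \<le> ?m ^ k" .
    have "v j ^ k \<le> ?m ^ k" using v0 by (intro power_mono) auto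
    then have "K' / (D * (1 - D)) * v j ^ k \<le> K' / (D * (1 - D)) * ?m ^ k" using c0 by (rule mult_left_mono)
    with 1 have 2: "v j + K' / (D * (1 - D)) * v j ^ k \<le> (1 + K' / (D * (1 - D))) * ?m ^ k"
      by (simp only: ring_distribs mult_1)
    \<comment> \<open>As \<open>k\<close> is at least 2, a train lasts at least as long as the time
      elapsed before it.\<close>
    have "T j * 1 \<le> T j * (k - 1)" using k2 by (intro mult_left_mono) auto
    also have "T j * (k - 1) = k * T j - T j" by (simp add: algebra_simps diff_mult_distrib2)
    also have "\<dots> \<le> T (Suc j) - T j" using T_grow[of j] by simp
    finally have 3: "D ^ (T (Suc j) - T j) \<le> D ^ T j" using Dpos D1 by (intro power_decreasing) auto
    have "v (Suc j) \<le> 2 * D ^ (T (Suc j) - T j) * (v j + K' / (D * (1 - D)) * v j ^ k)"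
      unfolding v_def by (rule train_bound) (use orbit that in auto)
    also have "\<dots> \<le> 2 * D ^ T j * ((1 + K' / (D * (1 - D))) * ?m ^ k)"
    proof (rule mult_mono[OF mult_left_mono[OF 3] 2])
      show "0 \<le> v j + K' / (D * (1 - D)) * v j ^ k"
        by (rule add_nonneg_nonneg[OF v0 mult_nonneg_nonneg[OF c0 zero_le_power[OF v0]]])
    qed (use Dpos in auto)
    finally show ?thesis by (simp only: E_def mult_ac)
  qed
  have tend: "(\<lambda>j. E * D ^ j) \<longlonglongrightarrow> E * 0"
    using Dpos D1 by (intro tendsto_intros LIMSEQ_realpow_zero) auto
  then have "\<forall>\<^sub>F j in sequentially. E * D ^ j < min \<rho> 1"
    using \<rho> by (intro order_tendstoD(2)) auto
  then obtain j1 where j1: "\<And>j. j1 \<le> j \<Longrightarrow> E * D ^ j < min \<rho> 1"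
    unfolding eventually_sequentially by blast
  have "\<forall>\<^sub>F j in sequentially. E * sqrt D ^ j < 1"
  proof -
    have "(\<lambda>j. E * sqrt D ^ j) \<longlonglongrightarrow> E * 0"
      using Dpos D1 by (intro tendsto_intros LIMSEQ_realpow_zero) auto
    then show ?thesis by (intro order_tendstoD(2)) auto
  qed
  then obtain j2 where j2: "\<And>j. j2 \<le> j \<Longrightarrow> E * sqrt D ^ j < 1"
    unfolding eventually_sequentially by blast
  define J where "J = max n0 (max j1 j2)"
  have TJ: "n0 \<le> T j" "j1 \<le> T j" "j2 \<le> T j" if "J \<le> j" for j
    using that T_index[of j] by (auto simp: J_def)
  have v1: "1 < v j" if "J \<le> j" for j
  proof (rule ccontr)
    assume "\<not> 1 < v j"
    then have "v (Suc j) \<le> E * D ^ T j" using rec[OF TJ(1)[OF that]] by (simp add: max_def split: if_splits)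
    also have "\<dots> < \<rho>" using j1[OF TJ(2)[OF that]] by simp
    finally show False using big[of "T (Suc j)"] TJ(1)[of "Suc j"] that by (simp add: v_def)
  qed
  \<comment> \<open>The decay \<open>D ^ T j\<close> is split into two equal square roots: one
    swallows the constant \<open>E\<close>, the other is the net gain with rate \<beta>.\<close>
  define \<beta> where "\<beta> = - ln (sqrt D)"
  have \<beta>: "0 < \<beta>" using Dpos D1 by (simp add: \<beta>_def)
  have lnrec: "ln (v (Suc j)) \<le> k * ln (v j) - \<beta> * T j" if j: "J \<le> j" for j
  proof -
    have vj: "1 < v j" "1 < v (Suc j)" using v1 j by auto
    have sq: "D = sqrt D * sqrt D" using Dpos by simp
    have "E * D ^ T j = (E * sqrt D ^ T j) * sqrt D ^ T j"
      by (subst sq) (simp only: power_mult_distrib mult.assoc)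
    also have "\<dots> \<le> 1 * sqrt D ^ T j"
      using j2[OF TJ(3)[OF j]] Dpos by (intro mult_right_mono) auto
    finally have "E * D ^ T j \<le> sqrt D ^ T j" by simp
    then have "E * D ^ T j * v j ^ k \<le> sqrt D ^ T j * v j ^ k"
      by (rule mult_right_mono) (use vj in auto)
    moreover have "v (Suc j) \<le> E * D ^ T j * v j ^ k"
      using rec[OF TJ(1)[OF j]] vj by (simp add: max_def)
    ultimately have "v (Suc j) \<le> sqrt D ^ T j * v j ^ k" by (rule order_trans[rotated])
    then have "ln (v (Suc j)) \<le> ln (sqrt D ^ T j * v j ^ k)"
      using vj Dpos by (subst ln_le_cancel_iff) auto
    also have "\<dots> = T j * ln (sqrt D) + k * ln (v j)"
      using vj Dpos by (subst ln_mult) (auto simp: ln_realpow)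
    finally show ?thesis by (simp add: \<beta>_def mult.commute)
  qed
  \<comment> \<open>Divided by \<open>k ^ i\<close>, the logarithm loses at least
    \<open>\<beta> / k\<close> per train, because \<open>T (J + i)\<close> is at least
    \<open>k ^ i\<close>.\<close>
  have bound: "ln (v (J + i)) \<le> real k ^ i * (ln (v J) - i * \<beta> / k)" for i
  proof (induction i)
    case (Suc i)
    have "real (k ^ i * 1) \<le> real (T (J + i))"
      unfolding of_nat_le_iff using T_ge[of i J] T_pos[of J] mult_le_mono2[of 1 "T J" "k ^ i"] by linarith
    then have kT: "\<beta> * real k ^ i \<le> \<beta> * T (J + i)" using \<beta> by (intro mult_left_mono) auto
    have "ln (v (J + Suc i)) \<le> k * ln (v (J + i)) - \<beta> * T (J + i)" using lnrec[of "J + i"] by simp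
    also have "\<dots> \<le> k * (real k ^ i * (ln (v J) - i * \<beta> / k)) - \<beta> * real k ^ i"
      by (rule diff_mono[OF mult_left_mono[OF Suc] kT]) simp
    also have "\<dots> = real k ^ Suc i * (ln (v J) - Suc i * \<beta> / k)"
      using k2 by (simp add: field_simps)
    finally show ?case .
  qed simp
  obtain i :: nat where i: "ln (v J) * k / \<beta> < i" using reals_Archimedean2 by blast
  then have "ln (v J) - i * \<beta> / k < 0" using \<beta> k2 by (simp add: field_simps)
  then have "real k ^ i * (ln (v J) - i * \<beta> / k) < 0" using k2 by (intro mult_pos_neg) auto
  then have "ln (v (J + i)) < 0" using bound[of i] by simp
  moreover have "0 < ln (v (J + i))" using v1[of "J + i"] by simp
  ultimately show False by simp
qed

text \<open>Once small, the orbit contracts at a rate \<open>D2\<close> strictly between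
  \<open>D0\<close> and \<open>D\<close>, so it eventually beats the shrinking radii
  \<open>\<epsilon> * D ^ n\<close>.\<close>

lemma orbit_enters:
  assumes orbit: "\<And>n. n0 \<le> n \<Longrightarrow> w (Suc n) = g n (w n)" and n0: "n1 \<le> n0" and \<epsilon>: "0 < \<epsilon>"
  shows "\<exists>n\<ge>n0. norm (w n) < \<epsilon> * s n"
proof -
  define D2 where "D2 = (D0 + D) / 2"
  have D2: "0 < D2" "D2 < D" using D0 by (auto simp: D2_def)
  \<comment> \<open>On this ball the power terms have norm at most
    \<open>(D - D0) / 2 * norm Z\<close>, so the linear bound \<open>D0\<close> worsens only to
    \<open>D2\<close>.\<close>
  define \<rho> where "\<rho> = min 1 ((D - D0) / (4 * K'))"
  have \<rho>: "0 < \<rho>" using D0 K'1 by (simp add: \<rho>_def)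
  have contr: "norm (g n Z) \<le> D2 * norm Z" if n: "n1 \<le> n" and Z: "norm Z \<le> \<rho>" for n and Z :: "complex ^ 2"
  proof -
    define A :: "complex ^ 2" where "A = (\<chi> i. lam n i * Z $ i)"
    define Q :: "complex ^ 2" where "Q = (\<chi> i. q n i * (Z $ (i + 1)) ^ k)"
    have "norm A \<le> D0 * norm Z"
    proof -
      have "norm A \<le> L2_set (\<lambda>i. D0 * norm (Z $ i)) UNIV"
        unfolding norm_vec_def A_def
        by (rule L2_set_mono) (use lamD D0 in \<open>auto simp: norm_mult intro: mult_right_mono\<close>)
      also have "\<dots> = D0 * norm Z"
        unfolding norm_vec_def using D0 by (simp add: L2_set_right_distrib)
      finally show ?thesis .
    qed
    moreover have "norm Q \<le> 2 * K' * \<rho> * norm Z"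
    proof -
      have comp: "norm (Q $ i) \<le> K' * (\<rho> * norm Z)" for i
      proof -
        have zn: "norm (Z $ (i + 1)) \<le> norm Z" by (rule Finite_Cartesian_Product.norm_nth_le)
        have "norm (Z $ (i + 1)) ^ k \<le> norm Z ^ k" using zn by (intro power_mono) auto
        also have "\<dots> \<le> norm Z ^ 2" using k2 Z by (intro power_decreasing) (auto simp: \<rho>_def)
        also have "\<dots> \<le> \<rho> * norm Z" using Z by (simp add: power2_eq_square mult_right_mono)
        finally have "norm (Z $ (i + 1)) ^ k \<le> \<rho> * norm Z" .
        then show ?thesis unfolding Q_def using q_le[OF n, of i] K'1
          by (auto simp: norm_mult norm_power intro!: mult_mono)
      qed
      have "norm Q \<le> norm (Q $ 1) + norm (Q $ (1 + 1))" by (rule norm_vec2_le)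
      then show ?thesis using comp[of 1] comp[of "1 + 1"] by simp
    qed
    moreover have "2 * K' * \<rho> * norm Z \<le> (D - D0) / 2 * norm Z"
    proof (rule mult_right_mono)
      have "\<rho> \<le> (D - D0) / (4 * K')" unfolding \<rho>_def by (rule min.cobounded2)
      then show "2 * K' * \<rho> \<le> (D - D0) / 2" using K'1 by (simp add: field_simps)
    qed simp
    moreover have "g n Z = A + Q" by (simp add: g_def A_def Q_def vec_eq_iff)
    ultimately have "norm (g n Z) \<le> D0 * norm Z + (D - D0) / 2 * norm Z"
      using norm_triangle_ineq[of A Q] by simp
    also have "\<dots> = D2 * norm Z" by (simp add: D2_def field_simps)
    finally show ?thesis .
  qed
  obtain N where N: "n0 \<le> N" "norm (w N) \<le> \<rho>" using orbit_gets_small[OF orbit \<rho>] by blast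
  have wb: "norm (w (N + j)) \<le> D2 ^ j * \<rho>" for j
  proof (induction j)
    case (Suc j)
    have "D2 ^ j * \<rho> \<le> 1 * \<rho>" using D2 D1 \<rho> by (intro mult_right_mono power_le_one) auto
    then have small: "norm (w (N + j)) \<le> \<rho>" using Suc by simp
    have "norm (w (N + Suc j)) = norm (g (N + j) (w (N + j)))" using orbit[of "N + j"] N by simp
    also have "\<dots> \<le> D2 * norm (w (N + j))" by (rule contr) (use N n0 small in auto)
    also have "\<dots> \<le> D2 * (D2 ^ j * \<rho>)" using Suc D2 by (intro mult_left_mono) auto
    finally show ?case by simp
  qed (use N in simp)
  have "(\<lambda>j. (D2 / D) ^ j) \<longlonglongrightarrow> 0" using D2 Dpos by (intro LIMSEQ_realpow_zero) auto
  then have "\<forall>\<^sub>F j in sequentially. (D2 / D) ^ j < \<epsilon> * D ^ N / \<rho>"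
    using \<epsilon> Dpos \<rho> by (intro order_tendstoD(2)) auto
  then obtain j where j: "(D2 / D) ^ j < \<epsilon> * D ^ N / \<rho>" unfolding eventually_sequentially by blast
  then have "D2 ^ j * \<rho> < \<epsilon> * s (N + j)"
    using Dpos \<rho> by (simp add: s_def power_divide power_add field_simps)
  then have "norm (w (N + j)) < \<epsilon> * s (N + j)" using wb[of j] by simp
  then show ?thesis using N by (intro exI[of _ "N + j"]) simp
qed

end

section \<open>The basin of the original sequence\<close>

context normal_form
begin

primrec \<Gamma> :: "nat \<Rightarrow> nat \<Rightarrow> complex ^ 2 \<Rightarrow> complex ^ 2" where
  "\<Gamma> n0 0 = (\<lambda>W. W)"
| "\<Gamma> n0 (Suc m) = (\<lambda>W. g (n0 + m) (\<Gamma> n0 m W))"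

primrec \<Gamma>inv :: "nat \<Rightarrow> nat \<Rightarrow> complex ^ 2 \<Rightarrow> complex ^ 2" where
  "\<Gamma>inv n0 0 = (\<lambda>W. W)"
| "\<Gamma>inv n0 (Suc m) = (\<lambda>W. \<Gamma>inv n0 m (ginv (n0 + m) W))"

lemma g_biholomorphism:
  assumes "n1 \<le> n" shows "biholomorphism UNIV UNIV (g n) (ginv n)"
  unfolding biholomorphism_def
proof (intro conjI ballI)
  show "range (g n) = UNIV" by (rule surjI) (rule g_ginv[OF assms])
  show "range (ginv n) = UNIV" by (rule surjI) (rule ginv_g[OF assms])
qed (simp_all add: g_hol ginv_hol g_ginv ginv_g assms)

lemma Gamma_biholomorphism:
  assumes "n1 \<le> n0" shows "biholomorphism UNIV UNIV (\<Gamma> n0 m) (\<Gamma>inv n0 m)"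
proof (induction m)
  case 0
  show ?case unfolding biholomorphism_def by (simp add: holomorphic_map_on_id)
next
  case (Suc m)
  show ?case
    unfolding \<Gamma>.simps \<Gamma>inv.simps
    by (rule biholomorphism_compose[OF Suc g_biholomorphism]) (use assms in simp)
qed

text \<open>The point just before \<open>f n\<close> is applied. \<open>compose_upto f n\<close>
  already contains \<open>f n\<close>, so it equals \<open>orbit (Suc n)\<close>; the shift makes
  \<open>orbit 0\<close> the identity.\<close>

definition orbit :: "nat \<Rightarrow> complex ^ 2 \<Rightarrow> complex ^ 2"
  where "orbit n Z = (case n of 0 \<Rightarrow> Z | Suc m \<Rightarrow> compose_upto f m Z)"

lemma orbit_Suc: "orbit (Suc n) Z = f n (orbit n Z)"
  by (cases n) (simp_all add: orbit_def)

lemma orbit_automorphism: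
  assumes "\<And>n. holomorphic_automorphism (f n)" shows "holomorphic_automorphism (orbit n)"
proof (induction n)
  case 0
  have "orbit 0 = (\<lambda>Z. Z)" by (rule ext) (simp add: orbit_def)
  moreover have "biholomorphism UNIV UNIV (\<lambda>Z. Z) (\<lambda>Z. Z :: complex ^ 2)"
    unfolding biholomorphism_def by (simp add: holomorphic_map_on_id)
  ultimately show ?case unfolding holomorphic_automorphism_def by metis
next
  case (Suc n)
  obtain h h' where h: "biholomorphism UNIV UNIV (orbit n) h" "biholomorphism UNIV UNIV (f n) h'"
    using Suc assms[of n] unfolding holomorphic_automorphism_def by (elim exE) simp
  have "orbit (Suc n) = (\<lambda>Z. f n (orbit n Z))" by (rule ext) (rule orbit_Suc)
  then show ?case
    using biholomorphism_compose[OF h] unfolding holomorphic_automorphism_def by metis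
qed

lemma orbit_stays:
  assumes "s n \<le> 1/16" "norm (orbit n Z) < s n / 16"
  shows "norm (orbit (Suc n) Z) < s (Suc n) / 16"
proof -
  have "norm (orbit (Suc n) Z) \<le> D0 * norm (orbit n Z)"
    unfolding orbit_Suc by (rule f_le) (use assms in simp)
  also have "\<dots> \<le> D * norm (orbit n Z)" using D0 by (intro mult_right_mono) auto
  also have "\<dots> < D * (s n / 16)" using assms Dpos by (intro mult_strict_left_mono)
  finally show ?thesis by (simp add: s_Suc)
qed

text \<open>A convergent orbit eventually decays like \<open>D0 ^ n\<close> and so enters the balls
  of radius comparable to \<open>D ^ n\<close>; conversely each such ball is mapped into the
  next.\<close>

lemma basin_eq:
  assumes small: "\<And>n. n0 \<le> n \<Longrightarrow> s n \<le> 1/16"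
  shows "basin_of_attraction f = {Z. \<exists>m. orbit (n0 + m) Z \<in> ball 0 (s (n0 + m) / 16)}"
proof (intro set_eqI iffI)
  fix Z assume "Z \<in> basin_of_attraction f"
  then have "(\<lambda>n. orbit (Suc n) Z) \<longlonglongrightarrow> 0" by (simp add: basin_of_attraction_def orbit_def)
  then have lim: "(\<lambda>n. orbit n Z) \<longlonglongrightarrow> 0" by (rule LIMSEQ_imp_Suc)
  then have "\<forall>\<^sub>F n in sequentially. norm (orbit n Z) < 1"
    by (rule order_tendstoD(2)[OF tendsto_norm_zero]) simp
  then obtain N1 where N1: "\<And>n. N1 \<le> n \<Longrightarrow> norm (orbit n Z) < 1" unfolding eventually_sequentially by blast
  define N where "N = max n0 N1"
  have N: "n0 \<le> N" "\<And>n. N \<le> n \<Longrightarrow> norm (orbit n Z) < 1" using N1 by (auto simp: N_def)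
  have le: "norm (orbit (N + j) Z) \<le> D0 ^ j" for j
  proof (induction j)
    case (Suc j)
    have "norm (orbit (N + Suc j) Z) \<le> D0 * norm (orbit (N + j) Z)"
      using f_le[OF N(2)[of "N + j"]] by (simp add: orbit_Suc)
    also have "\<dots> \<le> D0 * D0 ^ j" using Suc D0 by (intro mult_left_mono) auto
    finally show ?case by simp
  qed (use N(2)[of N] in simp)
  have "(\<lambda>j. (D0 / D) ^ j) \<longlonglongrightarrow> 0" using D0 Dpos by (intro LIMSEQ_realpow_zero) auto
  then have "\<forall>\<^sub>F j in sequentially. (D0 / D) ^ j < D ^ N / 16"
    using Dpos by (intro order_tendstoD(2)) auto
  then obtain j where "(D0 / D) ^ j < D ^ N / 16" unfolding eventually_sequentially by blast
  then have "D0 ^ j < s (N + j) / 16"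
    using Dpos by (simp add: s_def power_divide power_add field_simps)
  then have "norm (orbit (N + j) Z) < s (N + j) / 16" using le[of j] by simp
  then show "Z \<in> {Z. \<exists>m. orbit (n0 + m) Z \<in> ball 0 (s (n0 + m) / 16)}"
    using N(1) by (intro CollectI exI[of _ "N + j - n0"]) simp
next
  fix Z assume "Z \<in> {Z. \<exists>m. orbit (n0 + m) Z \<in> ball 0 (s (n0 + m) / 16)}"
  then obtain m where m: "norm (orbit (n0 + m) Z) < s (n0 + m) / 16" by auto
  have in_ball: "norm (orbit (n0 + m + j) Z) < s (n0 + m + j) / 16" for j
  proof (induction j)
    case (Suc j)
    show ?case using orbit_stays[OF small Suc] by simp
  qed (use m in simp)
  have "norm (orbit n Z) \<le> s n" if "n0 + m \<le> n" for n
    using in_ball[of "n - (n0 + m)"] that s_pos[of n] by simp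
  then have "\<forall>\<^sub>F n in sequentially. norm (orbit n Z) \<le> s n" unfolding eventually_sequentially by blast
  then have "(\<lambda>n. orbit n Z) \<longlonglongrightarrow> 0" using s_tendsto by (rule Lim_null_comparison)
  then have "(\<lambda>n. orbit (Suc n) Z) \<longlonglongrightarrow> 0" by (rule LIMSEQ_Suc)
  then show "Z \<in> basin_of_attraction f" by (simp add: basin_of_attraction_def orbit_def)
qed

end

theorem (in train_normal_form) basin_biholomorphic:
  assumes aut: "\<And>n. holomorphic_automorphism (f n)"
  shows "biholomorphic (basin_of_attraction f) (UNIV :: (complex ^ 2) set)"
proof -
  obtain n0 G where n0: "n1 \<le> n0" "\<And>n. n0 \<le> n \<Longrightarrow> s n \<le> 1/16"
    and G: "\<And>n. n0 \<le> n \<Longrightarrow> holomorphic_map_on (G n) (ball 0 (s n / 8))"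
      "\<And>n Z. n0 \<le> n \<Longrightarrow> norm Z < s n / 8 \<Longrightarrow> norm (G n Z - Z) \<le> s n / 128"
      "\<And>n Z. n0 \<le> n \<Longrightarrow> norm Z < s n / 8 \<Longrightarrow> G (Suc n) (f n Z) = g n (G n Z)"
    using local_conjugacy by blast
  have near: "inj_on (G (n0 + m)) (ball 0 (s (n0 + m) / 16))"
    "ball 0 (s (n0 + m) / 64) \<subseteq> G (n0 + m) ` ball 0 (s (n0 + m) / 16)"
    "Z \<in> ball 0 (s (n0 + m) / 16) \<Longrightarrow> complex_linear L \<Longrightarrow> (G (n0 + m) has_derivative L) (at Z) \<Longrightarrow> L v = 0 \<Longrightarrow> v = 0"
    for m Z L v
  proof -
    have 1: "holomorphic_map_on (G (n0 + m)) (ball 0 (s (n0 + m) / 8))" by (rule G(1)) simp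
    have 2: "norm (G (n0 + m) Z - Z) \<le> s (n0 + m) / 128" if "norm Z < s (n0 + m) / 8" for Z
      by (rule G(2)) (use that in simp_all)
    note ni = near_identity[OF 1 s_pos 2]
    show "inj_on (G (n0 + m)) (ball 0 (s (n0 + m) / 16))"
      "ball 0 (s (n0 + m) / 64) \<subseteq> G (n0 + m) ` ball 0 (s (n0 + m) / 16)" by (rule ni; assumption)+
    show "v = 0" if "Z \<in> ball 0 (s (n0 + m) / 16)" "complex_linear L"
      "(G (n0 + m) has_derivative L) (at Z)" "L v = 0"
      using that by (rule ni(3)[rotated])
  qed
  have "biholomorphic {Z. \<exists>m. orbit (n0 + m) Z \<in> ball 0 (s (n0 + m) / 16)} (UNIV :: (complex ^ 2) set)"
  proof (rule glued_biholomorphism[where \<Phi> = "\<lambda>m. orbit (n0 + m)" and \<Gamma> = "\<Gamma> n0" and \<Gamma>i = "\<Gamma>inv n0"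
      and \<psi> = "\<lambda>m. G (n0 + m)" and b = "\<lambda>m. s (n0 + m) / 16"])
    show "holomorphic_automorphism (orbit (n0 + m))" for m by (rule orbit_automorphism[OF aut])
    show "biholomorphism UNIV UNIV (\<Gamma> n0 m) (\<Gamma>inv n0 m)" for m by (rule Gamma_biholomorphism[OF n0(1)])
  next
    fix m Z assume "orbit (n0 + m) Z \<in> ball 0 (s (n0 + m) / 16)"
    then have Z: "norm (orbit (n0 + m) Z) < s (n0 + m) / 16" by simp
    then show "orbit (n0 + Suc m) Z \<in> ball 0 (s (n0 + Suc m) / 16)"
      using orbit_stays[OF n0(2)] by simp
    have "norm (orbit (n0 + m) Z) < s (n0 + m) / 8" using Z s_pos[of "n0 + m"] by simp
    then have "G (Suc (n0 + m)) (f (n0 + m) (orbit (n0 + m) Z)) = g (n0 + m) (G (n0 + m) (orbit (n0 + m) Z))"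
      by (intro G(3)) simp
    then show "\<Gamma>inv n0 (Suc m) (G (n0 + Suc m) (orbit (n0 + Suc m) Z)) = \<Gamma>inv n0 m (G (n0 + m) (orbit (n0 + m) Z))"
      using n0(1) by (simp add: orbit_Suc ginv_g)
  next
    fix m
    show "holomorphic_map_on (G (n0 + m)) (ball 0 (s (n0 + m) / 16))"
      by (rule holomorphic_map_on_subset[OF G(1)]) (use s_pos[of "n0 + m"] in auto)
    show "inj_on (G (n0 + m)) (ball 0 (s (n0 + m) / 16))" by (rule near(1))
  next
    fix m Z L v
    assume "Z \<in> ball 0 (s (n0 + m) / 16)" "complex_linear L" "(G (n0 + m) has_derivative L) (at Z)" "L v = 0"
    then show "v = 0" by (rule near(3))
  next
    fix W
    \<comment> \<open>Covering amounts to following the normal form from \<open>W\<close> at time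
      \<open>n0\<close> until it enters the ball of radius \<open>s n / 64\<close>, which
      \<open>near_identity\<close> puts into the image of the conjugacy.\<close>
    define w where "w n = \<Gamma> n0 (n - n0) W" for n
    have "w (Suc n) = g n (w n)" if "n0 \<le> n" for n
      using that by (simp add: w_def Suc_diff_le)
    from orbit_enters[OF this n0(1), of "1/64"] obtain n where n: "n0 \<le> n" "norm (w n) < 1/64 * s n" by auto
    define m where "m = n - n0"
    have nm: "n = n0 + m" using n(1) by (simp add: m_def)
    have "\<Gamma> n0 m W \<in> ball 0 (s (n0 + m) / 64)" using n(2) unfolding nm w_def by simp
    moreover have "ball 0 (s (n0 + m) / 64) \<subseteq> G (n0 + m) ` ball 0 (s (n0 + m) / 16)"
      by (rule near(2))
    ultimately show "\<exists>m. \<Gamma> n0 m W \<in> G (n0 + m) ` ball 0 (s (n0 + m) / 16)" by blast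
  qed
  then show ?thesis by (simp only: basin_eq[of n0, OF n0(2)])
qed

theorem theorem3:
  fixes f :: "nat \<Rightarrow> complex ^ 2 \<Rightarrow> complex ^ 2"
    and C D :: real and k :: nat
  assumes "\<And>n. holomorphic_automorphism (f n)"
    and "uniformly_attracting C D f"
    and "\<And>n. order_of_contact k (f n)"
    and "\<And>n. diagonal_matrix (linear_part (f n))"
    and "D ^ (k + 1) < C"
  shows "biholomorphic (basin_of_attraction f) (UNIV :: (complex ^ 2) set)"
proof -
  have CD: "0 < C" "C < D" "D < 1" using assms(2) by (auto simp: uniformly_attracting_def)
  have att: "C * norm Z \<le> norm (f n Z) \<and> norm (f n Z) \<le> D * norm Z" if "norm Z < 1" for n Z
    using assms(2) that by (auto simp: uniformly_attracting_def)
  have k1: "1 \<le> k"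
  proof (rule ccontr)
    assume "\<not> 1 \<le> k"
    then have "k = 0" by simp
    then show False using assms(5) CD by simp
  qed
  \<comment> \<open>Order at least 2 is available for every holomorphic map after subtracting its
    derivative, and raising the exponent preserves the condition since \<open>D < 1\<close>.\<close>
  define k' where "k' = max 2 k"
  have "D ^ (k' + 1) \<le> D ^ (k + 1)" using CD by (intro power_decreasing) (auto simp: k'_def)
  then have Dk': "D ^ (k' + 1) < C" using assms(5) by simp
  \<comment> \<open>By continuity the strict inequality survives a slight increase of
    \<open>D\<close>. The gap between \<open>D\<close> and \<open>D'\<close> is what lets orbits
    decaying like \<open>D ^ n\<close> enter balls of radius \<open>D' ^ n / 16\<close>.\<close>
  have "((\<lambda>x. x ^ (k' + 1)) \<longlongrightarrow> D ^ (k' + 1)) (at_right D)" by (intro tendsto_intros)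
  then have "\<forall>\<^sub>F x in at_right D. x ^ (k' + 1) < C" using Dk' by (rule order_tendstoD(2))
  moreover have "\<forall>\<^sub>F x in at_right D. D < x \<and> x < 1"
    unfolding eventually_at_right_field using CD by (intro exI[of _ 1]) auto
  ultimately have "\<forall>\<^sub>F x in at_right D. x ^ (k' + 1) < C \<and> D < x \<and> x < 1" by eventually_elim simp
  then obtain D' where D': "D' ^ (k' + 1) < C" "D < D'" "D' < 1"
    using eventually_happens[of _ "at_right D"] by (auto simp: trivial_limit_at_right_real)
  define K :: real where "K = 2 * 40 ^ k'"
  have f_hol: "holomorphic_map_on (f n) UNIV" for n
    using assms(1)[of n] by (auto simp: holomorphic_automorphism_def biholomorphism_def)
  have "\<forall>n. \<exists>lp :: (2 \<Rightarrow> complex) \<times> (2 \<Rightarrow> complex). \<forall>i. C \<le> norm (fst lp i) \<and> norm (fst lp i) \<le> D \<and> norm (snd lp i) \<le> K \<and>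
    (\<forall>Z. norm Z \<le> 1/16 \<longrightarrow> norm (f n Z $ i - fst lp i * Z $ i) \<le> K * norm Z ^ k' \<and>
      norm (f n Z $ i - fst lp i * Z $ i - snd lp i * (Z $ (i + 1)) ^ k') \<le>
        K * (norm (Z $ i) * norm Z ^ (k' - 1) + norm Z ^ (k' + 1)))"
  proof
    fix n
    have "\<exists>l p. \<forall>i. C \<le> norm (l i) \<and> norm (l i) \<le> D \<and> norm (p i) \<le> 2 * 40 ^ k' \<and>
    (\<forall>Z. norm Z \<le> 1/16 \<longrightarrow> norm (f n Z $ i - l i * Z $ i) \<le> 2 * 40 ^ k' * norm Z ^ k' \<and>
      norm (f n Z $ i - l i * Z $ i - p i * (Z $ (i + 1)) ^ k') \<le>
        2 * 40 ^ k' * (norm (Z $ i) * norm Z ^ (k' - 1) + norm Z ^ (k' + 1)))"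
      by (rule diagonal_jet[OF f_hol att CD(3) assms(3) k1 assms(4) k'_def])
    then obtain l p where "\<forall>i. C \<le> norm (l i) \<and> norm (l i) \<le> D \<and> norm (p i) \<le> 2 * 40 ^ k' \<and>
    (\<forall>Z. norm Z \<le> 1/16 \<longrightarrow> norm (f n Z $ i - l i * Z $ i) \<le> 2 * 40 ^ k' * norm Z ^ k' \<and>
      norm (f n Z $ i - l i * Z $ i - p i * (Z $ (i + 1)) ^ k') \<le>
        2 * 40 ^ k' * (norm (Z $ i) * norm Z ^ (k' - 1) + norm Z ^ (k' + 1)))" by (elim exE)
    then show "\<exists>lp :: (2 \<Rightarrow> complex) \<times> (2 \<Rightarrow> complex). \<forall>i. C \<le> norm (fst lp i) \<and> norm (fst lp i) \<le> D \<and> norm (snd lp i) \<le> K \<and>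
    (\<forall>Z. norm Z \<le> 1/16 \<longrightarrow> norm (f n Z $ i - fst lp i * Z $ i) \<le> K * norm Z ^ k' \<and>
      norm (f n Z $ i - fst lp i * Z $ i - snd lp i * (Z $ (i + 1)) ^ k') \<le>
        K * (norm (Z $ i) * norm Z ^ (k' - 1) + norm Z ^ (k' + 1)))"
      unfolding K_def by (intro exI[of _ "(l, p)"]) simp
  qed
  from choice[OF this] obtain lp :: "nat \<Rightarrow> (2 \<Rightarrow> complex) \<times> (2 \<Rightarrow> complex)" where
    lp: "\<forall>n i. C \<le> norm (fst (lp n) i) \<and> norm (fst (lp n) i) \<le> D \<and> norm (snd (lp n) i) \<le> K \<and>
    (\<forall>Z. norm Z \<le> 1/16 \<longrightarrow> norm (f n Z $ i - fst (lp n) i * Z $ i) \<le> K * norm Z ^ k' \<and>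
      norm (f n Z $ i - fst (lp n) i * Z $ i - snd (lp n) i * (Z $ (i + 1)) ^ k') \<le>
        K * (norm (Z $ i) * norm Z ^ (k' - 1) + norm Z ^ (k' + 1)))" by (elim exE)
  define lam where "lam n = fst (lp n)" for n
  define p where "p n = snd (lp n)" for n
  have lp': "C \<le> norm (lam n i)" "norm (lam n i) \<le> D" "norm (p n i) \<le> K"
    "norm Z \<le> 1/16 \<Longrightarrow> norm (f n Z $ i - lam n i * Z $ i) \<le> K * norm Z ^ k'"
    "norm Z \<le> 1/16 \<Longrightarrow> norm (f n Z $ i - lam n i * Z $ i - p n i * (Z $ (i + 1)) ^ k') \<le>
        K * (norm (Z $ i) * norm Z ^ (k' - 1) + norm Z ^ (k' + 1))" for n i Z
    using lp unfolding lam_def p_def by simp_all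
  have K1: "1 \<le> K"
    using one_le_power[of "40::real" k'] unfolding K_def by linarith
  \<comment> \<open>The enlarged \<open>D'\<close> takes the place of the locale parameter
    \<open>D\<close>, and the given attraction constant \<open>D\<close> becomes
    \<open>D0\<close>.\<close>
  interpret J: diagonal_jets lam p C D' D K k'
    by unfold_locales (use CD D' lp' K1 in \<open>simp_all add: k'_def\<close>)
  obtain \<tau> T c q K' \<kappa> where T: "1 \<le> T 0" "\<forall>j. k' * T j \<le> T (Suc j)"
    "\<forall>j n. T j \<le> n \<and> n < T (Suc j) \<longrightarrow> \<tau> n = \<tau> (T j)"
    and q: "\<forall>n i. q n i = p n i + c (Suc n) i * lam n (i + 1) ^ k' - lam n i * c n i"
    and \<kappa>: "0 < \<kappa>" "\<kappa> < 1" "1 \<le> K'"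
    and qc: "\<forall>n\<ge>T 0. q n (\<tau> n) = 0 \<and> (\<forall>i. norm (q n i) \<le> K' \<and> norm (c n i) * (D' ^ n) ^ (k' - 1) \<le> K' * \<kappa> ^ n)"
    using J.normal_form_coefficients by blast
  interpret train_normal_form lam p C D' D K k' f \<tau> c q K' \<kappa> "T 0" T
  proof unfold_locales
    show "holomorphic_map_on (f n) UNIV" for n by (rule f_hol)
    show "norm Z < 1 \<Longrightarrow> norm (f n Z) \<le> D * norm Z" for n Z using att by blast
    show "norm Z \<le> 1/16 \<Longrightarrow> norm (f n Z $ i - lam n i * Z $ i) \<le> K * norm Z ^ k'" for n i Z by (rule lp'(4))
    show "norm Z \<le> 1/16 \<Longrightarrow> norm (f n Z $ i - lam n i * Z $ i - p n i * (Z $ (i + 1)) ^ k') \<le>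
        K * (norm (Z $ i) * norm Z ^ (k' - 1) + norm Z ^ (k' + 1))" for n i Z by (rule lp'(5))
    show "q n i = p n i + c (Suc n) i * lam n (i + 1) ^ k' - lam n i * c n i" for n i using q by blast
    show "0 < \<kappa>" "\<kappa> < 1" "1 \<le> K'" by fact+
    show "T 0 \<le> n \<Longrightarrow> q n (\<tau> n) = 0" for n using qc by blast
    show "T 0 \<le> n \<Longrightarrow> norm (q n i) \<le> K'" for n i using qc by blast
    show "T 0 \<le> n \<Longrightarrow> norm (c n i) * (D' ^ n) ^ (k' - 1) \<le> K' * \<kappa> ^ n" for n i using qc by blast
    show "T 0 = T 0" by simp
    show "1 \<le> T 0" by fact
    show "k' * T j \<le> T (Suc j)" for j using T(2) by blast
    show "T j \<le> n \<Longrightarrow> n < T (Suc j) \<Longrightarrow> \<tau> n = \<tau> (T j)" for j n using T(3) by blast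
  qed
  show ?thesis by (rule basin_biholomorphic[OF assms(1)])
qed

end
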